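(* Let $d\ge 2$ be an integer and let $l=(a_1,\ldots,a_m)$ be a list of integers with $2\le a_i\le d$ for every $i$. Then $l$ is the (unordered) list of ramification numbers at the critical points of some branched covering $\pi:\mathbb{S}^2\to\mathbb{S}^2$ of degree $d$ if and only if $$\sum_{i=1}^m (a_i-1)=2d-2 .$$
   Context: A map $\pi:\mathbb{S}^2\to\mathbb{S}^2$ is a branched covering of degree $d$ if there is a finite set $F\subset\mathbb{S}^2$ such that $\pi:\mathbb{S}^2\setminus\pi^{-1}(F)\to\mathbb{S}^2\setminus F$ is a covering map of degree $d$, and for each $x\in F$ there is a neighborhood $V$ of $x$ and, for each preimage $y$ of $x$, a neighborhood $U$ of $y$ such that $\pi|_U:U\to V$ is equivalent, up to topological changes of coordinates, to $z\mapsto z^k$ on the unit disc for some integer $k>0$. The integer $k$ is the ramification number of $y$ (it is $1$ at points where $\pi$ is a local homeomorphism); $y$ is a critical point if its ramification number is $>1$. The list of ramification numbers at the critical points has one entry for each critical point. *)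

theory Defs
  imports "HOL-Analysis.Analysis"
begin

abbreviation S2 :: "(real^3) set"
  where "S2 \<equiv> sphere 0 1"

text \<open>
  In suitable topological coordinates centred at \<open>y\<close> and at its image, the restriction
  of \<open>p\<close> to a map from \<open>U\<close> to \<open>V\<close> is \<open>z \<mapsto> z ^ k\<close> on the open unit disc. Since the
  model map is onto the disc, \<open>p ` U = V\<close> follows.
\<close>

definition power_model ::
    "(real^3 \<Rightarrow> real^3) \<Rightarrow> (real^3) set \<Rightarrow> (real^3) set \<Rightarrow> real^3 \<Rightarrow> nat \<Rightarrow> bool"
  where "power_model p U V y k \<longleftrightarrow>
    k > 0 \<and>
    openin (top_of_set S2) U \<and> y \<in> U \<and>
    openin (top_of_set S2) V \<and> p y \<in> V \<and>
    (\<exists>\<phi> \<phi>' \<psi> \<psi>'.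
       homeomorphism U (ball (0::complex) 1) \<phi> \<phi>' \<and> \<phi> y = 0 \<and>
       homeomorphism V (ball (0::complex) 1) \<psi> \<psi>' \<and> \<psi> (p y) = 0 \<and>
       (\<forall>u\<in>U. p u \<in> V \<and> \<psi> (p u) = \<phi> u ^ k))"

text \<open>
  Maps of the sphere are represented by functions on the ambient space, of which only the
  values on the sphere matter.
\<close>

definition branched_covering :: "nat \<Rightarrow> (real^3 \<Rightarrow> real^3) \<Rightarrow> bool"
  where "branched_covering d p \<longleftrightarrow>
    continuous_on S2 p \<and> p ` S2 \<subseteq> S2 \<and>
    (\<exists>F. finite F \<and> F \<subseteq> S2 \<and>
       covering_space (S2 - p -` F) p (S2 - F) \<and>
       (\<forall>x \<in> S2 - F. finite {y\<in>S2. p y = x} \<and> card {y\<in>S2. p y = x} = d) \<and>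
       (\<forall>x\<in>F. \<exists>V. openin (top_of_set S2) V \<and> x \<in> V \<and>
          (\<forall>y\<in>S2. p y = x \<longrightarrow> (\<exists>U k. power_model p U V y k))))"

text \<open>
  For a branched covering, each point of the sphere has exactly one such \<open>k\<close> (the number of
  preimages near \<open>y\<close> of a generic point near \<open>p y\<close>), and \<open>k = 1\<close> exactly
  where \<open>p\<close> is a local homeomorphism, in particular away from the preimage of \<open>F\<close>.
\<close>

definition ramification_number :: "(real^3 \<Rightarrow> real^3) \<Rightarrow> real^3 \<Rightarrow> nat"
  where "ramification_number p y = (THE k. \<exists>U V. power_model p U V y k)"

definition critical_points :: "(real^3 \<Rightarrow> real^3) \<Rightarrow> (real^3) set"
  where "critical_points p = {y\<in>S2. ramification_number p y > 1}"

text \<open>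
  The list is unordered: the enumeration \<open>ys\<close> of the critical points may be in any order.
\<close>

definition is_critical_ramification_list :: "(real^3 \<Rightarrow> real^3) \<Rightarrow> nat list \<Rightarrow> bool"
  where "is_critical_ramification_list p l \<longleftrightarrow>
    (\<exists>ys. distinct ys \<and> set ys = critical_points p \<and> l = map (ramification_number p) ys)"

end

theory Submission
  imports Defs
begin

text \<open>
  Necessity is the Riemann-Hurwitz formula. Let \<open>p\<close> be a branched covering of degree \<open>d\<close> with
  \<open>n\<close> branch values, and let \<open>n'\<close> be the number of points above them. The local degrees above one
  value add up to \<open>d\<close> (\<open>sum_local_degrees_eq_degree\<close>), so the sum of the \<open>k - 1\<close> is \<open>d n - n'\<close>,
  and what has to be shown is \<open>n' - 2 = d (n - 2)\<close>: the Euler characteristic of the punctured sphere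
  is multiplied by \<open>d\<close>.

  The Euler characteristic is detected by the group \<open>H(X)\<close> of continuous nonvanishing complex
  functions on \<open>X\<close> modulo squares, the first integral cohomology reduced modulo 2. If a connected
  \<open>X\<close> is the union of two open sets \<open>A\<close> and \<open>B\<close> on which square roots exist, a Mayer-Vietoris
  argument (\<open>card_square_classes_mayer_vietoris\<close>) expresses the size of \<open>H(X)\<close> by the numbers of
  clopen subsets of \<open>A\<close>, \<open>B\<close> and \<open>A \<inter> B\<close>. For a covering of degree \<open>d\<close> of the plane with \<open>m\<close>
  punctures take for \<open>A\<close> and \<open>B\<close> the parts above the plane slit vertically downwards, respectively
  upwards, from every puncture. Both slit planes are simply connected, hence covered by \<open>d\<close> sheets,
  and they meet in \<open>m + 1\<close> strips, so \<open>H(X)\<close> has \<open>2 ^ (d (m - 1) + 1)\<close> elements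
  (\<open>card_square_classes_covering\<close>). The sphere without the \<open>n'\<close> points covers a punctured plane in
  two ways: by \<open>p\<close>, with degree \<open>d\<close> and \<open>n - 1\<close> punctures, and by a stereographic projection, with
  degree 1 and \<open>n' - 1\<close> punctures. Comparing the two values gives the formula.

  For sufficiency, maps are built whose critical points lie on one great circle, the equator, which
  they send to itself. The elementary step \<open>real_branched_blow_up\<close> slits the domain along an arc of
  the equator between two points and glues in a copy of the target sphere slit along the image of
  that arc. The degree and the ramification numbers of the two end points grow by one, and nothing
  else changes. The step is possible whenever no critical point lies inside the arc. With
  \<open>\<delta> = a - 1\<close>, a list with sum \<open>2 N\<close> and entries at most \<open>N\<close> is reached from the zero list in
  \<open>N\<close> such steps: going backwards one may decrease two neighbouring positive entries, provided that
  all entries equal to \<open>N\<close> are among them (\<open>real_branched_exists\<close>). Such maps come with little more than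
  local injectivity off finitely many points; that they are branched coverings follows from the
  classification of the coverings of a punctured disc (\<open>power_model_of_punctured_covering\<close>), and
  their ramification numbers are found by counting preimages.
\<close>

section \<open>Clopen subsets and sheets over simply connected sets\<close>

text \<open>
  For a set with finitely many components, all of them open, there are \<open>2 ^ c\<close> of these, \<open>c\<close> being
  the number of components. Counting clopen sets avoids speaking of components.
\<close>

definition clopens :: "'a::topological_space set \<Rightarrow> 'a set set"
  where "clopens X = {T. openin (top_of_set X) T \<and> closedin (top_of_set X) T}"

lemma clopens_subset: "T \<in> clopens X \<Longrightarrow> T \<subseteq> X"
  by (auto simp: clopens_def dest: openin_imp_subset)

lemma clopens_iff_open_compl:
  assumes "T \<subseteq> X"
  shows "T \<in> clopens X \<longleftrightarrow> openin (top_of_set X) T \<and> openin (top_of_set X) (X - T)"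
  using assms by (auto simp: clopens_def closedin_def)

lemma clopens_Compl: "T \<in> clopens X \<Longrightarrow> X - T \<in> clopens X"
  using clopens_subset[of T X] by (auto simp: clopens_iff_open_compl double_diff)

lemma clopens_connected:
  assumes "connected X" "T \<in> clopens X"
  shows "T = {} \<or> T = X"
  using assms by (auto simp: clopens_def connected_clopen)

lemma clopens_vimage:
  assumes "continuous_on S f" "f \<in> S \<rightarrow> X" "T \<in> clopens X"
  shows "S \<inter> f -` T \<in> clopens S"
  using assms continuous_openin_preimage[of S f X T] continuous_closedin_preimage_gen[of S f X T]
  by (auto simp: clopens_def)

lemma clopens_connected_image:
  assumes "connected S" "continuous_on S f" "f \<in> S \<rightarrow> X" "T \<in> clopens X" "a \<in> S" "b \<in> S"
  shows "f a \<in> T \<longleftrightarrow> f b \<in> T"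
  using clopens_connected[OF assms(1) clopens_vimage[OF assms(2,3,4)]] assms(5,6) by auto

lemma continuous_on_openin_cover:
  fixes f :: "'a::metric_space \<Rightarrow> 'b::topological_space"
  assumes "\<And>x. x \<in> S \<Longrightarrow> \<exists>U. openin (top_of_set S) U \<and> x \<in> U \<and> continuous_on U f"
  shows "continuous_on S f"
  unfolding continuous_on_eq_continuous_within
proof
  fix x assume "x \<in> S"
  then obtain U where U: "openin (top_of_set S) U" "x \<in> U" "continuous_on U f"
    using assms by blast
  then obtain O' where "open O'" "U = S \<inter> O'" by (auto simp: openin_open)
  then have "at x within S = at x within U"
    using U(2) by (intro at_within_nhd[of x O']) auto
  then show "continuous (at x within S) f"
    using U by (simp add: continuous_on_eq_continuous_within)
qed

lemma continuous_on_clopen_cases: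
  fixes f g :: "'a::metric_space \<Rightarrow> 'b::topological_space"
  assumes "T \<in> clopens S" "continuous_on S f" "continuous_on S g"
  shows "continuous_on S (\<lambda>x. if x \<in> T then f x else g x)"
proof (rule continuous_on_openin_cover)
  fix x assume "x \<in> S"
  show "\<exists>U. openin (top_of_set S) U \<and> x \<in> U \<and> continuous_on U (\<lambda>x. if x \<in> T then f x else g x)"
  proof (cases "x \<in> T")
    case True
    have "continuous_on T (\<lambda>x. if x \<in> T then f x else g x)"
      using continuous_on_subset[OF assms(2) clopens_subset[OF assms(1)]]
      by (rule continuous_on_eq) auto
    then show ?thesis using True assms(1) by (auto simp: clopens_def)
  next
    case False
    have "continuous_on (S - T) (\<lambda>x. if x \<in> T then f x else g x)"
      using continuous_on_subset[OF assms(3), of "S - T"] by (rule continuous_on_eq) auto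
    then show ?thesis using False assms(1) clopens_Compl[OF assms(1)] \<open>x \<in> S\<close>
      by (auto simp: clopens_def)
  qed
qed

lemma card_clopens_disjoint_Un:
  assumes "openin (top_of_set (Y \<union> Z)) Y" "openin (top_of_set (Y \<union> Z)) Z" "Y \<inter> Z = {}"
  shows "card (clopens (Y \<union> Z)) = card (clopens Y) * card (clopens Z)"
proof -
  let ?f = "\<lambda>T. (T \<inter> Y, T \<inter> Z)"
  have Y: "Y \<in> clopens (Y \<union> Z)" and Z: "Z \<in> clopens (Y \<union> Z)"
    using assms by (auto simp: clopens_iff_open_compl Un_Diff Int_Un_distrib2 Diff_triv Int_commute)
  have res: "T \<inter> W \<in> clopens W" if "T \<in> clopens (Y \<union> Z)" "W = Y \<or> W = Z" for T W
  proof -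
    have "W \<inter> id -` T \<in> clopens W"
      by (rule clopens_vimage[of W id "Y \<union> Z" T]) (use that in \<open>auto simp: continuous_on_id\<close>)
    then show ?thesis by (simp add: Int_commute)
  qed
  have ext: "T1 \<union> T2 \<in> clopens (Y \<union> Z)" if "T1 \<in> clopens Y" "T2 \<in> clopens Z" for T1 T2
  proof -
    have "openin (top_of_set (Y \<union> Z)) T1" "openin (top_of_set (Y \<union> Z)) (Y - T1)"
      "openin (top_of_set (Y \<union> Z)) T2" "openin (top_of_set (Y \<union> Z)) (Z - T2)"
      using that assms clopens_Compl[OF that(1)] clopens_Compl[OF that(2)]
      by (auto simp: clopens_def intro: openin_trans)
    moreover have "Y \<union> Z - (T1 \<union> T2) = (Y - T1) \<union> (Z - T2)"
      using that[THEN clopens_subset] assms(3) by blast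
    ultimately show ?thesis
      using that[THEN clopens_subset] by (subst clopens_iff_open_compl) auto
  qed
  have "bij_betw ?f (clopens (Y \<union> Z)) (clopens Y \<times> clopens Z)"
  proof (rule bij_betw_byWitness[where f' = "\<lambda>(T1, T2). T1 \<union> T2"])
    show "\<forall>T\<in>clopens (Y \<union> Z). (\<lambda>(T1, T2). T1 \<union> T2) (?f T) = T"
    proof
      fix T assume "T \<in> clopens (Y \<union> Z)"
      from clopens_subset[OF this] show "(\<lambda>(T1, T2). T1 \<union> T2) (?f T) = T" by auto
    qed
    show "\<forall>p\<in>clopens Y \<times> clopens Z. ?f ((\<lambda>(T1, T2). T1 \<union> T2) p) = p"
    proof
      fix p assume "p \<in> clopens Y \<times> clopens Z"
      then obtain T1 T2 where "p = (T1, T2)" "T1 \<subseteq> Y" "T2 \<subseteq> Z"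
        using clopens_subset by blast
      then show "?f ((\<lambda>(T1, T2). T1 \<union> T2) p) = p" using assms(3) by auto
    qed
  qed (use res ext in auto)
  then show ?thesis
    by (simp add: bij_betw_same_card card_cartesian_product)
qed

text \<open>
  Vanishing of the first integral cohomology modulo 2, in terms of functions.
\<close>

definition has_square_roots :: "'a::topological_space set \<Rightarrow> bool"
  where "has_square_roots X \<longleftrightarrow>
    (\<forall>f::'a \<Rightarrow> complex. continuous_on X f \<and> (\<forall>x\<in>X. f x \<noteq> 0) \<longrightarrow>
      (\<exists>g. continuous_on X g \<and> (\<forall>x\<in>X. f x = g x ^ 2)))"

text \<open>
  Over a simply connected set the inclusion lifts through every point of the fibre over \<open>a0\<close>; the
  lift through \<open>y\<close> is \<open>s y\<close>, and \<open>r x\<close> is the point in which the sheet containing \<open>x\<close> meets that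
  fibre. Each sheet is closed, being the set where \<open>s y \<circ> q\<close> and the identity agree. As there are
  finitely many sheets, each is open too.
\<close>

lemma covering_sheets:
  fixes q :: "'a::real_normed_vector \<Rightarrow> 'b::real_normed_vector"
  assumes cov: "covering_space X q Z" and AZ: "A \<subseteq> Z"
    and sc: "simply_connected A" "locally path_connected A" and a0: "a0 \<in> A"
    and fin: "finite {x\<in>X. q x = a0}"
  obtains s r where
    "\<And>y. y \<in> X \<Longrightarrow> q y = a0 \<Longrightarrow> continuous_on A (s y) \<and> s y \<in> A \<rightarrow> X \<inter> q -` A \<and> (\<forall>a\<in>A. q (s y a) = a) \<and> s y a0 = y"
    "\<And>x. x \<in> X \<inter> q -` A \<Longrightarrow> r x \<in> X \<and> q (r x) = a0 \<and> s (r x) (q x) = x"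
    "\<And>y. y \<in> X \<Longrightarrow> q y = a0 \<Longrightarrow> r y = y"
    "\<And>y. y \<in> X \<Longrightarrow> q y = a0 \<Longrightarrow> openin (top_of_set (X \<inter> q -` A)) {x \<in> X \<inter> q -` A. r x = y}"
proof -
  have conn: "connected A"
    using sc(1) by (rule simply_connected_imp_connected)
  have "\<exists>s. continuous_on A s \<and> s \<in> A \<rightarrow> X \<and> s a = y \<and> (\<forall>a\<in>A. q (s a) = a)"
    if "y \<in> X" "q y = a" "a \<in> A" for y a
    using covering_space_lift_strong[OF cov that(1,3) sc continuous_on_id, of]
      that AZ by (metis Pi_I subsetD)
  then obtain \<sigma> where \<sigma>: "\<And>y a. y \<in> X \<Longrightarrow> q y = a \<Longrightarrow> a \<in> A \<Longrightarrow>
      continuous_on A (\<sigma> y) \<and> \<sigma> y \<in> A \<rightarrow> X \<and> \<sigma> y a = y \<and> (\<forall>a\<in>A. q (\<sigma> y a) = a)"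
    by metis
  have uniq: "f c = g c" if "continuous_on A f" "f \<in> A \<rightarrow> X" "\<forall>a\<in>A. q (f a) = a"
    "continuous_on A g" "g \<in> A \<rightarrow> X" "\<forall>a\<in>A. q (g a) = a" "b \<in> A" "f b = g b" "c \<in> A" for f g b c
    by (rule covering_space_lift_unique[OF cov, of f b g A id c])
       (use that AZ conn in \<open>auto simp: continuous_on_id\<close>)
  define r where "r = (\<lambda>x. \<sigma> x a0)"
  let ?XA = "X \<inter> q -` A"
  have s: "continuous_on A (\<sigma> y) \<and> \<sigma> y \<in> A \<rightarrow> ?XA \<and> (\<forall>a\<in>A. q (\<sigma> y a) = a) \<and> \<sigma> y a0 = y"
    if "y \<in> X" "q y = a0" for y
    using \<sigma>[OF that a0] by auto
  have r: "r x \<in> X \<and> q (r x) = a0 \<and> \<sigma> (r x) (q x) = x" if "x \<in> ?XA" for x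
  proof -
    have x: "x \<in> X" "q x \<in> A" using that by auto
    note * = \<sigma>[OF x(1) refl x(2)]
    have r: "r x \<in> X" "q (r x) = a0" using * a0 by (auto simp: r_def)
    have "\<sigma> (r x) (q x) = \<sigma> x (q x)"
      by (rule uniq[of _ _ a0]) (use * \<sigma>[OF r a0] x a0 in \<open>auto simp: r_def\<close>)
    then show ?thesis using r * by auto
  qed
  have ry: "r y = y" if "y \<in> X" "q y = a0" for y
    using s[OF that] by (simp add: r_def)
  have sheet: "{x \<in> ?XA. r x = y} = {x \<in> ?XA. \<sigma> y (q x) - x = 0}" if y: "y \<in> X" "q y = a0" for y
  proof -
    have "r x = y" if x: "x \<in> ?XA" "\<sigma> y (q x) = x" for x
    proof -
      have "\<sigma> x a0 = \<sigma> y a0"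
        by (rule uniq[of _ _ "q x"]) (use x a0 \<sigma>[OF y a0] \<sigma>[of x "q x"] in auto)
      then show ?thesis using \<sigma>[OF y a0] by (simp add: r_def)
    qed
    then show ?thesis using r by auto
  qed
  have closed: "closedin (top_of_set ?XA) {x \<in> ?XA. r x = y}" if y: "y \<in> X" "q y = a0" for y
    unfolding sheet[OF y]
  proof (rule continuous_closedin_preimage_constant)
    have "continuous_on ?XA q"
      using covering_space_imp_continuous[OF cov] by (rule continuous_on_subset) auto
    moreover have "continuous_on A (\<sigma> y)" using s[OF y] by simp
    ultimately have "continuous_on ?XA (\<lambda>x. \<sigma> y (q x))"
      by (intro continuous_on_compose2[of A "\<sigma> y" ?XA q]) auto
    then show "continuous_on ?XA (\<lambda>x. \<sigma> y (q x) - x)"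
      by (intro continuous_intros)
  qed
  have "openin (top_of_set ?XA) {x \<in> ?XA. r x = y}" if y: "y \<in> X" "q y = a0" for y
  proof -
    let ?F = "{x\<in>X. q x = a0} - {y}"
    have "closedin (top_of_set ?XA) (\<Union>z\<in>?F. {x \<in> ?XA. r x = z})"
      using fin closed by (intro closedin_Union) auto
    then have "openin (top_of_set ?XA) (?XA - (\<Union>z\<in>?F. {x \<in> ?XA. r x = z}))"
      by (intro openin_diff openin_subtopology_self)
    moreover have "?XA - (\<Union>z\<in>?F. {x \<in> ?XA. r x = z}) = {x \<in> ?XA. r x = y}"
      using r by auto
    ultimately show ?thesis by simp
  qed
  then show ?thesis using that s r ry by blast
qed

text \<open>
  Sheets are connected, so a clopen set is a union of sheets and is determined by its trace on one
  fibre.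
\<close>

lemma card_clopens_over_simply_connected:
  fixes q :: "'a::real_normed_vector \<Rightarrow> 'b::real_normed_vector"
  assumes cov: "covering_space X q Z" and AZ: "A \<subseteq> Z"
    and sc: "simply_connected A" "locally path_connected A" and a0: "a0 \<in> A"
    and fin: "finite {x\<in>X. q x = a0}"
  shows "card (clopens (X \<inter> q -` A)) = 2 ^ card {x\<in>X. q x = a0}"
proof -
  obtain s r where s: "\<And>y. y \<in> X \<Longrightarrow> q y = a0 \<Longrightarrow> continuous_on A (s y) \<and> s y \<in> A \<rightarrow> X \<inter> q -` A \<and> (\<forall>a\<in>A. q (s y a) = a) \<and> s y a0 = y"
    and r: "\<And>x. x \<in> X \<inter> q -` A \<Longrightarrow> r x \<in> X \<and> q (r x) = a0 \<and> s (r x) (q x) = x"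
    and ry: "\<And>y. y \<in> X \<Longrightarrow> q y = a0 \<Longrightarrow> r y = y"
    and op: "\<And>y. y \<in> X \<Longrightarrow> q y = a0 \<Longrightarrow> openin (top_of_set (X \<inter> q -` A)) {x \<in> X \<inter> q -` A. r x = y}"
    by (rule covering_sheets[OF assms]) (rule that)
  let ?XA = "X \<inter> q -` A" and ?F = "{x\<in>X. q x = a0}"
  have conn: "connected A"
    using sc(1) by (rule simply_connected_imp_connected)
  have opB: "openin (top_of_set ?XA) {x \<in> ?XA. r x \<in> B}" if "B \<subseteq> ?F" for B
  proof -
    have "{x \<in> ?XA. r x \<in> B} = (\<Union>y\<in>B. {x \<in> ?XA. r x = y})" by auto
    moreover have "openin (top_of_set ?XA) (\<Union>y\<in>B. {x \<in> ?XA. r x = y})"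
      using op that by (intro openin_Union) auto
    ultimately show ?thesis by simp
  qed
  have "bij_betw (\<lambda>T. T \<inter> ?F) (clopens ?XA) (Pow ?F)"
  proof (rule bij_betw_byWitness[where f' = "\<lambda>B. {x \<in> ?XA. r x \<in> B}"])
    have *: "x \<in> T \<longleftrightarrow> r x \<in> T" if T: "T \<in> clopens ?XA" and x: "x \<in> ?XA" for T x
    proof -
      have rx: "r x \<in> X" "q (r x) = a0" and e: "s (r x) (q x) = x" using r[OF x] by auto
      have "s (r x) (q x) \<in> T \<longleftrightarrow> s (r x) a0 \<in> T"
        by (rule clopens_connected_image[OF conn _ _ T]) (use s[OF rx] a0 x in auto)
      then show ?thesis using s[OF rx] e by simp
    qed
    show "\<forall>T\<in>clopens ?XA. {x \<in> ?XA. r x \<in> T \<inter> ?F} = T"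
    proof (intro ballI set_eqI)
      fix T x assume T: "T \<in> clopens ?XA"
      have "x \<in> ?XA \<and> r x \<in> T \<inter> ?F \<longleftrightarrow> x \<in> ?XA \<and> x \<in> T"
        using *[OF T, of x] r[of x] by blast
      then show "x \<in> {x \<in> ?XA. r x \<in> T \<inter> ?F} \<longleftrightarrow> x \<in> T"
        using clopens_subset[OF T] by blast
    qed
    show "\<forall>B\<in>Pow ?F. {x \<in> ?XA. r x \<in> B} \<inter> ?F = B"
    proof (intro ballI set_eqI)
      fix B y assume "B \<in> Pow ?F"
      then have "y \<in> B \<Longrightarrow> y \<in> ?F" by blast
      then show "y \<in> {x \<in> ?XA. r x \<in> B} \<inter> ?F \<longleftrightarrow> y \<in> B"
        using ry[of y] a0 by auto
    qed
    have "{x \<in> ?XA. r x \<in> B} \<in> clopens ?XA" if "B \<subseteq> ?F" for B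
    proof -
      have "?XA - {x \<in> ?XA. r x \<in> B} = {x \<in> ?XA. r x \<in> ?F - B}" using r by auto
      then show ?thesis using opB[OF that] opB[of "?F - B"] by (subst clopens_iff_open_compl) auto
    qed
    then show "(\<lambda>B. {x \<in> ?XA. r x \<in> B}) ` Pow ?F \<subseteq> clopens ?XA" by auto
  qed auto
  then show ?thesis using fin by (simp add: bij_betw_same_card card_Pow)
qed

text \<open>
  Every sheet is a copy of \<open>A\<close>, where a square root exists; the sheets being open, the roots on the
  sheets combine to a continuous function.
\<close>

lemma has_square_roots_over_simply_connected:
  fixes q :: "'a::real_normed_vector \<Rightarrow> 'b::real_normed_vector"
  assumes cov: "covering_space X q Z" and AZ: "A \<subseteq> Z"
    and sc: "simply_connected A" "locally path_connected A" and a0: "a0 \<in> A"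
    and fin: "finite {x\<in>X. q x = a0}"
  shows "has_square_roots (X \<inter> q -` A)"
proof -
  obtain s r where s: "\<And>y. y \<in> X \<Longrightarrow> q y = a0 \<Longrightarrow> continuous_on A (s y) \<and> s y \<in> A \<rightarrow> X \<inter> q -` A \<and> (\<forall>a\<in>A. q (s y a) = a) \<and> s y a0 = y"
    and r: "\<And>x. x \<in> X \<inter> q -` A \<Longrightarrow> r x \<in> X \<and> q (r x) = a0 \<and> s (r x) (q x) = x"
    and ry: "\<And>y. y \<in> X \<Longrightarrow> q y = a0 \<Longrightarrow> r y = y"
    and op: "\<And>y. y \<in> X \<Longrightarrow> q y = a0 \<Longrightarrow> openin (top_of_set (X \<inter> q -` A)) {x \<in> X \<inter> q -` A. r x = y}"
    by (rule covering_sheets[OF assms]) (rule that)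
  let ?XA = "X \<inter> q -` A"
  show ?thesis unfolding has_square_roots_def
  proof (intro allI impI)
    fix f :: "'a \<Rightarrow> complex" assume f: "continuous_on ?XA f \<and> (\<forall>x\<in>?XA. f x \<noteq> 0)"
    have "\<exists>g. continuous_on A g \<and> (\<forall>a\<in>A. f (s y a) = g a ^ 2)" if y: "y \<in> X" "q y = a0" for y
    proof -
      have "continuous_on A (\<lambda>a. f (s y a))"
        by (rule continuous_on_compose2[of ?XA f]) (use f s[OF y] in auto)
      moreover have "f (s y a) \<noteq> 0" if "a \<in> A" for a
        using f s[OF y] that by (auto simp: Pi_iff)
      ultimately show ?thesis
        using continuous_sqrt_on_simply_connected[OF _ sc] by metis
    qed
    then obtain g where g: "\<And>y. y \<in> X \<Longrightarrow> q y = a0 \<Longrightarrow> continuous_on A (g y) \<and> (\<forall>a\<in>A. f (s y a) = g y a ^ 2)"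
      by metis
    have "continuous_on ?XA (\<lambda>x. g (r x) (q x))"
    proof (rule continuous_on_openin_cover)
      fix x assume x: "x \<in> ?XA"
      have y: "r x \<in> X" "q (r x) = a0" using r[OF x] by auto
      let ?U = "{z \<in> ?XA. r z = r x}"
      have "continuous_on ?U q"
        using covering_space_imp_continuous[OF cov] by (rule continuous_on_subset) auto
      then have "continuous_on ?U (\<lambda>z. g (r x) (q z))"
        by (intro continuous_on_compose2[of A "g (r x)" ?U q]) (use g[OF y] in auto)
      then have "continuous_on ?U (\<lambda>z. g (r z) (q z))"
        by (rule continuous_on_eq) auto
      then show "\<exists>U. openin (top_of_set ?XA) U \<and> x \<in> U \<and> continuous_on U (\<lambda>x. g (r x) (q x))"
        using op[OF y] x by blast
    qed
    moreover have "\<forall>x\<in>?XA. f x = g (r x) (q x) ^ 2"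
      using r g by (metis IntD2 vimageE)
    ultimately show "\<exists>g. continuous_on ?XA g \<and> (\<forall>x\<in>?XA. f x = g x ^ 2)" by blast
  qed
qed

section \<open>Counting square classes of nonvanishing functions\<close>

definition nonvanishing :: "'a::topological_space set \<Rightarrow> ('a \<Rightarrow> complex) set"
  where "nonvanishing X = {f. continuous_on X f \<and> (\<forall>x\<in>X. f x \<noteq> 0)}"

definition square_rel :: "'a::topological_space set \<Rightarrow> (('a \<Rightarrow> complex) \<times> ('a \<Rightarrow> complex)) set"
  where "square_rel X = {(f, g). f \<in> nonvanishing X \<and> g \<in> nonvanishing X \<and>
    (\<exists>s. continuous_on X s \<and> (\<forall>x\<in>X. f x = g x * s x ^ 2))}"

text \<open>
  By the exponential sequence, nonvanishing functions modulo exponentials form the first integral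
  cohomology of \<open>X\<close>. Exponentials are squares, so these classes form its reduction modulo 2.
\<close>

definition square_classes :: "'a::topological_space set \<Rightarrow> ('a \<Rightarrow> complex) set set"
  where "square_classes X = nonvanishing X // square_rel X"

lemma equiv_square_rel: "equiv (nonvanishing X) (square_rel X)"
proof (rule equivI)
  show "square_rel X \<subseteq> nonvanishing X \<times> nonvanishing X"
    by (auto simp: square_rel_def)
  show "refl_on (nonvanishing X) (square_rel X)"
    by (auto simp: square_rel_def refl_on_def intro!: exI[of _ "\<lambda>x. 1"])
  show "sym (square_rel X)"
  proof (rule symI)
    fix f g assume "(f, g) \<in> square_rel X"
    then obtain s where s: "f \<in> nonvanishing X" "g \<in> nonvanishing X" "continuous_on X s"
      "\<forall>x\<in>X. f x = g x * s x ^ 2" by (auto simp: square_rel_def)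
    then have "\<forall>x\<in>X. s x \<noteq> 0" by (auto simp: nonvanishing_def)
    with s have "continuous_on X (\<lambda>x. inverse (s x))" "\<forall>x\<in>X. g x = f x * inverse (s x) ^ 2"
      by (auto intro!: continuous_intros simp: field_simps)
    then show "(g, f) \<in> square_rel X" using s unfolding square_rel_def by blast
  qed
  show "trans (square_rel X)"
  proof (rule transI)
    fix f g h assume "(f, g) \<in> square_rel X" "(g, h) \<in> square_rel X"
    then obtain s t where s: "f \<in> nonvanishing X" "h \<in> nonvanishing X" "continuous_on X s"
      "\<forall>x\<in>X. f x = g x * s x ^ 2" "continuous_on X t" "\<forall>x\<in>X. g x = h x * t x ^ 2"
      unfolding square_rel_def by blast
    then have "continuous_on X (\<lambda>x. t x * s x)" "\<forall>x\<in>X. f x = h x * (t x * s x) ^ 2"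
      by (auto intro!: continuous_intros simp: power_mult_distrib)
    then show "(f, h) \<in> square_rel X" using s unfolding square_rel_def by blast
  qed
qed

definition sgn_on :: "'a set \<Rightarrow> 'a \<Rightarrow> complex"
  where "sgn_on T x = (if x \<in> T then -1 else 1)"

lemma sgn_on_simps [simp]: "sgn_on T x ^ 2 = 1" "sgn_on T x \<noteq> 0" "sgn_on T x * sgn_on T x = 1"
  by (auto simp: sgn_on_def)

lemma continuous_on_sgn_on:
  fixes T :: "'a::metric_space set"
  shows "T \<in> clopens X \<Longrightarrow> continuous_on X (sgn_on T)"
  unfolding sgn_on_def by (intro continuous_on_clopen_cases continuous_on_const)

text \<open>
  Two square roots of the same nonvanishing function differ by a locally constant sign.
\<close>

lemma disagreement_clopen:
  fixes u v :: "'a::topological_space \<Rightarrow> complex"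
  assumes "continuous_on X u" "continuous_on X v" "\<And>x. x \<in> X \<Longrightarrow> u x ^ 2 = v x ^ 2"
    "\<And>x. x \<in> X \<Longrightarrow> u x \<noteq> 0"
  shows "{x\<in>X. u x \<noteq> v x} \<in> clopens X"
proof -
  have e: "u x = v x \<or> u x = - v x" if "x \<in> X" for x
    using assms(3)[OF that] by (simp add: power2_eq_iff)
  have "closedin (top_of_set X) {x\<in>X. u x + v x = 0}" "closedin (top_of_set X) {x\<in>X. u x - v x = 0}"
    by (intro continuous_closedin_preimage_constant continuous_intros assms)+
  moreover have "{x\<in>X. u x + v x = 0} = {x\<in>X. u x \<noteq> v x}"
    using e assms(4) by (auto simp: add_eq_0_iff2)
  moreover have "X - {x\<in>X. u x \<noteq> v x} = {x\<in>X. u x - v x = 0}" by auto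
  ultimately show ?thesis
    by (simp add: clopens_def openin_closedin_eq)
qed

text \<open>
  A function \<open>f\<close> has square roots \<open>u\<close> on \<open>A\<close> and \<open>v\<close> on \<open>B\<close>; on \<open>A \<inter> B\<close> they differ by a sign,
  recorded by the clopen set where they disagree. The choices are the class of \<open>f\<close> and the signs of
  \<open>u\<close> and \<open>v\<close>. Normalising the sign of \<open>u\<close> at one point makes the correspondence with the clopen
  subsets of \<open>A \<inter> B\<close> bijective: two choices with the same disagreement set have quotients that fit
  together to a square root of \<open>f1 / f2\<close> on \<open>X\<close>, and every clopen set \<open>T\<close> arises by writing the
  indicator of \<open>T\<close> as a difference of functions continuous on \<open>A\<close> and on \<open>B\<close>.
\<close>

theorem card_square_classes_mayer_vietoris:
  fixes X :: "'a::euclidean_space set"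
  assumes opA: "openin (top_of_set X) A" and opB: "openin (top_of_set X) B" and AB: "A \<union> B = X"
    and conn: "connected X" and a0: "a0 \<in> A"
    and rootA: "has_square_roots A" and rootB: "has_square_roots B"
    and finA: "finite (clopens A)"
  shows "card (square_classes X) * card (clopens A) * card (clopens B) = 2 * card (clopens (A \<inter> B))"
proof -
  have sub: "A \<subseteq> X" "B \<subseteq> X" using AB by auto
  define rep where "rep = (\<lambda>h::('a \<Rightarrow> complex) set. SOME f. f \<in> h)"
  have rep: "rep h \<in> h" "rep h \<in> nonvanishing X" if "h \<in> square_classes X" for h
  proof -
    have "h \<noteq> {}" using that equiv_square_rel in_quotient_imp_non_empty unfolding square_classes_def by blast
    then show "rep h \<in> h" unfolding rep_def by (simp add: some_in_eq)
    then show "rep h \<in> nonvanishing X"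
      using that equiv_square_rel in_quotient_imp_subset unfolding square_classes_def by blast
  qed
  have "\<exists>u. continuous_on A u \<and> (\<forall>x\<in>A. rep h x = u x ^ 2)" if "h \<in> square_classes X" for h
    using rootA rep(2)[OF that] sub continuous_on_subset[of X "rep h" A]
    unfolding has_square_roots_def nonvanishing_def by blast
  then obtain u where u: "\<And>h. h \<in> square_classes X \<Longrightarrow> continuous_on A (u h)"
      "\<And>h x. h \<in> square_classes X \<Longrightarrow> x \<in> A \<Longrightarrow> rep h x = u h x ^ 2" by metis
  have "\<exists>v. continuous_on B v \<and> (\<forall>x\<in>B. rep h x = v x ^ 2)" if "h \<in> square_classes X" for h
    using rootB rep(2)[OF that] sub continuous_on_subset[of X "rep h" B]
    unfolding has_square_roots_def nonvanishing_def by blast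
  then obtain v where v: "\<And>h. h \<in> square_classes X \<Longrightarrow> continuous_on B (v h)"
      "\<And>h x. h \<in> square_classes X \<Longrightarrow> x \<in> B \<Longrightarrow> rep h x = v h x ^ 2" by metis
  have u0: "u h x \<noteq> 0" if "h \<in> square_classes X" "x \<in> A" for h x
    using rep(2)[OF that(1)] u(2)[OF that] that(2) sub by (auto simp: nonvanishing_def)
  have v0: "v h x \<noteq> 0" if "h \<in> square_classes X" "x \<in> B" for h x
    using rep(2)[OF that(1)] v(2)[OF that] that(2) sub by (auto simp: nonvanishing_def)
  define U where "U = (\<lambda>h T x. u h x * sgn_on T x)"
  define V where "V = (\<lambda>h T x. v h x * sgn_on T x)"
  have U: "continuous_on A (U h T)" "\<And>x. x \<in> A \<Longrightarrow> U h T x ^ 2 = rep h x" "\<And>x. x \<in> A \<Longrightarrow> U h T x \<noteq> 0"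
    if "h \<in> square_classes X" "T \<in> clopens A" for h T
    using u[OF that(1)] u0[OF that(1)] continuous_on_sgn_on[OF that(2)]
    by (auto simp: U_def power_mult_distrib intro!: continuous_intros)
  have V: "continuous_on B (V h T)" "\<And>x. x \<in> B \<Longrightarrow> V h T x ^ 2 = rep h x" "\<And>x. x \<in> B \<Longrightarrow> V h T x \<noteq> 0"
    if "h \<in> square_classes X" "T \<in> clopens B" for h T
    using v[OF that(1)] v0[OF that(1)] continuous_on_sgn_on[OF that(2)]
    by (auto simp: V_def power_mult_distrib intro!: continuous_intros)
  \<comment> \<open>all choices, the sign of u being fixed at a0\<close>
  define D where "D = square_classes X \<times> {T \<in> clopens A. a0 \<notin> T} \<times> clopens B"
  define \<Theta> where "\<Theta> = (\<lambda>(h, TA, TB). {x \<in> A \<inter> B. U h TA x \<noteq> V h TB x})"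
  have inj: "inj_on \<Theta> D"
  proof (rule inj_onI)
    fix t1 t2 assume t: "t1 \<in> D" "t2 \<in> D" and \<Theta>eq: "\<Theta> t1 = \<Theta> t2"
    obtain h1 TA1 TB1 where t1: "t1 = (h1, TA1, TB1)" by (cases t1)
    obtain h2 TA2 TB2 where t2: "t2 = (h2, TA2, TB2)" by (cases t2)
    have h: "h1 \<in> square_classes X" "h2 \<in> square_classes X"
      and TA: "TA1 \<in> clopens A" "TA2 \<in> clopens A" and nin: "a0 \<notin> TA1" "a0 \<notin> TA2"
      and TB: "TB1 \<in> clopens B" "TB2 \<in> clopens B"
      using t by (auto simp: D_def t1 t2)
    have eq: "{x \<in> A \<inter> B. U h1 TA1 x \<noteq> V h1 TB1 x} = {x \<in> A \<inter> B. U h2 TA2 x \<noteq> V h2 TB2 x}"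
      using \<Theta>eq by (simp add: \<Theta>_def t1 t2)
    define G where "G = (\<lambda>x. if x \<in> A then U h1 TA1 x / U h2 TA2 x else V h1 TB1 x / V h2 TB2 x)"
    have GB: "G x = V h1 TB1 x / V h2 TB2 x" if "x \<in> B" for x
    proof (cases "x \<in> A")
      case True
      have "U h1 TA1 x = V h1 TB1 x \<or> U h1 TA1 x = - V h1 TB1 x"
        using U(2)[OF h(1) TA(1) True] V(2)[OF h(1) TB(1) that] by (metis power2_eq_iff)
      moreover have "U h2 TA2 x = V h2 TB2 x \<or> U h2 TA2 x = - V h2 TB2 x"
        using U(2)[OF h(2) TA(2) True] V(2)[OF h(2) TB(2) that] by (metis power2_eq_iff)
      moreover have "U h1 TA1 x \<noteq> V h1 TB1 x \<longleftrightarrow> U h2 TA2 x \<noteq> V h2 TB2 x"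
        using eq True that by blast
      ultimately show ?thesis using True by (auto simp: G_def)
    qed (simp add: G_def)
    have contG: "continuous_on X G"
    proof (rule continuous_on_openin_cover)
      fix x assume "x \<in> X"
      have cA: "continuous_on A G"
        by (rule continuous_on_eq[of A "\<lambda>x. U h1 TA1 x / U h2 TA2 x"])
           (use U h TA in \<open>auto intro!: continuous_intros simp: G_def\<close>)
      have cB: "continuous_on B G"
        by (rule continuous_on_eq[of B "\<lambda>x. V h1 TB1 x / V h2 TB2 x"])
           (use V h TB GB in \<open>auto intro!: continuous_intros\<close>)
      show "\<exists>U. openin (top_of_set X) U \<and> x \<in> U \<and> continuous_on U G"
        using \<open>x \<in> X\<close> AB opA opB cA cB by blast
    qed
    have r0: "rep h2 x \<noteq> 0" if "x \<in> X" for x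
      using rep(2)[OF h(2)] that by (simp add: nonvanishing_def)
    have sq: "rep h1 x = rep h2 x * G x ^ 2" if "x \<in> X" for x
    proof (cases "x \<in> A")
      case True
      then show ?thesis using U[OF h(1) TA(1)] U[OF h(2) TA(2)] r0[OF that] by (simp add: G_def power_divide flip: U(2))
    next
      case False
      then have "x \<in> B" using that AB by auto
      then show ?thesis using V[OF h(1) TB(1)] V[OF h(2) TB(2)] r0[OF that] GB by (simp add: power_divide flip: V(2))
    qed
    have "(rep h1, rep h2) \<in> square_rel X"
      using contG sq rep h by (auto simp: square_rel_def)
    then have heq: "h1 = h2"
      using quotient_eqI[OF equiv_square_rel] rep(1) h unfolding square_classes_def by metis
    have "G x ^ 2 = 1" if "x \<in> X" for x
      using sq[OF that] heq rep(2)[OF h(2)] that by (auto simp: nonvanishing_def)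
    then have "{x\<in>X. G x \<noteq> 1} \<in> clopens X"
      using disagreement_clopen[OF contG continuous_on_const[of X 1]] by force
    moreover have "G a0 = 1" "a0 \<in> X"
      using a0 nin heq u0[OF h(2) a0] sub by (auto simp: G_def U_def sgn_on_def)
    ultimately have G1: "G x = 1" if "x \<in> X" for x
      using clopens_connected[OF conn] that by blast
    have "x \<in> TA1 \<longleftrightarrow> x \<in> TA2" if "x \<in> A" for x
      using G1[of x] that sub u0[OF h(2) that] heq
      by (auto simp: G_def U_def sgn_on_def split: if_splits)
    moreover have "x \<in> TB1 \<longleftrightarrow> x \<in> TB2" if "x \<in> B" for x
      using G1[of x] GB[OF that] that sub v0[OF h(2) that] heq
      by (auto simp: V_def sgn_on_def split: if_splits)
    ultimately have "TA1 = TA2" "TB1 = TB2"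
      using TA[THEN clopens_subset] TB[THEN clopens_subset] by blast+
    with heq show "t1 = t2" by (simp add: t1 t2)
  qed
  have into: "\<Theta> ` D \<subseteq> clopens (A \<inter> B)"
  proof (clarsimp simp: D_def \<Theta>_def)
    fix h TA TB assume h: "h \<in> square_classes X" and TA: "TA \<in> clopens A" and TB: "TB \<in> clopens B"
    have "{x \<in> A \<inter> B. U h TA x \<noteq> V h TB x} \<in> clopens (A \<inter> B)"
      by (rule disagreement_clopen)
         (use U[OF h TA] V[OF h TB] in \<open>auto intro: continuous_on_subset\<close>)
    then show "{x. x \<in> A \<and> x \<in> B \<and> U h TA x \<noteq> V h TB x} \<in> clopens (A \<inter> B)" by simp
  qed
  have onto: "clopens (A \<inter> B) \<subseteq> \<Theta> ` D"
  proof
    fix T assume T: "T \<in> clopens (A \<inter> B)"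
    \<comment> \<open>a partition of unity consisting of \<open>\<rho>\<close> and \<open>1 - \<rho>\<close>\<close>
    obtain \<rho> :: "'a \<Rightarrow> real" where \<rho>: "continuous_on X \<rho>"
      "\<And>x. x \<in> X \<Longrightarrow> \<rho> x \<in> closed_segment 0 1"
      "\<And>x. x \<in> X \<Longrightarrow> \<rho> x = 0 \<longleftrightarrow> x \<in> X - B" "\<And>x. x \<in> X \<Longrightarrow> \<rho> x = 1 \<longleftrightarrow> x \<in> X - A"
      by (rule Urysohn_local_strong[of X "X - B" "X - A" "0::real" 1])
         (use opA opB AB in auto)
    define b :: "'a \<Rightarrow> real" where "b = indicator T"
    have contb: "continuous_on (A \<inter> B) b"
    proof -
      have "b = (\<lambda>x. if x \<in> T then 1 else 0)" by (auto simp: b_def fun_eq_iff)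
      then show ?thesis using continuous_on_clopen_cases[OF T continuous_on_const continuous_on_const] by simp
    qed
    have cut: "continuous_on W (\<lambda>x. if x \<in> A \<inter> B then \<tau> x * b x else 0)"
      if W: "openin (top_of_set X) W" and AB': "openin (top_of_set W) (A \<inter> B)" and \<tau>: "continuous_on X \<tau>"
        and z: "\<And>x. x \<in> W - (A \<inter> B) \<Longrightarrow> \<tau> x = 0" for W and \<tau> :: "'a \<Rightarrow> real"
    proof -
      have cW: "continuous_on W \<tau>"
        using \<tau> W by (meson continuous_on_subset openin_imp_subset)
      show ?thesis unfolding continuous_on_eq_continuous_within
      proof
        fix x assume x: "x \<in> W"
        show "continuous (at x within W) (\<lambda>x. if x \<in> A \<inter> B then \<tau> x * b x else 0)"
        proof (cases "x \<in> A \<inter> B")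
          case True
          have "continuous_on (A \<inter> B) (\<lambda>x. if x \<in> A \<inter> B then \<tau> x * b x else 0)"
            by (rule continuous_on_eq[of _ "\<lambda>x. \<tau> x * b x"])
               (use contb continuous_on_subset[OF cW openin_imp_subset[OF AB']] in \<open>auto intro!: continuous_intros\<close>)
          then have "continuous (at x within A \<inter> B) (\<lambda>x. if x \<in> A \<inter> B then \<tau> x * b x else 0)"
            using True by (simp add: continuous_on_eq_continuous_within)
          moreover obtain O' where "open O'" "A \<inter> B = W \<inter> O'" using AB' by (auto simp: openin_open)
          then have "at x within W = at x within (A \<inter> B)"
            using True by (intro at_within_nhd[of x O']) auto
          ultimately show ?thesis by simp
        next
          case False
          have "(\<tau> \<longlongrightarrow> 0) (at x within W)"
            using cW x False z[of x] by (auto simp: continuous_on_def)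
          then have "((\<lambda>x. if x \<in> A \<inter> B then \<tau> x * b x else 0) \<longlongrightarrow> 0) (at x within W)"
            by (rule tendsto_0_le[where K=1]) (auto simp: b_def indicator_def intro!: always_eventually)
          then show ?thesis using False by (auto simp: continuous_within)
        qed
      qed
    qed
    \<comment> \<open>the indicator of T is \<open>\<alpha> - \<beta>\<close> on \<open>A \<inter> B\<close>\<close>
    define \<alpha> where "\<alpha> = (\<lambda>x. if x \<in> A \<inter> B then \<rho> x * b x else 0)"
    define \<beta> where "\<beta> = (\<lambda>x. if x \<in> A \<inter> B then (\<rho> x - 1) * b x else 0)"
    have opAB: "openin (top_of_set A) (A \<inter> B)" "openin (top_of_set B) (A \<inter> B)"
      using opA opB sub by (metis Int_absorb1 openin_Int openin_subset_trans inf.cobounded1 inf.cobounded2)+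
    have \<alpha>: "continuous_on A \<alpha>"
      unfolding \<alpha>_def by (rule cut[OF opA opAB(1) \<rho>(1)]) (use \<rho>(3) sub in auto)
    have \<beta>: "continuous_on B \<beta>"
      unfolding \<beta>_def by (rule cut[OF opB opAB(2)]) (use \<rho>(1,4) sub in \<open>auto intro!: continuous_intros\<close>)
    define P where "P = (\<lambda>x. exp (\<i> * of_real (pi * \<alpha> x)))"
    define Q where "Q = (\<lambda>x. exp (\<i> * of_real (pi * \<beta> x)))"
    have contP: "continuous_on A P" and contQ: "continuous_on B Q"
      unfolding P_def Q_def using \<alpha> \<beta> by (auto intro!: continuous_intros)
    have PQ: "P x = Q x * sgn_on T x" if "x \<in> A \<inter> B" for x
    proof -
      have "\<alpha> x = \<beta> x + b x" using that by (simp add: \<alpha>_def \<beta>_def algebra_simps)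
      then have "P x = Q x * exp (\<i> * of_real (pi * b x))"
        by (simp add: P_def Q_def algebra_simps exp_add)
      also have "exp (\<i> * of_real (pi * b x)) = sgn_on T x"
        by (auto simp: b_def indicator_def sgn_on_def mult.commute)
      finally show ?thesis .
    qed
    define f where "f = (\<lambda>x. if x \<in> A then P x ^ 2 else Q x ^ 2)"
    have fB: "f x = Q x ^ 2" if "x \<in> B" for x
      using PQ[of x] that by (auto simp: f_def power_mult_distrib)
    have f: "f \<in> nonvanishing X"
    proof -
      have cA: "continuous_on A f"
        by (rule continuous_on_eq[of _ "\<lambda>x. P x ^ 2"]) (use contP in \<open>auto simp: f_def intro!: continuous_intros\<close>)
      have cB: "continuous_on B f"
        by (rule continuous_on_eq[of _ "\<lambda>x. Q x ^ 2"]) (use contQ fB in \<open>auto intro!: continuous_intros\<close>)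
      have "continuous_on X f"
        by (rule continuous_on_openin_cover) (use AB opA opB cA cB in blast)
      moreover have "f x \<noteq> 0" for x by (simp add: f_def P_def Q_def)
      ultimately show ?thesis by (simp add: nonvanishing_def)
    qed
    define h where "h = square_rel X `` {f}"
    have h: "h \<in> square_classes X" using f by (auto simp: h_def square_classes_def intro: quotientI)
    have "(f, rep h) \<in> square_rel X" using rep(1)[OF h] by (auto simp: h_def)
    then obtain s where s: "continuous_on X s" "\<And>x. x \<in> X \<Longrightarrow> f x = rep h x * s x ^ 2"
      by (auto simp: square_rel_def)
    have s0: "s x \<noteq> 0" if "x \<in> X" for x using s(2)[OF that] f that by (auto simp: nonvanishing_def)
    \<comment> \<open>flips the global sign of s so that a0 does not belong to TA\<close>
    define e :: complex where "e = (if P a0 = u h a0 * s a0 then 1 else -1)"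
    have e: "e ^ 2 = 1" "e \<noteq> 0" by (auto simp: e_def)
    define TA where "TA = {x\<in>A. P x \<noteq> e * u h x * s x}"
    define TB where "TB = {x\<in>B. Q x \<noteq> e * v h x * s x}"
    have PA: "P x ^ 2 = (e * u h x * s x) ^ 2" if "x \<in> A" for x
      using s(2)[of x] u(2)[OF h that] that sub e by (auto simp: f_def power_mult_distrib)
    have QB: "Q x ^ 2 = (e * v h x * s x) ^ 2" if "x \<in> B" for x
      using s(2)[of x] v(2)[OF h that] that sub e fB[OF that] by (auto simp: power_mult_distrib)
    have TA: "TA \<in> clopens A"
      unfolding TA_def
      by (rule disagreement_clopen)
         (use PA contP u(1)[OF h] continuous_on_subset[OF s(1) sub(1)] in \<open>auto intro!: continuous_intros simp: P_def\<close>)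
    have TB: "TB \<in> clopens B"
      unfolding TB_def
      by (rule disagreement_clopen)
         (use QB contQ v(1)[OF h] continuous_on_subset[OF s(1) sub(2)] in \<open>auto intro!: continuous_intros simp: Q_def\<close>)
    have "P a0 = e * u h a0 * s a0"
      using PA[OF a0] by (auto simp: e_def power2_eq_iff)
    then have nin: "a0 \<notin> TA" by (simp add: TA_def)
    have PU: "P x = e * s x * U h TA x" if "x \<in> A" for x
      using PA[OF that] that unfolding power2_eq_iff by (auto simp: TA_def U_def sgn_on_def)
    have QV: "Q x = e * s x * V h TB x" if "x \<in> B" for x
      using QB[OF that] that unfolding power2_eq_iff by (auto simp: TB_def V_def sgn_on_def)
    have "x \<in> T \<longleftrightarrow> U h TA x \<noteq> V h TB x" if x: "x \<in> A \<inter> B" for x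
    proof -
      have "x \<in> T \<longleftrightarrow> P x \<noteq> Q x"
        using PQ[OF x] by (auto simp: sgn_on_def Q_def)
      also have "\<dots> \<longleftrightarrow> U h TA x \<noteq> V h TB x"
        using PU QV x s0[of x] e sub by auto
      finally show ?thesis .
    qed
    then have "T = \<Theta> (h, TA, TB)"
      using clopens_subset[OF T] by (auto simp: \<Theta>_def)
    then show "T \<in> \<Theta> ` D" using h TA TB nin by (auto simp: D_def)
  qed
  have "bij_betw \<Theta> D (clopens (A \<inter> B))"
    using inj into onto by (auto simp: bij_betw_def)
  then have cardD: "card (clopens (A \<inter> B)) = card (square_classes X) * card {T \<in> clopens A. a0 \<notin> T} * card (clopens B)"
    by (simp add: bij_betw_same_card[symmetric] D_def card_cartesian_product)
  have "bij_betw (\<lambda>T. A - T) {T \<in> clopens A. a0 \<notin> T} {T \<in> clopens A. a0 \<in> T}"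
    by (rule bij_betw_byWitness[where f' = "\<lambda>T. A - T"])
       (use a0 in \<open>auto simp: clopens_Compl dest: clopens_subset\<close>)
  then have "card {T \<in> clopens A. a0 \<in> T} = card {T \<in> clopens A. a0 \<notin> T}"
    by (simp add: bij_betw_same_card)
  moreover have "card (clopens A) = card {T \<in> clopens A. a0 \<in> T} + card {T \<in> clopens A. a0 \<notin> T}"
    using finA by (subst card_Un_disjoint[symmetric]) (auto intro: arg_cong[where f=card])
  ultimately show ?thesis using cardD by simp
qed

section \<open>Coverings of punctured planes\<close>

text \<open>
  For \<open>e = 1\<close> the vertical rays downwards from the points of \<open>P\<close> are removed, for \<open>e = -1\<close> the rays
  upwards.
\<close>

definition slit_plane :: "real \<Rightarrow> complex set \<Rightarrow> complex set"
  where "slit_plane e P = {z. \<forall>a\<in>P. Re z = Re a \<longrightarrow> e * Im a < e * Im z}"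

lemma open_slit_plane:
  assumes "finite P"
  shows "open (slit_plane e P)"
proof -
  have eq: "slit_plane e P = - (\<Union>a\<in>P. {z. Re z = Re a} \<inter> {z. e * Im z \<le> e * Im a})"
    by (auto simp: slit_plane_def not_le)
  moreover have "closed (\<Union>a\<in>P. {z. Re z = Re a} \<inter> {z. e * Im z \<le> e * Im a})"
    using assms by (intro closed_UN ballI closed_Int closed_Collect_eq closed_Collect_le continuous_intros)
  ultimately show ?thesis unfolding eq by (intro open_Compl)
qed

text \<open>
  Points can be moved away from the slits vertically until they reach a half-plane that is free of
  slits.
\<close>

lemma contractible_slit_plane:
  assumes "finite P" and e: "e = 1 \<or> e = -1"
  shows "contractible (slit_plane e P)"
proof -
  have ee: "e * e = 1" using e by auto
  obtain M where M: "\<And>a. a \<in> P \<Longrightarrow> e * Im a < M"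
  proof (cases "P = {}")
    case False
    then show ?thesis
      using assms(1) that[of "Max ((\<lambda>a. e * Im a) ` P) + 1"]
      by (metis (no_types, lifting) Max_ge finite_imageI imageI le_less_trans less_add_one)
  qed (use that in auto)
  let ?A = "slit_plane e P"
  define up where "up = (\<lambda>z. z + \<i> * of_real (e * max 0 (M - e * Im z)))"
  have up_Re: "Re (up z) = Re z" and up_Im: "e * Im (up z) = max (e * Im z) M" for z
    using ee by (auto simp: up_def algebra_simps max_def)
  have cont: "continuous_on S up" for S
    unfolding up_def by (intro continuous_intros)
  have half: "{z. M \<le> e * Im z} \<subseteq> ?A" using M by (force simp: slit_plane_def)
  have conv: "convex {z. M \<le> e * Im z}"
  proof -
    have "{z. M \<le> e * Im z} = {z. (of_real e * \<i>) \<bullet> z \<ge> M}" by (auto simp: inner_complex_def)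
    then show ?thesis by (simp add: convex_halfspace_ge)
  qed
  have "homotopic_with_canon (\<lambda>h. True) ?A ?A id up"
  proof (rule homotopic_with_linear)
    fix z assume z: "z \<in> ?A"
    show "closed_segment (id z) (up z) \<subseteq> ?A"
    proof
      fix w assume "w \<in> closed_segment (id z) (up z)"
      then obtain t where t: "0 \<le> t" "t \<le> 1" "w = (1 - t) *\<^sub>R z + t *\<^sub>R up z"
        by (auto simp: closed_segment_def)
      have "Re w = Re z" by (simp add: t up_Re algebra_simps)
      moreover have "e * Im w = (1 - t) * (e * Im z) + t * (e * Im (up z))" by (simp add: t algebra_simps)
      then have "e * Im w - e * Im z = t * (e * Im (up z) - e * Im z)" by (simp add: algebra_simps)
      moreover have "0 \<le> t * (e * Im (up z) - e * Im z)" using t by (simp add: up_Im)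
      ultimately have "e * Im w \<ge> e * Im z" by linarith
      with \<open>Re w = Re z\<close> show "w \<in> ?A" using z by (force simp: slit_plane_def)
    qed
  qed (auto intro: cont continuous_on_id)
  moreover have "homotopic_with_canon (\<lambda>h. True) ?A ?A up (\<lambda>z. of_real (e * M) * \<i>)"
  proof (rule homotopic_with_linear)
    fix z assume z: "z \<in> ?A"
    have "up z \<in> {z. M \<le> e * Im z}" by (simp add: up_Im)
    moreover have "of_real (e * M) * \<i> \<in> {z. M \<le> e * Im z}" using ee by (simp add: mult.assoc[symmetric])
    ultimately show "closed_segment (up z) (of_real (e * M) * \<i>) \<subseteq> ?A"
      using conv half by (meson closed_segment_subset subset_trans)
  qed (auto intro: cont)
  ultimately have "homotopic_with_canon (\<lambda>h. True) ?A ?A id (\<lambda>z. of_real (e * M) * \<i>)"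
    by (rule homotopic_with_trans)
  then show ?thesis by (auto simp: contractible_def)
qed

text \<open>
  Removing the vertical lines over \<open>R\<close> cuts the strip over \<open>Q\<close> into \<open>card R + 1\<close> convex strips, each
  covered by \<open>d\<close> sheets.
\<close>

lemma card_clopens_over_strips:
  fixes q :: "'a::real_normed_vector \<Rightarrow> complex"
  assumes cov: "covering_space X q Z" and d: "\<And>z. z \<in> Z \<Longrightarrow> card {x\<in>X. q x = z} = d" "d > 0"
    and "finite R" "R \<subseteq> Q" "open Q" "convex Q" "Q \<noteq> {}" "{z. Re z \<in> Q - R} \<subseteq> Z"
  shows "card (clopens (X \<inter> q -` {z. Re z \<in> Q - R})) = (2 ^ d) ^ (card R + 1)"
  using assms(4-)
proof (induction R arbitrary: Q rule: finite_linorder_max_induct)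
  case (empty Q)
  let ?A = "{z. Re z \<in> Q - {}}"
  obtain x0 where "x0 \<in> Q" using empty by auto
  have "?A = Re -` Q" by auto
  moreover have "open (Re -` Q)" using \<open>open Q\<close> by (intro open_vimage continuous_intros)
  moreover have "convex (Re -` Q)" using \<open>convex Q\<close> by (intro convex_linear_vimage) (auto intro: linearI)
  ultimately have "simply_connected ?A" "locally path_connected ?A"
    by (auto intro: convex_imp_simply_connected open_imp_locally_path_connected)
  moreover have "of_real x0 \<in> ?A" using \<open>x0 \<in> Q\<close> by auto
  moreover have "card {x\<in>X. q x = of_real x0} = d" using d(1) calculation(3) empty by blast
  ultimately show ?case
    using card_clopens_over_simply_connected[OF cov, of ?A "of_real x0"] d(2) empty
    by (simp add: card_ge_0_finite)
next
  case (insert b R Q)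
  define Q1 where "Q1 = Q \<inter> {..<b}"
  define Q2 where "Q2 = Q \<inter> {b<..}"
  have opn: "open Q1" "open Q2" using \<open>open Q\<close> by (auto simp: Q1_def Q2_def)
  have cv: "convex Q1" "convex Q2" using \<open>convex Q\<close> by (auto simp: Q1_def Q2_def intro: convex_Int)
  have b: "b \<in> Q" using insert by auto
  obtain r where r: "r > 0" "ball b r \<subseteq> Q" using \<open>open Q\<close> b open_contains_ball by blast
  have ne: "Q1 \<noteq> {}" "Q2 \<noteq> {}"
  proof -
    have "b - r/2 \<in> ball b r" "b + r/2 \<in> ball b r" using r by (auto simp: dist_real_def)
    then have "b - r/2 \<in> Q1" "b + r/2 \<in> Q2" using r by (auto simp: Q1_def Q2_def)
    then show "Q1 \<noteq> {}" "Q2 \<noteq> {}" by blast+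
  qed
  have R: "R \<subseteq> Q1" using insert by (auto simp: Q1_def)
  have split: "Q - insert b R = (Q1 - R) \<union> Q2" using insert.hyps(2) by (force simp: Q1_def Q2_def)
  let ?Y = "X \<inter> q -` {z. Re z \<in> Q1 - R}" and ?Y' = "X \<inter> q -` {z. Re z \<in> Q2}"
  have un: "X \<inter> q -` {z. Re z \<in> Q - insert b R} = ?Y \<union> ?Y'" unfolding split by auto
  have Z: "{z. Re z \<in> Q1 - R} \<subseteq> Z" "{z. Re z \<in> Q2 - {}} \<subseteq> Z"
    using insert.prems(5) split by auto
  have opX: "openin (top_of_set X) (X \<inter> q -` {z. Re z \<in> O'})" if "open O'" for O'
  proof -
    have "open (Re -` O')" using that by (intro open_vimage continuous_intros)
    then have "open {z. Re z \<in> O'}" by (simp add: vimage_def)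
    then show ?thesis
      using covering_space_imp_continuous[OF cov] by (rule continuous_openin_preimage_gen[rotated])
  qed
  have o: "open (Q1 - R)" using opn insert by (auto intro: finite_imp_closed)
  have "card (clopens (?Y \<union> ?Y')) = card (clopens ?Y) * card (clopens ?Y')"
  proof (rule card_clopens_disjoint_Un)
    show "openin (top_of_set (?Y \<union> ?Y')) ?Y" "openin (top_of_set (?Y \<union> ?Y')) ?Y'"
      using opX[OF o] opX[OF opn(2)] by (auto intro: openin_subset_trans)
    show "?Y \<inter> ?Y' = {}" by (auto simp: Q1_def Q2_def)
  qed
  also have "card (clopens ?Y) = (2 ^ d) ^ (card R + 1)"
    using insert.IH[OF R opn(1) cv(1) ne(1) Z(1)] .
  also have "card (clopens ?Y') = 2 ^ d"
  proof -
    obtain x0 where "x0 \<in> Q2" using ne by auto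
    have "{z. Re z \<in> Q2} = Re -` Q2" by auto
    moreover have "open (Re -` Q2)" using opn by (intro open_vimage continuous_intros)
    moreover have "convex (Re -` Q2)" using cv by (intro convex_linear_vimage) (auto intro: linearI)
    ultimately have "simply_connected {z. Re z \<in> Q2}" "locally path_connected {z. Re z \<in> Q2}"
      by (auto intro: convex_imp_simply_connected open_imp_locally_path_connected)
    moreover have x0: "of_real x0 \<in> {z. Re z \<in> Q2}" using \<open>x0 \<in> Q2\<close> by auto
    moreover have "card {x\<in>X. q x = of_real x0} = d"
      by (rule d(1)) (use x0 Z(2) in blast)
    ultimately show ?thesis
      using card_clopens_over_simply_connected[OF cov, of "{z. Re z \<in> Q2}" "of_real x0"] d(2) Z(2)
      by (simp add: card_ge_0_finite)
  qed
  finally show ?case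
    using insert un by (simp add: card_insert_if) (metis less_irrefl)
qed

text \<open>
  The two slit planes cover the punctured plane and meet in \<open>card P + 1\<close> strips, provided that the
  punctures lie on different vertical lines.
\<close>

lemma card_square_classes_covering:
  fixes q :: "'a::euclidean_space \<Rightarrow> complex"
  assumes cov: "covering_space X q (- P)" and d: "\<And>z. z \<notin> P \<Longrightarrow> card {x\<in>X. q x = z} = d" "d > 0"
    and P: "finite P" "inj_on Re P" and conn: "connected X"
  shows "card (square_classes X) * 2 ^ (2 * d) = 2 * 2 ^ (d * (card P + 1))"
proof -
  let ?S = "\<lambda>e. slit_plane e P"
  let ?A = "X \<inter> q -` ?S 1" and ?B = "X \<inter> q -` ?S (-1)"
  have sub: "?S e \<subseteq> - P" for e by (auto simp: slit_plane_def)
  have cover: "?S 1 \<union> ?S (-1) = - P"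
  proof
    show "- P \<subseteq> ?S 1 \<union> ?S (-1)"
    proof
      fix z assume z: "z \<in> - P"
      show "z \<in> ?S 1 \<union> ?S (-1)"
      proof (rule ccontr)
        assume "\<not> ?thesis"
        then obtain a b where ab: "a \<in> P" "b \<in> P" "Re z = Re a" "Re z = Re b" "Im z \<le> Im a" "Im b \<le> Im z"
          by (auto simp: slit_plane_def not_less)
        then have "a = b" using P(2) by (auto dest: inj_onD)
        then have "z = a" using ab by (auto simp: complex_eq_iff)
        then show False using z ab by auto
      qed
    qed
  qed (use sub in auto)
  have sc: "simply_connected (?S e)" "locally path_connected (?S e)" if "e = 1 \<or> e = -1" for e
    using that P contractible_slit_plane[of P e] open_slit_plane[of P e]
    by (auto intro: contractible_imp_simply_connected open_imp_locally_path_connected)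
  have "\<exists>a. a \<in> ?S e" if "e = 1 \<or> e = -1" for e
  proof -
    have "infinite (UNIV :: real set)" by (rule infinite_UNIV_char_0)
    then obtain t where t: "t \<notin> Re ` P" using P by (meson ex_new_if_finite finite_imageI)
    then have "of_real t \<in> ?S e" by (force simp: slit_plane_def)
    then show ?thesis by blast
  qed
  then obtain a where a: "\<And>e. e = 1 \<or> e = -1 \<Longrightarrow> a e \<in> ?S e" by metis
  have fib: "card {x\<in>X. q x = a e} = d" "finite {x\<in>X. q x = a e}" if "e = 1 \<or> e = -1" for e
    using d a[OF that] sub by (auto intro!: card_ge_0_finite)
  have roots: "has_square_roots (X \<inter> q -` ?S e)" and clop: "card (clopens (X \<inter> q -` ?S e)) = 2 ^ d"
    if "e = 1 \<or> e = -1" for e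
    using has_square_roots_over_simply_connected[OF cov sub sc[OF that] a[OF that] fib(2)[OF that]]
      card_clopens_over_simply_connected[OF cov sub sc[OF that] a[OF that] fib(2)[OF that]] fib(1)[OF that]
    by auto
  have op: "openin (top_of_set X) (X \<inter> q -` ?S e)" for e
    using covering_space_imp_continuous[OF cov] open_slit_plane[OF P(1), of e]
    by (rule continuous_openin_preimage_gen)
  have un: "?A \<union> ?B = X"
    using cover covering_space_imp_surjective[OF cov] by blast
  have "{x\<in>X. q x = a 1} \<noteq> {}" using fib(1)[of 1] d(2) by fastforce
  then obtain a0 where a0: "a0 \<in> ?A" using a[of 1] by blast
  have int: "?A \<inter> ?B = X \<inter> q -` {z. Re z \<in> UNIV - Re ` P}"
  proof -
    have "z \<in> ?S 1 \<and> z \<in> ?S (-1) \<longleftrightarrow> Re z \<notin> Re ` P" for z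
      by (fastforce simp: slit_plane_def image_iff)
    then show ?thesis by blast
  qed
  have "card (square_classes X) * card (clopens ?A) * card (clopens ?B) = 2 * card (clopens (?A \<inter> ?B))"
    by (rule card_square_classes_mayer_vietoris[OF op op un conn a0])
       (use roots clop[of 1] in \<open>auto intro!: card_ge_0_finite\<close>)
  also have "card (clopens (?A \<inter> ?B)) = (2 ^ d) ^ (card (Re ` P) + 1)"
    unfolding int
    by (rule card_clopens_over_strips[OF cov]) (use d P in auto)
  finally show ?thesis
    using clop[of 1] clop[of "-1"] P(2)
    by (simp add: card_image power_mult[symmetric] power_add[symmetric] mult_2 mult.assoc)
qed

lemma covering_space_compose_homeomorphism:
  assumes cov: "covering_space X q Z" and h: "homeomorphism Z Z' h k"
  shows "covering_space X (h \<circ> q) Z'"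
proof
  have qi: "q ` X = Z" and cq: "continuous_on X q" using cov by (auto simp: covering_space_def)
  have hk: "continuous_on Z h" "h ` Z = Z'" "\<And>z. z \<in> Z \<Longrightarrow> k (h z) = z" "\<And>z. z \<in> Z' \<Longrightarrow> h (k z) = z" "k ` Z' = Z"
    using h by (auto simp: homeomorphism_def)
  show "continuous_on X (h \<circ> q)" using cq hk(1) qi by (intro continuous_on_compose) auto
  show "(h \<circ> q) ` X = Z'" using qi hk(2) by (metis image_comp)
  fix x assume "x \<in> Z'"
  then have "k x \<in> Z" using hk by auto
  then obtain T v where T: "k x \<in> T" "openin (top_of_set Z) T" "\<Union>v = X \<inter> q -` T"
      "\<forall>u \<in> v. openin (top_of_set X) u" "pairwise disjnt v" "\<forall>u \<in> v. \<exists>g. homeomorphism u T q g"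
    using cov unfolding covering_space_def by blast
  have TZ: "T \<subseteq> Z" using T(2) by (rule openin_imp_subset)
  have 1: "x \<in> h ` T" using T(1) hk \<open>x \<in> Z'\<close> by force
  have 2: "openin (top_of_set Z') (h ` T)"
    using homeomorphism_imp_open_map[OF h T(2)] .
  have 3: "\<Union>v = X \<inter> (h \<circ> q) -` (h ` T)"
  proof -
    have *: "h (q y) \<in> h ` T \<longleftrightarrow> q y \<in> T" if "y \<in> X" for y
    proof -
      have "inj_on h Z" using hk(3) by (rule inj_on_inverseI)
      then show ?thesis using that qi TZ by (intro inj_on_image_mem_iff) auto
    qed
    have "X \<inter> (h \<circ> q) -` (h ` T) = X \<inter> q -` T"
    proof (rule set_eqI)
      fix y
      show "y \<in> X \<inter> (h \<circ> q) -` (h ` T) \<longleftrightarrow> y \<in> X \<inter> q -` T"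
        using *[of y] by (simp only: Int_iff vimage_eq o_apply) blast
    qed
    then show ?thesis using T(3) by simp
  qed
  have 4: "\<exists>g. homeomorphism u (h ` T) (h \<circ> q) g" if u: "u \<in> v" for u
  proof -
    obtain g where g: "homeomorphism u T q g" using T(6) u by blast
    have "homeomorphism T (h ` T) h k"
      using homeomorphism_of_subsets[OF h TZ, of "h ` T"] TZ hk(2) by blast
    then show ?thesis using homeomorphism_compose[OF g] by blast
  qed
  show "\<exists>T. x \<in> T \<and> openin (top_of_set Z') T \<and> (\<exists>v. \<Union>v = X \<inter> (h \<circ> q) -` T \<and>
      (\<forall>u \<in> v. openin (top_of_set X) u) \<and> pairwise disjnt v \<and> (\<forall>u \<in> v. \<exists>g. homeomorphism u T (h \<circ> q) g))"
    by (intro exI[of _ "h ` T"] exI[of _ v] conjI ballI 1 2 3 4 T(5) T(4)[rule_format])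
qed

text \<open>
  Only the finitely many directions of lines through two points of \<open>P\<close> have to be avoided.
\<close>

lemma rotate_to_inj_Re:
  assumes "finite P"
  obtains w :: complex where "w \<noteq> 0" "inj_on Re ((*) w ` P)"
proof -
  let ?bad = "(\<lambda>(a, b). (Re a - Re b) / (Im a - Im b)) ` (P \<times> P)"
  have "finite ?bad" using assms by auto
  then obtain t where t: "t \<notin> ?bad" using ex_new_if_finite[OF infinite_UNIV_char_0] by blast
  have "a = b" if "a \<in> P" "b \<in> P" "Re (Complex 1 t * a) = Re (Complex 1 t * b)" for a b
  proof -
    have e: "Re a - Re b = t * (Im a - Im b)" using that(3) by (simp add: algebra_simps)
    have "Im a = Im b"
    proof (rule ccontr)
      assume "Im a \<noteq> Im b"
      then have "t = (Re a - Re b) / (Im a - Im b)" using e by simp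
      then show False using t that by force
    qed
    then show ?thesis using e by (simp add: complex_eq_iff)
  qed
  then have "inj_on Re ((*) (Complex 1 t) ` P)" by (fastforce simp: inj_on_def)
  moreover have "Complex 1 t \<noteq> 0" by (simp add: complex_eq_iff)
  ultimately show ?thesis using that by blast
qed

lemma card_square_classes_covering_punctured_plane:
  fixes q :: "'a::euclidean_space \<Rightarrow> 'b::topological_space"
  assumes cov: "covering_space X q Y" and d: "\<And>z. z \<in> Y \<Longrightarrow> card {x\<in>X. q x = z} = d" "d > 0"
    and h: "homeomorphism Y (- P) h k" and P: "finite (P :: complex set)" and conn: "connected X"
  shows "card (square_classes X) * 2 ^ (2 * d) = 2 * 2 ^ (d * (card P + 1))"
proof -
  obtain w :: complex where w: "w \<noteq> 0" "inj_on Re ((*) w ` P)" using rotate_to_inj_Re[OF P] .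
  have rot: "homeomorphism (- P) (- ((*) w ` P)) ((*) w) (\<lambda>z. z / w)"
  proof -
    have "bij ((*) w)" using w(1) by (intro bij_betw_byWitness[where f' = "\<lambda>z. z / w"]) auto
    then have 1: "(*) w ` (- P) = - ((*) w ` P)" by (rule bij_image_Compl_eq)
    have "(\<lambda>z. z / w) ` ((*) w ` (- P)) = - P" using w(1) by (force simp: image_image)
    then show ?thesis unfolding homeomorphism_def 1[symmetric]
      using w(1) by (auto intro!: continuous_intros)
  qed
  note g = homeomorphism_compose[OF h rot]
  have hk: "h ` Y = - P" "\<And>z. z \<in> Y \<Longrightarrow> k (h z) = z" "\<And>z. z \<in> - P \<Longrightarrow> h (k z) = z" "k ` (- P) = Y"
    using h by (auto simp: homeomorphism_def)
  have qi: "q ` X = Y" using cov by (rule covering_space_imp_surjective)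
  have "card (square_classes X) * 2 ^ (2 * d) = 2 * 2 ^ (d * (card ((*) w ` P) + 1))"
  proof (rule card_square_classes_covering[OF covering_space_compose_homeomorphism[OF cov g] _ d(2) _ w(2) conn])
    fix z assume z: "z \<notin> (*) w ` P"
    then have zw: "z / w \<in> - P" using w(1) by force
    have "{x \<in> X. (((*) w \<circ> h) \<circ> q) x = z} = {x\<in>X. q x = k (z / w)}"
    proof -
      have "w * h (q x) = z \<longleftrightarrow> q x = k (z / w)" if "x \<in> X" for x
        using hk(2)[of "q x"] hk(3)[OF zw] qi that w(1) by (auto simp: field_simps)
      then show ?thesis by auto
    qed
    then show "card {x \<in> X. (((*) w \<circ> h) \<circ> q) x = z} = d" using d(1)[of "k (z / w)"] zw hk by auto
  qed (use P in auto)
  moreover have "card ((*) w ` P) = card P" using w(1) by (intro card_image) (auto simp: inj_on_def)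
  ultimately show ?thesis by simp
qed

section \<open>Local degrees\<close>

lemma punctured_sphere_homeomorphism_plane:
  fixes b :: "'a::euclidean_space"
  assumes "DIM('a) = 3" "b \<in> sphere 0 1"
  obtains h k where "homeomorphism (sphere 0 1 - {b}) (UNIV::complex set) h k"
proof -
  have "(sphere 0 1 - {b}) homeomorphic (UNIV::complex set)"
    by (rule homeomorphic_punctured_sphere_affine) (use assms in auto)
  then show ?thesis using that by (auto simp: homeomorphic_def)
qed

lemma openin_sphere_delete_finite:
  fixes F :: "'a::euclidean_space set"
  assumes "finite F" "openin (top_of_set (sphere 0 1)) T"
  shows "openin (top_of_set (sphere 0 1)) (T - F)"
proof -
  have "closed F" using assms(1) by (rule finite_imp_closed)
  then have "openin (top_of_set (sphere 0 1)) (sphere 0 1 \<inter> - F)"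
    by (metis open_Compl openin_open_Int)
  from openin_Int[OF assms(2) this] have "openin (top_of_set (sphere 0 1)) (T \<inter> (sphere 0 1 \<inter> - F))" .
  moreover have "T \<inter> (sphere 0 1 \<inter> - F) = T - F" using openin_imp_subset[OF assms(2)] by blast
  ultimately show ?thesis by simp
qed

text \<open>
  Small round discs in a stereographic chart.
\<close>

lemma sphere_disc_chart:
  fixes x :: "'a::euclidean_space"
  assumes dim: "DIM('a) = 3" and T: "openin (top_of_set (sphere 0 1)) T" "x \<in> T"
  obtains V \<psi> \<psi>' where "openin (top_of_set (sphere 0 1)) V" "x \<in> V" "V \<subseteq> T"
    "homeomorphism V (ball (0::complex) 1) \<psi> \<psi>'" "\<psi> x = 0"
proof -
  let ?S = "sphere (0::'a) 1"
  have TS: "T \<subseteq> ?S" using T(1) by (rule openin_imp_subset)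
  have xS: "x \<in> ?S" using T TS by auto
  have b: "-x \<in> ?S" using xS by auto
  have xb: "x \<noteq> -x"
  proof
    assume "x = -x"
    then have "2 *\<^sub>R x = 0" by (metis add.right_inverse scaleR_2)
    then show False using xS by simp
  qed
  obtain h k where hk: "homeomorphism (?S - {-x}) (UNIV::complex set) h k"
    using punctured_sphere_homeomorphism_plane[OF dim b] .
  have opT: "openin (top_of_set (?S - {-x})) (T - {-x})"
    using openin_sphere_delete_finite[OF _ T(1), of "{-x}"] TS
    by (auto intro: openin_subset_trans)
  have "open (h ` (T - {-x}))"
    using homeomorphism_imp_open_map[OF hk opT] by simp
  moreover have "h x \<in> h ` (T - {-x})" using T xb by auto
  ultimately obtain r where r: "r > 0" "ball (h x) r \<subseteq> h ` (T - {-x})"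
    using open_contains_ball by blast
  define V where "V = k ` ball (h x) r"
  have kh: "k (h z) = z" if "z \<in> ?S - {-x}" for z using hk that by (auto simp: homeomorphism_def)
  have hk': "h (k z) = z" for z using hk by (auto simp: homeomorphism_def)
  have VT: "V \<subseteq> T - {-x}" using r(2) kh TS unfolding V_def by force
  have opV: "openin (top_of_set (?S - {-x})) V"
    unfolding V_def by (rule homeomorphism_imp_open_map[OF homeomorphism_symD[OF hk]]) simp
  then have opV': "openin (top_of_set ?S) V"
    by (rule openin_trans) (rule openin_sphere_delete_finite, auto)
  have hV: "homeomorphism V (ball (h x) r) h k"
    by (rule homeomorphism_of_subsets[OF hk _ subset_UNIV]) (use VT TS in \<open>auto simp: V_def image_image hk'\<close>)
  have sc: "homeomorphism (ball (h x) r) (ball 0 1) (\<lambda>z. (z - h x) / of_real r) (\<lambda>z. h x + of_real r * z)"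
  proof (rule homeomorphismI)
    show "(\<lambda>z. (z - h x) / of_real r) ` ball (h x) r \<subseteq> ball 0 1"
      using r(1) by (auto simp: dist_norm norm_divide norm_minus_commute)
    show "(\<lambda>z. h x + of_real r * z) ` ball 0 1 \<subseteq> ball (h x) r"
      using r(1) by (auto simp: dist_norm norm_mult)
  qed (use r(1) in \<open>auto intro!: continuous_intros\<close>)
  show ?thesis
  proof (rule that[OF opV' _ _ homeomorphism_compose[OF hV sc]])
    show "x \<in> V" using kh[of x] xS xb r(1) unfolding V_def by (metis Diff_iff centre_in_ball image_eqI singletonD)
  qed (use VT in auto)
qed

lemma infinite_openin_sphere:
  fixes N :: "'a::euclidean_space set"
  assumes "DIM('a) = 3" "openin (top_of_set (sphere 0 1)) N" "N \<noteq> {}"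
  shows "infinite N"
proof
  assume fin: "finite N"
  obtain x where "x \<in> N" using assms by auto
  obtain V \<psi> \<psi>' where V: "V \<subseteq> N" "homeomorphism V (ball (0::complex) 1) \<psi> \<psi>'"
    using sphere_disc_chart[OF assms(1,2) \<open>x \<in> N\<close>] by metis
  then have "finite (\<psi> ` V)" using fin finite_subset by blast
  then have "finite (ball (0::complex) 1)" using V(2) by (simp add: homeomorphism_def)
  then show False using uncountable_ball[of 1 "0::complex"] countable_finite by force
qed

text \<open>
  The ramification number can be read off topologically, as the number of preimages close to \<open>y\<close> of
  a point close to \<open>p y\<close>: in the model these are the \<open>k\<close> roots of a small nonzero number.
\<close>

lemma power_model_count:
  assumes pm: "power_model p U V y k" and W: "openin (top_of_set S2) W" "y \<in> W"
  obtains N where "openin (top_of_set S2) N" "p y \<in> N" "N \<subseteq> V"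
    "\<And>x. x \<in> N - {p y} \<Longrightarrow> card {u \<in> U \<inter> W. p u = x} = k \<and> finite {u \<in> U \<inter> W. p u = x}"
proof -
  obtain \<phi> \<phi>' \<psi> \<psi>' where k: "k > 0" and U: "openin (top_of_set S2) U" "y \<in> U"
    and V: "openin (top_of_set S2) V" "p y \<in> V"
    and \<phi>: "homeomorphism U (ball (0::complex) 1) \<phi> \<phi>'" "\<phi> y = 0"
    and \<psi>: "homeomorphism V (ball (0::complex) 1) \<psi> \<psi>'" "\<psi> (p y) = 0"
    and pU: "\<And>u. u \<in> U \<Longrightarrow> p u \<in> V \<and> \<psi> (p u) = \<phi> u ^ k"
    using pm unfolding power_model_def by blast
  have US: "U \<subseteq> S2" using U(1) by (rule openin_imp_subset)
  have "openin (top_of_set U) (U \<inter> W)"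
    by (rule openin_subset_trans[OF openin_Int[OF U(1) W(1)]]) (use US in auto)
  then have "openin (top_of_set (ball 0 1)) (\<phi> ` (U \<inter> W))"
    by (rule homeomorphism_imp_open_map[OF \<phi>(1)])
  then have "open (\<phi> ` (U \<inter> W))" by (simp add: openin_open_eq)
  moreover have "0 \<in> \<phi> ` (U \<inter> W)" using U W \<phi>(2) by force
  ultimately obtain r where r: "r > 0" "ball 0 r \<subseteq> \<phi> ` (U \<inter> W)" using open_contains_ball by blast
  have \<phi>U: "\<phi> ` U = ball 0 1" "\<And>u. u \<in> U \<Longrightarrow> \<phi>' (\<phi> u) = u" "\<And>z. z \<in> ball 0 1 \<Longrightarrow> \<phi> (\<phi>' z) = z"
    "\<phi>' ` ball 0 1 = U"
    using \<phi>(1) by (auto simp: homeomorphism_def)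
  have \<psi>V: "\<psi> ` V = ball 0 1" "\<And>u. u \<in> V \<Longrightarrow> \<psi>' (\<psi> u) = u" "\<And>z. z \<in> ball 0 1 \<Longrightarrow> \<psi> (\<psi>' z) = z"
    "\<psi>' ` ball 0 1 = V"
    using \<psi>(1) by (auto simp: homeomorphism_def)
  define N where "N = \<psi>' ` (ball 0 1 \<inter> ball 0 (r ^ k))"
  have "openin (top_of_set V) N"
    unfolding N_def by (rule homeomorphism_imp_open_map[OF homeomorphism_symD[OF \<psi>(1)]]) (auto intro: openin_open_Int)
  then have N: "openin (top_of_set S2) N" "N \<subseteq> V"
    using openin_trans[OF _ V(1)] by (auto dest: openin_imp_subset)
  have "p y \<in> N" unfolding N_def
    by (rule image_eqI[of _ _ "\<psi> (p y)"]) (use \<psi>(2) \<psi>V(2)[OF V(2)] r(1) in auto)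
  moreover have "card {u \<in> U \<inter> W. p u = x} = k \<and> finite {u \<in> U \<inter> W. p u = x}" if x: "x \<in> N - {p y}" for x
  proof -
    have xV: "x \<in> V" using x N by auto
    have \<psi>x: "cmod (\<psi> x) < r ^ k" "\<psi> x \<noteq> 0"
    proof -
      show "cmod (\<psi> x) < r ^ k" using x \<psi>V(3) unfolding N_def by auto
      show "\<psi> x \<noteq> 0" using x \<psi>V(2)[OF xV] \<psi>V(2)[OF V(2)] \<psi>(2) by auto
    qed
    have "{u \<in> U \<inter> W. p u = x} = \<phi>' ` {z. z ^ k = \<psi> x}"
    proof (intro set_eqI iffI)
      fix u assume "u \<in> {u \<in> U \<inter> W. p u = x}"
      then show "u \<in> \<phi>' ` {z. z ^ k = \<psi> x}" using pU[of u] \<phi>U(2)[of u] by (auto intro!: image_eqI[of _ _ "\<phi> u"])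
    next
      fix u assume "u \<in> \<phi>' ` {z. z ^ k = \<psi> x}"
      then obtain z where z: "z ^ k = \<psi> x" "u = \<phi>' z" by auto
      have "cmod z ^ k < r ^ k" using \<psi>x(1) z(1) by (metis norm_power)
      then have "z \<in> ball 0 r" using r(1) by (auto intro: power_less_imp_less_base)
      then obtain v where v: "v \<in> U \<inter> W" "z = \<phi> v" using r(2) by auto
      then have "u = v" using z \<phi>U(2) by auto
      moreover have "p v = x" using pU[of v] v z \<psi>V(2) xV by (metis IntD1)
      ultimately show "u \<in> {u \<in> U \<inter> W. p u = x}" using v by auto
    qed
    moreover have "inj_on \<phi>' {z. z ^ k = \<psi> x}"
    proof (rule inj_on_subset)
      show "inj_on \<phi>' (ball 0 1)" using \<phi>U(3) by (rule inj_on_inverseI)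
      show "{z. z ^ k = \<psi> x} \<subseteq> ball 0 1"
      proof clarsimp
        fix z assume "z ^ k = \<psi> x"
        moreover have "cmod (\<psi> x) < 1" using \<psi>V(1) xV by auto
        ultimately have "cmod z ^ k < 1 ^ k" by (metis norm_power power_one)
        then show "cmod z < 1" by (rule power_less_imp_less_base) simp
      qed
    qed
    moreover have "card {z. z ^ k = \<psi> x} = k" "finite {z. z ^ k = \<psi> x}"
      using card_nth_roots[OF \<psi>x(2) k] k by (auto intro: card_ge_0_finite)
    ultimately show ?thesis by (simp add: card_image)
  qed
  ultimately show ?thesis using that N by blast
qed

lemma power_model_unique:
  assumes "power_model p U V y k" "power_model p U' V' y k'"
  shows "k = k'"
proof -
  have US: "openin (top_of_set S2) U" "y \<in> U" and US': "openin (top_of_set S2) U'" "y \<in> U'"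
    using assms by (auto simp: power_model_def)
  obtain N where N: "openin (top_of_set S2) N" "p y \<in> N" "N \<subseteq> V"
    "\<And>x. x \<in> N - {p y} \<Longrightarrow> card {u \<in> U \<inter> U'. p u = x} = k \<and> finite {u \<in> U \<inter> U'. p u = x}"
    by (rule power_model_count[OF assms(1) US']) (rule that)
  obtain N' where N': "openin (top_of_set S2) N'" "p y \<in> N'" "N' \<subseteq> V'"
    "\<And>x. x \<in> N' - {p y} \<Longrightarrow> card {u \<in> U' \<inter> U. p u = x} = k' \<and> finite {u \<in> U' \<inter> U. p u = x}"
    by (rule power_model_count[OF assms(2) US]) (rule that)
  have "infinite (N \<inter> N')" using N N' by (intro infinite_openin_sphere) (auto intro: openin_Int)
  then have "\<not> N \<inter> N' \<subseteq> {p y}" using finite_subset by blast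
  then obtain x where "x \<in> N - {p y}" "x \<in> N' - {p y}" by auto
  then show ?thesis using N(4)[of x] N'(4)[of x] by (simp add: Int_commute)
qed

lemma ramification_number_eq:
  assumes "power_model p U V y k"
  shows "ramification_number p y = k"
  unfolding ramification_number_def using assms power_model_unique by (intro the_equality) blast+

text \<open>
  Composing the local inverse with a disc chart at \<open>p y\<close> yields a power model with exponent 1.
\<close>

lemma ramification_number_regular:
  assumes cov: "covering_space (S2 - p -` F) p (S2 - F)" and F: "finite F"
    and p: "continuous_on S2 p" and y: "y \<in> S2" "p y \<notin> F"
  shows "ramification_number p y = 1"
proof -
  let ?X = "S2 - p -` F"
  obtain T u q where T: "y \<in> T" "openin (top_of_set ?X) T" "p y \<in> u"
    "openin (top_of_set (S2 - F)) u" "homeomorphism T u p q"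
    using covering_space_local_homeomorphism[OF cov, of y] y by auto
  have "openin (top_of_set S2) (S2 - F)"
    using openin_sphere_delete_finite[OF F] by simp
  then have u: "openin (top_of_set S2) u" by (rule openin_trans[OF T(4)])
  have "?X = S2 \<inter> p -` (- F)" by auto
  moreover have "openin (top_of_set S2) (S2 \<inter> p -` (- F))"
    using F by (intro continuous_openin_preimage_gen p open_Compl finite_imp_closed)
  ultimately have "openin (top_of_set S2) ?X" by simp
  then have TS: "openin (top_of_set S2) T" by (rule openin_trans[OF T(2)])
  obtain V \<psi> \<psi>' where V: "openin (top_of_set S2) V" "p y \<in> V" "V \<subseteq> u"
    "homeomorphism V (ball (0::complex) 1) \<psi> \<psi>'" "\<psi> (p y) = 0"
    by (rule sphere_disc_chart[OF _ u T(3)]) auto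
  have pq: "\<And>t. t \<in> T \<Longrightarrow> q (p t) = t" "\<And>x. x \<in> u \<Longrightarrow> p (q x) = x" "q ` u = T"
    using T(5) by (auto simp: homeomorphism_def)
  have "openin (top_of_set u) V" using V u by (meson openin_imp_subset openin_subset_trans)
  then have "openin (top_of_set T) (q ` V)"
    by (rule homeomorphism_imp_open_map[OF homeomorphism_symD[OF T(5)]])
  then have U: "openin (top_of_set S2) (q ` V)" using TS by (rule openin_trans)
  have yU: "y \<in> q ` V" using pq(1)[OF T(1)] V(2) by force
  have "p ` q ` V = V" using pq(2) V(3) by force
  then have "homeomorphism (q ` V) V p q"
    using homeomorphism_of_subsets[OF T(5), of "q ` V" V] pq V(3) by blast
  from homeomorphism_compose[OF this V(4)]
  moreover have "\<forall>u\<in>q ` V. p u \<in> V \<and> \<psi> (p u) = (\<psi> \<circ> p) u ^ 1"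
    using pq(2) V(3) by auto
  moreover have "(\<psi> \<circ> p) y = 0" using V(5) by simp
  ultimately have "power_model p (q ` V) V y 1"
    unfolding power_model_def using U yU V(1,2,4,5) zero_less_one by blast
  then show ?thesis by (rule ramification_number_eq)
qed

text \<open>
  In a power model \<open>y\<close> is the only point above \<open>p y\<close>, so the fibre is discrete; it is also compact.
\<close>

lemma fibre_finite_of_power_models:
  assumes p: "continuous_on S2 p" and pm: "\<And>y. y \<in> S2 \<Longrightarrow> p y = x \<Longrightarrow> \<exists>U V k. power_model p U V y k"
  shows "finite {y\<in>S2. p y = x}"
proof (rule ccontr)
  let ?K = "{y\<in>S2. p y = x}"
  assume inf: "infinite ?K"
  have "closedin (top_of_set S2) ?K" by (rule continuous_closedin_preimage_constant[OF p])
  then have "compact ?K" by (rule closedin_compact[rotated]) auto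
  then obtain y where y: "y \<in> ?K" "y islimpt ?K"
    using inf unfolding compact_eq_Bolzano_Weierstrass by blast
  obtain U V k where "power_model p U V y k" using pm y by blast
  then obtain \<phi> \<phi>' \<psi> \<psi>' where k: "k > 0" and U: "openin (top_of_set S2) U" "y \<in> U"
    and \<phi>: "homeomorphism U (ball (0::complex) 1) \<phi> \<phi>'" "\<phi> y = 0"
    and \<psi>: "\<psi> (p y) = (0::complex)"
    and pU: "\<And>u. u \<in> U \<Longrightarrow> p u \<in> V \<and> \<psi> (p u) = \<phi> u ^ k"
    unfolding power_model_def by blast
  obtain O' where O': "open O'" "U = S2 \<inter> O'" using U(1) by (auto simp: openin_open)
  then obtain u where u: "u \<in> ?K" "u \<in> O'" "u \<noteq> y" using y(2) U(2) unfolding islimpt_def by blast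
  then have uU: "u \<in> U" using O' by auto
  have "\<phi> u ^ k = 0" using pU[OF uU] u y \<psi> by auto
  then have "\<phi> u = \<phi> y" using \<phi>(2) k by simp
  then have "u = y" using \<phi>(1) uU U(2) by (metis homeomorphism_apply1)
  then show False using u by simp
qed

lemma separate_fibre:
  fixes Y :: "'a::metric_space set"
  assumes "finite Y"
  obtains W where "\<And>y. y \<in> Y \<Longrightarrow> open (W y) \<and> y \<in> W y" "\<And>y z. y \<in> Y \<Longrightarrow> z \<in> Y \<Longrightarrow> y \<noteq> z \<Longrightarrow> W y \<inter> W z = {}"
proof -
  obtain e where e: "e > 0" "\<And>y z. y \<in> Y \<Longrightarrow> z \<in> Y \<Longrightarrow> y \<noteq> z \<Longrightarrow> e \<le> dist y z"
  proof (cases "\<exists>y\<in>Y. \<exists>z\<in>Y. y \<noteq> z")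
    case True
    let ?D = "(\<lambda>(y, z). dist y z) ` {(y, z). y \<in> Y \<and> z \<in> Y \<and> y \<noteq> z}"
    have fin: "finite {(y, z). y \<in> Y \<and> z \<in> Y \<and> y \<noteq> z}"
      by (rule finite_subset[of _ "Y \<times> Y"]) (use assms in auto)
    have ne: "?D \<noteq> {}" using True by auto
    have "Min ?D \<in> ?D" using fin ne by (intro Min_in) auto
    then have "Min ?D > 0" by auto
    moreover have "Min ?D \<le> dist y z" if "y \<in> Y" "z \<in> Y" "y \<noteq> z" for y z
      using fin that by (intro Min_le) auto
    ultimately show ?thesis using that by blast
  qed (use that[of 1] in auto)
  show ?thesis
  proof (rule that[of "\<lambda>y. ball y (e/2)"])
    fix y z assume yz: "y \<in> Y" "z \<in> Y" "y \<noteq> z"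
    show "ball y (e/2) \<inter> ball z (e/2) = {}"
    proof (rule ccontr)
      assume "\<not> ?thesis"
      then obtain w where "dist y w < e/2" "dist z w < e/2" by auto
      then have "dist y z < e" using dist_triangle2[of y z w] by linarith
      then show False using e(2)[OF yz] by simp
    qed
  qed (use e in auto)
qed

text \<open>
  Maps from compact spaces are closed, so a neighbourhood of a fibre contains the preimage of a
  neighbourhood of the point.
\<close>

lemma fibre_neighbourhood:
  fixes p :: "'a::metric_space \<Rightarrow> 'b::metric_space"
  assumes p: "continuous_on S p" "p ` S \<subseteq> T" and S: "compact S"
    and W: "openin (top_of_set S) W" and fib: "\<And>y. y \<in> S \<Longrightarrow> p y = x \<Longrightarrow> y \<in> W" and x: "x \<in> T"
  obtains N where "openin (top_of_set T) N" "x \<in> N" "\<And>u. u \<in> S \<Longrightarrow> p u \<in> N \<Longrightarrow> u \<in> W"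
proof -
  obtain O' where O': "open O'" "W = S \<inter> O'" using W by (auto simp: openin_open)
  have "S - W = S \<inter> - O'" using O' by auto
  then have "compact (S - W)" using S O' by (simp add: compact_Int_closed closed_Compl)
  then have "compact (p ` (S - W))" using p by (intro compact_continuous_image) (auto intro: continuous_on_subset)
  then have "open (- p ` (S - W))" by (simp add: compact_imp_closed open_Compl)
  then have "openin (top_of_set T) (T \<inter> - p ` (S - W))" by (rule openin_open_Int)
  then show ?thesis
    by (rule that) (use fib x in auto)
qed

text \<open>
  A generic point near \<open>x\<close> has \<open>d\<close> preimages. By compactness all of them are close to the fibre over
  \<open>x\<close>, and \<open>k y\<close> of them are close to \<open>y\<close>.
\<close>

lemma sum_local_degrees_eq_degree:
  assumes p: "continuous_on S2 p" "p ` S2 \<subseteq> S2" and x: "x \<in> S2" and F: "finite F"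
    and d: "\<And>x. x \<in> S2 - F \<Longrightarrow> card {y\<in>S2. p y = x} = d"
    and pm: "\<And>y. y \<in> S2 \<Longrightarrow> p y = x \<Longrightarrow> \<exists>U V. power_model p U V y (k y)"
  shows "(\<Sum>y\<in>{y\<in>S2. p y = x}. k y) = d"
proof -
  let ?Y = "{y\<in>S2. p y = x}"
  have fin: "finite ?Y" using pm by (intro fibre_finite_of_power_models[OF p(1)]) blast
  have "\<forall>y\<in>?Y. \<exists>U V. power_model p U V y (k y)" using pm by auto
  then obtain U V where UV: "\<And>y. y \<in> ?Y \<Longrightarrow> power_model p (U y) (V y) y (k y)"
    unfolding bchoice_iff by blast
  obtain W0 where W0: "\<And>y. y \<in> ?Y \<Longrightarrow> open (W0 y) \<and> y \<in> W0 y"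
     "\<And>y z. y \<in> ?Y \<Longrightarrow> z \<in> ?Y \<Longrightarrow> y \<noteq> z \<Longrightarrow> W0 y \<inter> W0 z = {}"
    by (rule separate_fibre[OF fin]) (rule that)
  define W where "W = (\<lambda>y. U y \<inter> W0 y)"
  have W: "openin (top_of_set S2) (W y)" "y \<in> W y" if "y \<in> ?Y" for y
    using UV[OF that] W0(1)[OF that] unfolding W_def power_model_def
    by (auto intro: openin_Int_open)
  have "\<exists>N. openin (top_of_set S2) N \<and> p y \<in> N \<and>
      (\<forall>x\<in>N - {p y}. card {u \<in> U y \<inter> W y. p u = x} = k y \<and> finite {u \<in> U y \<inter> W y. p u = x})" if "y \<in> ?Y" for y
    by (rule power_model_count[OF UV[OF that] W[OF that]]) blast
  then have "\<forall>y\<in>?Y. \<exists>N. openin (top_of_set S2) N \<and> p y \<in> N \<and>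
      (\<forall>x\<in>N - {p y}. card {u \<in> U y \<inter> W y. p u = x} = k y \<and> finite {u \<in> U y \<inter> W y. p u = x})"
    by (rule ballI)
  then obtain N where N: "\<And>y. y \<in> ?Y \<Longrightarrow> openin (top_of_set S2) (N y) \<and> p y \<in> N y \<and>
      (\<forall>x\<in>N y - {p y}. card {u \<in> U y \<inter> W y. p u = x} = k y \<and> finite {u \<in> U y \<inter> W y. p u = x})"
    by (rule bchoice[THEN exE]) auto
  have "openin (top_of_set S2) (\<Union>y\<in>?Y. W y)" using W by (intro openin_Union) auto
  then obtain M where M: "openin (top_of_set S2) M" "x \<in> M" "\<And>u. u \<in> S2 \<Longrightarrow> p u \<in> M \<Longrightarrow> u \<in> (\<Union>y\<in>?Y. W y)"
    by (rule fibre_neighbourhood[OF p compact_sphere _ _ x, of "\<Union>y\<in>?Y. W y"]) (use W(2) in auto)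
  define M' where "M' = M \<inter> (\<Inter>y\<in>?Y. N y)"
  have "openin (top_of_set S2) M'"
  proof (cases "?Y = {}")
    case False
    then have "openin (top_of_set S2) (\<Inter>y\<in>?Y. N y)" using fin N by (intro openin_INT2) auto
    then show ?thesis using M(1) by (simp add: M'_def openin_Int)
  next
    case True
    have "M' = M" unfolding M'_def True by simp
    then show ?thesis using M(1) by simp
  qed
  moreover have "x \<in> N y" if "y \<in> ?Y" for y using N[OF that] that by simp
  then have "x \<in> M'" using M(2) unfolding M'_def by blast
  ultimately have "infinite M'" by (intro infinite_openin_sphere) auto
  then have "\<not> M' \<subseteq> insert x F" using F finite_subset by blast
  then obtain x' where x': "x' \<in> M'" "x' \<noteq> x" "x' \<notin> F" by auto
  have x'S: "x' \<in> S2" using x'(1) M(1) openin_imp_subset unfolding M'_def by blast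
  have cf: "card {u \<in> U y \<inter> W y. p u = x'} = k y" "finite {u \<in> U y \<inter> W y. p u = x'}" if "y \<in> ?Y" for y
  proof -
    have "x' \<in> N y" "x' \<noteq> p y" using that x' by (auto simp: M'_def)
    then show "card {u \<in> U y \<inter> W y. p u = x'} = k y" "finite {u \<in> U y \<inter> W y. p u = x'}"
      using N[OF that] by auto
  qed
  have "{u\<in>S2. p u = x'} = (\<Union>y\<in>?Y. {u \<in> U y \<inter> W y. p u = x'})"
  proof -
    have "u \<in> (\<Union>y\<in>?Y. W y)" if "u \<in> S2" "p u = x'" for u
      using M(3)[OF that(1)] that(2) x'(1) by (simp add: M'_def)
    moreover have "W y \<subseteq> S2" if "y \<in> ?Y" for y using W(1)[OF that] by (rule openin_imp_subset)
    ultimately show ?thesis unfolding W_def by blast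
  qed
  then have "card {u\<in>S2. p u = x'} = card (\<Union>y\<in>?Y. {u \<in> U y \<inter> W y. p u = x'})" by simp
  also have "\<dots> = (\<Sum>y\<in>?Y. card {u \<in> U y \<inter> W y. p u = x'})"
  proof (rule card_UN_disjoint[OF fin])
    show "\<forall>y\<in>?Y. finite {u \<in> U y \<inter> W y. p u = x'}"
      using cf by blast
    show "\<forall>y\<in>?Y. \<forall>z\<in>?Y. y \<noteq> z \<longrightarrow> {u \<in> U y \<inter> W y. p u = x'} \<inter> {u \<in> U z \<inter> W z. p u = x'} = {}"
      using W0(2) unfolding W_def by blast
  qed
  also have "\<dots> = (\<Sum>y\<in>?Y. k y)"
    using cf by (intro sum.cong) blast+
  finally show ?thesis using d[of x'] x' x'S by simp
qed

section \<open>The Riemann-Hurwitz formula\<close>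

lemma sphere_minus_finite_homeomorphism:
  fixes F :: "'a::euclidean_space set"
  assumes dim: "DIM('a) = 3" and F: "finite F" "F \<subseteq> sphere 0 1" "b \<in> F"
  obtains P h k where "finite (P::complex set)" "card P = card F - 1" "homeomorphism (sphere 0 1 - F) (- P) h k"
proof -
  obtain h k where hk: "homeomorphism (sphere 0 1 - {b}) (UNIV::complex set) h k"
    using punctured_sphere_homeomorphism_plane[OF dim, of b] F by blast
  let ?P = "h ` (F - {b})"
  have inj: "inj_on h (sphere 0 1 - {b})"
    using hk by (auto simp: homeomorphism_def intro: inj_on_inverseI)
  have "h ` (sphere 0 1 - F) = h ` ((sphere 0 1 - {b}) - (F - {b}))"
    using F by (intro arg_cong[where f = "(`) h"]) auto
  also have "\<dots> = h ` (sphere 0 1 - {b}) - ?P"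
    by (rule inj_on_image_set_diff[OF inj]) (use F in auto)
  also have "\<dots> = - ?P" using hk by (auto simp: homeomorphism_def)
  finally have "homeomorphism (sphere 0 1 - F) (- ?P) h k"
    by (intro homeomorphism_of_subsets[OF hk _ subset_UNIV]) (use F in auto)
  moreover have "card ?P = card F - 1"
  proof -
    have "inj_on h (F - {b})" using F by (intro inj_on_subset[OF inj]) auto
    then show ?thesis using F by (simp add: card_image)
  qed
  ultimately show ?thesis using that[of ?P] F by auto
qed

text \<open>
  Above the simply connected sphere there would be \<open>d\<close> sheets, hence \<open>2 ^ d\<close> clopen sets, but a
  sphere is connected and has two.
\<close>

lemma no_covering_of_sphere:
  assumes cov: "covering_space S2 p S2" and d: "\<And>x. x \<in> S2 \<Longrightarrow> card {y\<in>S2. p y = x} = d" "d \<ge> 2"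
  shows False
proof -
  obtain x0 :: "real^3" where x0: "x0 \<in> S2" using vector_choose_size[of 1] by auto
  have sc: "simply_connected S2" "locally path_connected S2"
    by (auto simp: simply_connected_sphere locally_path_connected_sphere)
  have "card (clopens (S2 \<inter> p -` S2)) = 2 ^ card {x\<in>S2. p x = x0}"
    by (rule card_clopens_over_simply_connected[OF cov subset_refl sc x0])
       (use d x0 in \<open>auto intro!: card_ge_0_finite\<close>)
  moreover have "S2 \<inter> p -` S2 = S2" using covering_space_imp_surjective[OF cov] by blast
  ultimately have c: "card (clopens S2) = 2 ^ d" using d(1)[OF x0] by simp
  have "connected S2" using sc(1) by (rule simply_connected_imp_connected)
  then have "clopens S2 \<subseteq> {{}, S2}" using clopens_connected by blast
  then have "card (clopens S2) \<le> card {{}, S2}" by (intro card_mono) auto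
  also have "\<dots> \<le> 2" by (simp add: card_insert_if)
  also have "2 < (2::nat) ^ d" using d(2) power_strict_increasing[of 1 d "2::nat"] by auto
  finally show False using c by simp
qed

text \<open>
  Removing the branch values and everything above them leaves a connected surface that covers a
  punctured plane with degree \<open>d\<close> and is itself homeomorphic to a punctured plane. The two values
  for the number of its square classes determine the number of removed points, and the local degrees
  turn this number into the sum.
\<close>

theorem riemann_hurwitz:
  assumes bc: "branched_covering d p" and d2: "d \<ge> 2"
  shows "finite (critical_points p)"
    and "(\<Sum>y\<in>critical_points p. ramification_number p y - 1) = 2 * d - 2"
proof -
  let ?k = "ramification_number p"
  have p: "continuous_on S2 p" "p ` S2 \<subseteq> S2" using bc by (auto simp: branched_covering_def)
  define good where "good = (\<lambda>F. finite F \<and> F \<subseteq> S2 \<and>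
       covering_space (S2 - p -` F) p (S2 - F) \<and>
       (\<forall>x \<in> S2 - F. finite {y\<in>S2. p y = x} \<and> card {y\<in>S2. p y = x} = d) \<and>
       (\<forall>x\<in>F. \<exists>V. openin (top_of_set S2) V \<and> x \<in> V \<and>
          (\<forall>y\<in>S2. p y = x \<longrightarrow> (\<exists>U k. power_model p U V y k))))"
  obtain F where "good F" using bc unfolding branched_covering_def good_def[symmetric] by auto
  then have F: "finite F" "F \<subseteq> S2" and cov: "covering_space (S2 - p -` F) p (S2 - F)"
    and fd: "\<And>x. x \<in> S2 - F \<Longrightarrow> finite {y\<in>S2. p y = x} \<and> card {y\<in>S2. p y = x} = d"
    and loc: "\<And>x. x \<in> F \<Longrightarrow> \<exists>V. openin (top_of_set S2) V \<and> x \<in> V \<and>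
          (\<forall>y\<in>S2. p y = x \<longrightarrow> (\<exists>U k. power_model p U V y k))"
    unfolding good_def by simp_all
  have pm: "\<exists>U V. power_model p U V y (?k y)" if y: "y \<in> S2" "p y \<in> F" for y
  proof -
    obtain U V k where "power_model p U V y k" using loc[OF y(2)] y(1) by blast
    then show ?thesis using ramification_number_eq by blast
  qed
  have kpos: "?k y \<ge> 1" if "y \<in> S2" "p y \<in> F" for y
    using pm[OF that] by (auto simp: power_model_def)
  have fib: "(\<Sum>y\<in>{y\<in>S2. p y = x}. ?k y) = d" if "x \<in> F" for x
    by (rule sum_local_degrees_eq_degree[OF p _ F(1)]) (use that F fd pm in auto)
  have fibfin: "finite {y\<in>S2. p y = x}" if "x \<in> F" for x
    by (rule fibre_finite_of_power_models[OF p(1)]) (use pm that in blast)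
  define Y where "Y = {y\<in>S2. p y \<in> F}"
  have Yeq: "Y = (\<Union>x\<in>F. {y\<in>S2. p y = x})" by (auto simp: Y_def)
  have finY: "finite Y" unfolding Yeq using F fibfin by auto
  have crit: "critical_points p = {y\<in>Y. ?k y > 1}"
    using ramification_number_regular[OF cov F(1) p(1)] by (force simp: critical_points_def Y_def)
  then show "finite (critical_points p)" using finY by simp
  have Fne: "F \<noteq> {}"
  proof
    assume "F = {}"
    then show False using no_covering_of_sphere[of p d] cov fd d2 by auto
  qed
  then obtain b where b: "b \<in> F" by blast
  have "{y\<in>S2. p y = b} \<noteq> {}" using fib[OF b] d2 by (metis sum.empty not_numeral_le_zero)
  then obtain c where c: "c \<in> Y" using b by (auto simp: Y_def)
  have X: "S2 - p -` F = S2 - Y" by (auto simp: Y_def)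
  obtain P h k where P: "finite (P::complex set)" "card P = card F - 1" "homeomorphism (S2 - F) (- P) h k"
    by (rule sphere_minus_finite_homeomorphism[OF _ F b]) auto
  obtain P' h' k' where P': "finite (P'::complex set)" "card P' = card Y - 1" "homeomorphism (S2 - Y) (- P') h' k'"
    by (rule sphere_minus_finite_homeomorphism[OF _ finY _ c]) (auto simp: Y_def)
  have conn: "connected (S2 - Y)"
  proof -
    have "connected (UNIV - P')" using P'(1) by (intro connected_open_delete_finite) auto
    then have "connected (- P')" by (simp add: Compl_eq_Diff_UNIV)
    then have "connected (k' ` (- P'))" using P'(3)
      by (intro connected_continuous_image) (auto simp: homeomorphism_def)
    then show ?thesis using P'(3) by (simp add: homeomorphism_def)
  qed
  have "card (square_classes (S2 - Y)) * 2 ^ (2 * d) = 2 * 2 ^ (d * (card P + 1))"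
  proof (rule card_square_classes_covering_punctured_plane[OF _ _ _ P(3) P(1) conn])
    show "covering_space (S2 - Y) p (S2 - F)" using cov X by simp
    fix z assume z: "z \<in> S2 - F"
    then have "{x \<in> S2 - Y. p x = z} = {x\<in>S2. p x = z}" by (auto simp: Y_def)
    then show "card {x \<in> S2 - Y. p x = z} = d" using fd[OF z] by simp
  qed (use d2 in auto)
  moreover have "card (square_classes (S2 - Y)) * 2 ^ (2 * 1) = 2 * 2 ^ (1 * (card P' + 1))"
  proof (rule card_square_classes_covering_punctured_plane[OF _ _ _ P'(3) P'(1) conn])
    show "covering_space (S2 - Y) id (S2 - Y)"
      by (rule homeomorphism_imp_covering_space[of _ _ _ id]) (auto simp: homeomorphism_def continuous_on_id)
    fix z assume z: "z \<in> S2 - Y"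
    then have "{x \<in> S2 - Y. id x = z} = {z}" by auto
    then show "card {x \<in> S2 - Y. id x = z} = 1" by simp
  qed auto
  moreover have "card F > 0" "card Y > 0"
    unfolding card_gt_0_iff using Fne F(1) c finY by blast+
  then have "card P + 1 = card F" "card P' + 1 = card Y"
    using P(2) P'(2) by simp_all
  moreover note c1 = this
  ultimately have e: "card (square_classes (S2 - Y)) * 2 ^ (2 * d) = 2 * 2 ^ (d * card F)"
    "card (square_classes (S2 - Y)) * 4 = 2 * 2 ^ card Y"
    unfolding c1[symmetric] by simp_all
  have "(2::nat) ^ (card Y + 2 * d) = 2 ^ (d * card F + 2)"
  proof -
    have "2 * (2::nat) ^ (card Y + 2 * d) = (card (square_classes (S2 - Y)) * 4) * 2 ^ (2 * d)"
      unfolding e(2) by (simp add: power_add)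
    also have "\<dots> = 4 * (card (square_classes (S2 - Y)) * 2 ^ (2 * d))" by simp
    also have "\<dots> = 2 * 2 ^ (d * card F + 2)" unfolding e(1) by simp
    finally show ?thesis by simp
  qed
  \<comment> \<open>the Euler characteristic \<open>2 - card Y\<close> is d times \<open>2 - card F\<close>\<close>
  then have euler: "card Y + 2 * d = d * card F + 2"
    by (rule power_inject_exp[THEN iffD1, rotated]) simp
  have "(\<Sum>y\<in>Y. ?k y) = (\<Sum>x\<in>F. \<Sum>y\<in>{y\<in>S2. p y = x}. ?k y)"
    unfolding Yeq by (rule sum.UNION_disjoint) (use F fibfin in auto)
  also have "\<dots> = d * card F" using fib by simp
  finally have s: "(\<Sum>y\<in>Y. ?k y) = d * card F" .
  have "(\<Sum>y\<in>Y. ?k y) = (\<Sum>y\<in>Y. (?k y - 1) + 1)"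
  proof (rule sum.cong)
    fix y assume "y \<in> Y"
    then have "?k y \<ge> 1" using kpos by (simp add: Y_def)
    then show "?k y = (?k y - 1) + 1" by simp
  qed simp
  also have "\<dots> = (\<Sum>y\<in>Y. ?k y - 1) + card Y" by (simp only: sum.distrib) simp
  finally have s2: "(\<Sum>y\<in>Y. ?k y - 1) + card Y = d * card F" using s by simp
  have "(\<Sum>y\<in>critical_points p. ?k y - 1) = (\<Sum>y\<in>Y. ?k y - 1)"
    unfolding crit by (rule sum.mono_neutral_left[OF finY]) auto
  then show "(\<Sum>y\<in>critical_points p. ?k y - 1) = 2 * d - 2" using s2 euler by linarith
qed

section \<open>From punctured coverings to power maps\<close>

text \<open>
  Invariance of domain for maps between 2-spheres: locally the image misses a point, and composing
  with a chart of its complement leads to maps from the sphere to the plane.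
\<close>

lemma openin_image_inj_sphere:
  fixes f :: "'a::euclidean_space \<Rightarrow> 'b::euclidean_space"
  assumes dim: "DIM('a) = 3" "DIM('b) = 3" and W: "openin (top_of_set (sphere 0 1)) W"
    and f: "continuous_on W f" "inj_on f W" "f ` W \<subseteq> sphere 0 1"
  shows "openin (top_of_set (sphere 0 1)) (f ` W)"
proof (subst openin_subopen, clarify)
  fix x assume x: "x \<in> W"
  let ?S = "sphere (0::'b) 1"
  have fx: "f x \<in> ?S" using f(3) x by auto
  define b where "b = - f x"
  have b: "b \<in> ?S" using fx by (simp add: b_def)
  have "f x \<noteq> b"
  proof
    assume "f x = b"
    then have "2 *\<^sub>R f x = 0" unfolding b_def by (metis add.right_inverse scaleR_2)
    then show False using fx by simp
  qed
  obtain h k where hk: "homeomorphism (?S - {b}) (UNIV::complex set) h k"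
    using punctured_sphere_homeomorphism_plane[OF dim(2) b] .
  define W' where "W' = W \<inter> f -` (- {b})"
  have W': "openin (top_of_set (sphere 0 1)) W'"
    unfolding W'_def by (rule openin_trans[OF continuous_openin_preimage_gen[OF f(1)] W]) auto
  have fW': "f ` W' \<subseteq> ?S - {b}" using f(3) by (auto simp: W'_def)
  have kh: "k (h z) = z" if "z \<in> ?S - {b}" for z using hk that by (auto simp: homeomorphism_def)
  have "continuous_on W' (h \<circ> f)"
  proof (rule continuous_on_compose)
    show "continuous_on W' f" using f(1) by (rule continuous_on_subset) (auto simp: W'_def)
    show "continuous_on (f ` W') h" using hk fW' by (auto simp: homeomorphism_def intro: continuous_on_subset)
  qed
  moreover have "inj_on (h \<circ> f) W'"
  proof (rule comp_inj_on)
    show "inj_on f W'" using f(2) by (rule inj_on_subset) (auto simp: W'_def)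
    show "inj_on h (f ` W')"
      by (rule inj_on_subset[OF inj_on_inverseI[of "?S - {b}" k h] fW']) (rule kh)
  qed
  ultimately have "openin (top_of_set UNIV) ((h \<circ> f) ` W')"
    by (intro invariance_of_domain_sphere_affine_set[OF _ _ _ _ _ _ W']) (use dim in auto)
  then have "openin (top_of_set (?S - {b})) (k ` (h \<circ> f) ` W')"
    by (rule homeomorphism_imp_open_map[OF homeomorphism_symD[OF hk]])
  moreover have "k ` (h \<circ> f) ` W' = f ` W'"
  proof -
    have "k (h (f a)) = f a" if "a \<in> W'" for a using kh[of "f a"] fW' that by blast
    then show ?thesis by (simp add: image_image cong: image_cong)
  qed
  ultimately have "openin (top_of_set (?S - {b})) (f ` W')" by simp
  then have "openin (top_of_set ?S) (f ` W')"
    by (rule openin_trans) (rule openin_sphere_delete_finite, auto)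
  moreover have "f x \<in> f ` W'" using x \<open>f x \<noteq> b\<close> by (auto simp: W'_def)
  moreover have "f ` W' \<subseteq> f ` W" by (auto simp: W'_def)
  ultimately show "\<exists>T. openin (top_of_set (sphere 0 1)) T \<and> f x \<in> T \<and> T \<subseteq> f ` W" by blast
qed

text \<open>
  The set \<open>U\<close> misses a point, so this is the corresponding statement for open sets in the plane.
\<close>

lemma connected_openin_sphere_delete:
  fixes U :: "'a::euclidean_space set"
  assumes dim: "DIM('a) = 3" and U: "openin (top_of_set (sphere 0 1)) U" "connected U"
    and b: "b \<in> sphere 0 1" "b \<notin> U"
  shows "connected (U - {y})"
proof (cases "y \<in> U")
  case True
  obtain h k where hk: "homeomorphism (sphere 0 1 - {b}) (UNIV::complex set) h k"
    using punctured_sphere_homeomorphism_plane[OF dim b(1)] .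
  have Us: "U \<subseteq> sphere 0 1 - {b}" using openin_imp_subset[OF U(1)] b by auto
  have kh: "k (h z) = z" if "z \<in> U" for z using hk that Us by (auto simp: homeomorphism_def)
  have "openin (top_of_set (sphere 0 1 - {b})) U"
    by (rule openin_subset_trans[OF U(1) Us]) auto
  then have "open (h ` U)" using homeomorphism_imp_open_map[OF hk] by simp
  moreover have "connected (h ` U)"
    using U(2) hk Us by (intro connected_continuous_image) (auto simp: homeomorphism_def intro: continuous_on_subset)
  ultimately have "connected (h ` U - {h y})" by (intro connected_open_delete) auto
  moreover have "continuous_on (h ` U - {h y}) k"
    using hk by (auto simp: homeomorphism_def intro: continuous_on_subset)
  ultimately have "connected (k ` (h ` U - {h y}))" by (rule connected_continuous_image[rotated])
  moreover have "h ` U - {h y} = h ` (U - {y})"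
    using kh True by (auto simp: image_iff) (metis kh)
  then have "k ` (h ` U - {h y}) = U - {y}"
    using kh by (force simp: image_image)
  ultimately show ?thesis by simp
qed (use U in simp)

text \<open>
  On each smaller closed disc \<open>\<theta>\<close> is a homeomorphism by compactness, and the function \<open>m\<close> shows that
  the images of the smaller open discs are open.
\<close>

lemma homeomorphism_of_proper_modulus:
  fixes \<theta> :: "complex \<Rightarrow> 'a::metric_space" and m :: "'a \<Rightarrow> real"
  assumes cont: "continuous_on (ball 0 1) \<theta>" and im: "\<theta> ` ball 0 1 = U" and inj: "inj_on \<theta> (ball 0 1)"
    and m: "continuous_on U m" "\<And>z. z \<in> ball 0 1 \<Longrightarrow> m (\<theta> z) = cmod z ^ k" and k: "k > 0"
  shows "homeomorphism U (ball 0 1) (inv_into (ball 0 1) \<theta>) \<theta>"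
proof -
  let ?\<phi> = "inv_into (ball 0 1) \<theta>"
  have \<phi>\<theta>: "?\<phi> (\<theta> z) = z" if "z \<in> ball 0 1" for z using inj that by (rule inv_into_f_f)
  have "continuous_on U ?\<phi>"
  proof (rule continuous_on_openin_cover)
    fix u assume "u \<in> U"
    then obtain z where z: "z \<in> ball 0 1" "u = \<theta> z" using im by auto
    obtain r where r: "cmod z < r" "r < 1" using z(1) dense by (auto simp: dist_norm)
    have r0: "r > 0" using r(1) norm_ge_zero[of z] by linarith
    let ?V = "U \<inter> m -` {..< r ^ k}"
    have "openin (top_of_set U) ?V" by (rule continuous_openin_preimage_gen[OF m(1)]) simp
    moreover have "u \<in> ?V"
      using \<open>u \<in> U\<close> m(2)[OF z(1)] z r k by (auto intro!: power_strict_mono)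
    moreover have "continuous_on ?V ?\<phi>"
    proof (rule continuous_on_subset)
      have sub: "cball 0 r \<subseteq> ball (0::complex) 1" using r by auto
      show "continuous_on (\<theta> ` cball 0 r) ?\<phi>"
        by (rule continuous_on_inv) (use continuous_on_subset[OF cont sub] \<phi>\<theta> sub in auto)
      show "?V \<subseteq> \<theta> ` cball 0 r"
      proof
        fix v assume v: "v \<in> ?V"
        then obtain w where w: "w \<in> ball 0 1" "v = \<theta> w" using im by auto
        have "cmod w ^ k < r ^ k" using v w m(2)[OF w(1)] by simp
        then have "cmod w < r" by (rule power_less_imp_less_base) (use r0 in simp)
        then show "v \<in> \<theta> ` cball 0 r" using w by auto
      qed
    qed
    ultimately show "\<exists>V. openin (top_of_set U) V \<and> u \<in> V \<and> continuous_on V ?\<phi>" by blast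
  qed
  moreover have "?\<phi> ` U = ball 0 1" using \<phi>\<theta> im by (force simp: image_iff)
  ultimately show ?thesis
    unfolding homeomorphism_def using cont im \<phi>\<theta> by auto
qed

text \<open>
  Coverings of a punctured disc are power maps. The exponential \<open>e\<close> from the left half-plane \<open>H\<close> to
  \<open>V - {x}\<close> lifts to a map \<open>g\<close> from \<open>H\<close> to \<open>U - {y}\<close>, which is onto because paths in \<open>U - {y}\<close> can be
  followed by logarithms. Finiteness of the fibres forces some \<open>g\<close>-period \<open>2 \<pi> k \<i>\<close> with \<open>k > 0\<close>; for the
  least \<open>k\<close>, the map \<open>\<theta> z = g (k * Ln z)\<close> is a well-defined bijection from the punctured disc to
  \<open>U - {y}\<close> with \<open>p (\<theta> z)\<close> having the coordinate \<open>z ^ k\<close>. The properness assumption says that points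
  of \<open>U\<close> above a small neighbourhood of \<open>x\<close> are close to \<open>y\<close>; it makes \<open>\<theta>\<close> continuous at 0.
\<close>

lemma power_model_of_punctured_covering:
  assumes cov: "covering_space X p Z" and VZ: "V - {x} \<subseteq> Z"
    and fib: "\<And>x. x \<in> Z \<Longrightarrow> finite {u\<in>X. p u = x}"
    and V: "openin (top_of_set S2) V" "x \<in> V" "homeomorphism V (ball (0::complex) 1) \<psi> \<psi>'" "\<psi> x = 0"
    and U: "openin (top_of_set S2) U" "y \<in> U" "p y = x" "p ` U \<subseteq> V" "connected (U - {y})"
    and pU: "continuous_on U p" and UX: "U - {y} \<subseteq> X"
    and yonly: "\<And>u. u \<in> U \<Longrightarrow> p u = x \<Longrightarrow> u = y"
    and maxU: "\<And>T. connected T \<Longrightarrow> T \<subseteq> X \<Longrightarrow> p ` T \<subseteq> V \<Longrightarrow> T \<inter> U \<noteq> {} \<Longrightarrow> T \<subseteq> U"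
    and proper: "\<And>O'. openin (top_of_set S2) O' \<Longrightarrow> y \<in> O' \<Longrightarrow>
        \<exists>N. openin (top_of_set S2) N \<and> x \<in> N \<and> (\<forall>u\<in>U. p u \<in> N \<longrightarrow> u \<in> O')"
  shows "\<exists>k. power_model p U V y k"
proof -
  have \<psi>V: "\<psi> ` V = ball 0 1" "\<And>v. v \<in> V \<Longrightarrow> \<psi>' (\<psi> v) = v" "\<And>z. z \<in> ball 0 1 \<Longrightarrow> \<psi> (\<psi>' z) = z"
    "\<psi>' ` ball 0 1 = V" "continuous_on V \<psi>" "continuous_on (ball 0 1) \<psi>'"
    using V(3) by (auto simp: homeomorphism_def)
  have \<psi>0: "\<psi> v = 0 \<longleftrightarrow> v = x" if "v \<in> V" for v using \<psi>V(2) that V(2,4) by metis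
  define H where "H = {w::complex. Re w < 0}"
  have H: "convex H" "open H" unfolding H_def by (simp_all add: convex_halfspace_Re_lt open_halfspace_Re_lt)
  then have scH: "simply_connected H" "locally path_connected H" "connected H"
    by (auto intro: convex_imp_simply_connected open_imp_locally_path_connected convex_connected)
  have expH: "exp w \<in> ball 0 1" if "w \<in> H" for w using that by (simp add: H_def)
  define e where "e = (\<lambda>w. \<psi>' (exp w))"
  have e: "e w \<in> V" "e w \<noteq> x" if "w \<in> H" for w
  proof -
    show "e w \<in> V" using expH[OF that] \<psi>V(4) by (auto simp: e_def)
    then show "e w \<noteq> x" using \<psi>0[of "e w"] \<psi>V(3)[OF expH[OF that]] by (simp add: e_def)
  qed
  have eH: "continuous_on H e" "e \<in> H \<rightarrow> Z"
  proof -
    show "continuous_on H e" unfolding e_def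
      by (rule continuous_on_compose2[OF \<psi>V(6)]) (use expH in \<open>auto intro!: continuous_intros\<close>)
    show "e \<in> H \<rightarrow> Z" using e VZ by auto
  qed
  have "infinite U" by (rule infinite_openin_sphere) (use U in auto)
  then have "\<not> U \<subseteq> {y}" using finite_subset by blast
  then obtain u0 where u0: "u0 \<in> U" "u0 \<noteq> y" by blast
  have lnU: "p u \<in> V" "\<psi> (p u) \<noteq> 0" "\<psi> (p u) \<in> ball 0 1" if "u \<in> U" "u \<noteq> y" for u
  proof -
    show "p u \<in> V" using U(4) that by auto
    then show "\<psi> (p u) \<noteq> 0" "\<psi> (p u) \<in> ball 0 1" using \<psi>0 yonly that \<psi>V(1) by blast+
  qed
  define w0 where "w0 = Ln (\<psi> (p u0))"
  have ew0: "exp w0 = \<psi> (p u0)" using lnU[OF u0] by (simp add: w0_def)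
  have inH: "w \<in> H" if "exp w \<in> ball 0 1" for w
    using that by (simp add: H_def)
  have w0: "w0 \<in> H" "e w0 = p u0"
    using inH[of w0] lnU[OF u0] \<psi>V(2) by (auto simp: ew0 e_def)
  have u0X: "u0 \<in> X" using u0 UX by auto
  obtain g where g: "continuous_on H g" "g \<in> H \<rightarrow> X" "g w0 = u0" "\<And>w. w \<in> H \<Longrightarrow> p (g w) = e w"
    by (rule covering_space_lift_strong[OF cov u0X w0(1) scH(1,2) eH w0(2)]) (rule that)
  have gU: "g w \<in> U" "g w \<noteq> y" if "w \<in> H" for w
  proof -
    have "g ` H \<subseteq> U"
    proof (rule maxU)
      show "connected (g ` H)" using g(1) scH(3) by (rule connected_continuous_image)
      show "g ` H \<inter> U \<noteq> {}" using g(3) w0 u0 by blast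
    qed (use g e in auto)
    then show "g w \<in> U" using that by blast
    show "g w \<noteq> y" using g(4)[OF that] e(2)[OF that] U(3) by auto
  qed
  have surj: "\<exists>w\<in>H. g w = u" if u: "u \<in> U" "u \<noteq> y" for u
  proof -
    have "openin (top_of_set S2) (U - {y})" using U(1) by (intro openin_sphere_delete_finite) auto
    then have "locally path_connected (U - {y})"
      by (rule locally_open_subset[rotated]) (rule locally_path_connected_sphere)
    then have "path_connected (U - {y})"
      using U(5) by (simp add: path_connected_component connected_iff_connected_component
          path_component_eq_connected_component)
    then obtain \<gamma> where \<gamma>: "path \<gamma>" "path_image \<gamma> \<subseteq> U - {y}" "pathstart \<gamma> = u0" "pathfinish \<gamma> = u"
      using u0 u unfolding path_connected_def by blast
    have \<gamma>U: "\<gamma> t \<in> U" "\<gamma> t \<noteq> y" if "t \<in> {0..1}" for t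
    proof -
      have "\<gamma> t \<in> U - {y}" using \<gamma>(2) that unfolding path_image_def by blast
      then show "\<gamma> t \<in> U" "\<gamma> t \<noteq> y" by auto
    qed
    have c\<gamma>: "continuous_on {0..1} \<gamma>" using \<gamma>(1) by (simp add: path_def)
    have cp\<gamma>: "continuous_on {0..1} (p \<circ> \<gamma>)"
      by (intro continuous_on_compose c\<gamma> continuous_on_subset[OF pU]) (use \<gamma>U in auto)
    have "continuous_on {0..1} (\<psi> \<circ> (p \<circ> \<gamma>))"
      by (intro continuous_on_compose cp\<gamma> continuous_on_subset[OF \<psi>V(5)]) (use \<gamma>U U(4) in auto)
    moreover have "(\<psi> \<circ> (p \<circ> \<gamma>)) t \<noteq> 0" if "t \<in> {0..1}" for t
      using lnU[OF \<gamma>U[OF that]] by simp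
    ultimately obtain l where l: "continuous_on {0..1} l" "\<And>t. t \<in> {0..1} \<Longrightarrow> (\<psi> \<circ> (p \<circ> \<gamma>)) t = exp (l t)"
      using continuous_logarithm_on_contractible[of "{0..1::real}" "\<psi> \<circ> (p \<circ> \<gamma>)"]
      by (metis convex_imp_contractible convex_real_interval(5))
    \<comment> \<open>the logarithm of the path that starts at w0\<close>
    define l' where "l' = (\<lambda>t. l t + (w0 - l 0))"
    have "exp (l 0) = exp w0" using l(2)[of 0] \<gamma>(3) ew0 by (simp add: pathstart_def)
    then have el': "exp (l' t) = \<psi> (p (\<gamma> t))" if "t \<in> {0..1}" for t
      using l(2)[OF that] by (simp add: l'_def exp_add exp_diff)
    have l'H: "l' t \<in> H" if "t \<in> {0..1}" for t
      by (rule inH, unfold el'[OF that]) (rule lnU(3)[OF \<gamma>U[OF that]])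
    have cl': "continuous_on {0..1} l'" unfolding l'_def by (intro continuous_intros l)
    have "(g \<circ> l') 1 = \<gamma> 1"
    proof (rule covering_space_lift_unique[OF cov _ cp\<gamma>])
      show "(g \<circ> l') 0 = \<gamma> 0" using g(3) \<gamma>(3) by (simp add: l'_def pathstart_def)
      show "p \<circ> \<gamma> \<in> {0..1} \<rightarrow> Z"
        using VZ U(4) \<gamma>U yonly by fastforce
      show "continuous_on {0..1} (g \<circ> l')"
        by (intro continuous_on_compose cl' continuous_on_subset[OF g(1)]) (use l'H in auto)
      show "g \<circ> l' \<in> {0..1} \<rightarrow> X" using l'H g(2) by auto
      show "\<gamma> \<in> {0..1} \<rightarrow> X" using \<gamma>U UX by blast
      show "(p \<circ> \<gamma>) t = p ((g \<circ> l') t)" if "t \<in> {0..1}" for t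
        using g(4)[OF l'H[OF that]] el'[OF that] \<psi>V(2) lnU[OF \<gamma>U[OF that]] by (simp add: e_def)
    qed (use c\<gamma> in auto)
    then show ?thesis using \<gamma>(4) l'H[of 1] by (auto simp: pathfinish_def)
  qed
  \<comment> \<open>c n is the n-th period of exp, and per n says that it is a period of g\<close>
  define c where "c = (\<lambda>n::int. of_int (2 * n) * of_real pi * \<i> :: complex)"
  have cadd: "c (m + n) = c m + c n" "c (- n) = - c n" "c 0 = 0" for m n by (auto simp: c_def algebra_simps)
  have cH: "w + c n \<in> H \<longleftrightarrow> w \<in> H" for w n by (simp add: H_def c_def)
  have expc: "exp (w + c n) = exp w" for w n
    using exp_eq[of "w + c n" w] by (auto simp: c_def)
  define per where "per = (\<lambda>n. \<forall>w\<in>H. g (w + c n) = g w)"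
  have perI: "per n" if "w \<in> H" "g (w + c n) = g w" for n w
    unfolding per_def
  proof
    fix w' assume w': "w' \<in> H"
    have "((\<lambda>w. g (w + c n)) w') = g w'"
    proof (rule covering_space_lift_unique[OF cov _ eH])
      show "continuous_on H (\<lambda>w. g (w + c n))"
        by (rule continuous_on_compose2[OF g(1)]) (auto intro!: continuous_intros simp: cH)
      show "(\<lambda>w. g (w + c n)) \<in> H \<rightarrow> X" using g(2) cH by auto
      show "e t = p (g (t + c n))" if "t \<in> H" for t
        using g(4)[of "t + c n"] that cH by (simp add: e_def expc)
    qed (use that g scH w' in auto)
    then show "g (w' + c n) = g w'" .
  qed
  have per_add: "per (m + n)" if "per m" "per n" for m n
    using that cH unfolding per_def cadd by (metis add.assoc)
  have per_neg: "per (- n)" if "per n" for n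
    unfolding per_def cadd
  proof
    fix w assume "w \<in> H"
    then have "w - c n \<in> H" using cH[of w "-n"] by (simp add: cadd)
    then show "g (w + - c n) = g w" using that unfolding per_def by (metis diff_add_cancel uminus_add_conv_diff add.commute)
  qed
  have per_mult: "per (of_nat m * n)" if "per n" for m n
  proof (induction m)
    case (Suc m)
    then show ?case using per_add[OF that Suc] by (simp add: algebra_simps)
  qed (simp add: per_def cadd)
  have per_mult': "per (m * n)" if "per n" for m n
    using per_mult[OF that, of "nat m"] per_neg[OF per_mult[OF that, of "nat (- m)"]]
    by (cases "m \<ge> 0") auto
  obtain n0 :: nat where n0: "n0 > 0" "per (int n0)"
  proof -
    have "(\<lambda>n::nat. g (w0 + c (int n))) ` UNIV \<subseteq> {u\<in>X. p u = e w0}"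
      using g cH[of w0] w0(1) by (auto simp: e_def expc Pi_iff)
    moreover have "finite {u\<in>X. p u = e w0}" using fib eH(2) w0(1) by blast
    ultimately have "finite ((\<lambda>n::nat. g (w0 + c (int n))) ` UNIV)" using finite_subset by blast
    then have "\<not> inj (\<lambda>n::nat. g (w0 + c (int n)))" using finite_imageD infinite_UNIV_nat by blast
    then obtain m n :: nat where mn: "m < n" "g (w0 + c (int m)) = g (w0 + c (int n))"
      unfolding inj_def by (metis linorder_neqE_nat)
    have "c (int n) = c (int m) + c (int n - int m)" by (simp flip: cadd)
    then have "per (int n - int m)"
      using mn(2) w0(1) cH by (intro perI[of "w0 + c (int m)"]) (auto simp: algebra_simps)
    then show ?thesis using that[of "n - m"] mn(1) by (simp add: of_nat_diff)
  qed
  \<comment> \<open>the ramification number\<close>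
  define k where "k = (LEAST n. n > 0 \<and> per (int n))"
  have k: "k > 0" "per (int k)" using LeastI[of "\<lambda>n. n > 0 \<and> per (int n)" n0] n0 by (auto simp: k_def)
  have kmin: "k \<le> n" if "n > 0" "per (int n)" for n unfolding k_def using that by (intro Least_le) auto
  have perk: "int k dvd n" if "per n" for n
  proof (rule ccontr)
    assume "\<not> int k dvd n"
    then have pos: "n mod int k > 0" using k(1) by (metis dvd_eq_mod_eq_0 of_nat_0_less_iff order_le_less pos_mod_sign)
    have "n mod int k = n + (- (n div int k)) * int k" by (simp add: minus_div_mult_eq_mod[symmetric])
    then have "per (n mod int k)" using per_add[OF that per_mult'[OF k(2), of "- (n div int k)"]] by simp
    then have "k \<le> nat (n mod int k)" using pos by (intro kmin) auto
    then show False using pos_mod_bound[of "int k" n] k(1) pos by linarith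
  qed
  have same: "g w = g w' \<longleftrightarrow> (\<exists>j. w' = w + c (int k * j))" if "w \<in> H" "w' \<in> H" for w w'
  proof
    assume eq: "g w = g w'"
    then have "\<psi>' (exp w) = \<psi>' (exp w')" using g(4) that by (metis e_def)
    then have "exp w' = exp w" using \<psi>V(3) expH that by metis
    then obtain n where "w' = w + c n" unfolding exp_eq by (auto simp: c_def)
    then have "per n" using eq that by (intro perI[of w]) auto
    then obtain j where "n = int k * j" using perk by blast
    then show "\<exists>j. w' = w + c (int k * j)" using \<open>w' = w + c n\<close> by blast
  next
    assume "\<exists>j. w' = w + c (int k * j)"
    then obtain j where j: "w' = w + c (int k * j)" by blast
    have "per (int k * j)" using per_mult'[OF k(2), of j] by (simp add: mult.commute)
    then show "g w = g w'" using that j by (simp add: per_def)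
  qed
  define \<theta> where "\<theta> = (\<lambda>z. if z = 0 then y else g (of_nat k * Ln z))"
  have ckj: "c (int k * j) = of_nat k * c j" for j by (simp add: c_def)
  have LnH: "of_nat k * L \<in> H" if "exp L = z" "z \<in> ball 0 1" for z L
    using that inH[of L] k(1) by (simp add: H_def zero_less_mult_iff mult_pos_neg)
  have \<theta>L: "\<theta> z = g (of_nat k * L)" if "exp L = z" "z \<in> ball 0 1" for z L
  proof -
    have z: "z \<noteq> 0" using that(1) by auto
    have "exp (Ln z) = exp L" using z that by simp
    then obtain j where "Ln z = L + c j" unfolding exp_eq by (auto simp: c_def)
    then have "of_nat k * Ln z = of_nat k * L + c (int k * j)" by (simp only: ckj distrib_left)
    moreover have "of_nat k * Ln z \<in> H" using LnH[of "Ln z" z] z that(2) by simp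
    ultimately show ?thesis using same[of "of_nat k * L" "of_nat k * Ln z"] LnH[OF that] z by (auto simp: \<theta>_def)
  qed
  have \<theta>p: "p (\<theta> z) = \<psi>' (z ^ k)" if "z \<in> ball 0 1" for z
  proof (cases "z = 0")
    case True
    then show ?thesis using U(3) k(1) \<psi>V(2)[OF V(2)] V(4) by (simp add: \<theta>_def zero_power)
  next
    case False
    then show ?thesis using g(4)[OF LnH[of "Ln z" z]] that by (simp add: \<theta>_def e_def exp_of_nat_mult)
  qed
  have \<theta>U: "\<theta> z \<in> U" "\<theta> z = y \<longleftrightarrow> z = 0" if "z \<in> ball 0 1" for z
    using gU[OF LnH[of "Ln z" z]] that U(2) by (auto simp: \<theta>_def)
  have inj: "inj_on \<theta> (ball 0 1)"
  proof (rule inj_onI)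
    fix z z' assume zz: "z \<in> ball 0 1" "z' \<in> ball 0 1" "\<theta> z = \<theta> z'"
    show "z = z'"
    proof (cases "z = 0")
      case True
      then show ?thesis using \<theta>U(2) zz by metis
    next
      case False
      then have z': "z' \<noteq> 0" using \<theta>U(2) zz by metis
      then have "g (of_nat k * Ln z) = g (of_nat k * Ln z')" using zz False by (simp add: \<theta>_def)
      then obtain j where "of_nat k * Ln z' = of_nat k * Ln z + c (int k * j)"
        using same LnH[of "Ln z" z] LnH[of "Ln z'" z'] zz False z' by auto
      then have "of_nat k * Ln z' = of_nat k * (Ln z + c j)" by (simp only: ckj distrib_left)
      then have "Ln z' = Ln z + c j" using k(1) by simp
      then have "exp (Ln z') = exp (Ln z)" by (simp add: expc)
      then show ?thesis using False z' by simp
    qed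
  qed
  have im: "\<theta> ` ball 0 1 = U"
  proof
    show "\<theta> ` ball 0 1 \<subseteq> U" using \<theta>U(1) by blast
    show "U \<subseteq> \<theta> ` ball 0 1"
    proof
      fix u assume u: "u \<in> U"
      show "u \<in> \<theta> ` ball 0 1"
      proof (cases "u = y")
        case True
        then show ?thesis by (intro image_eqI[of _ _ 0]) (auto simp: \<theta>_def)
      next
        case False
        then obtain w where w: "w \<in> H" "g w = u" using surj u by blast
        have "w / of_nat k \<in> H" using w(1) k(1) by (simp add: H_def divide_neg_pos)
        then have b: "exp (w / of_nat k) \<in> ball 0 1" by (rule expH)
        then show ?thesis using \<theta>L[OF refl b] w k(1) by (intro image_eqI[OF _ b]) simp
      qed
    qed
  qed
  have at0: "continuous (at 0 within ball 0 1) \<theta>"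
    unfolding continuous_within_topological
  proof (intro allI impI)
    fix O' assume O': "open O'" "\<theta> 0 \<in> O'"
    have "openin (top_of_set S2) (S2 \<inter> O')" using O'(1) by (rule openin_open_Int)
    moreover have "y \<in> S2 \<inter> O'"
      using O'(2) U(2) openin_imp_subset[OF U(1)] by (auto simp: \<theta>_def)
    ultimately obtain N where N: "openin (top_of_set S2) N" "x \<in> N" "\<forall>u\<in>U. p u \<in> N \<longrightarrow> u \<in> S2 \<inter> O'"
      using proper by blast
    have "openin (top_of_set V) (V \<inter> N)"
      by (rule openin_subset_trans[OF openin_Int[OF V(1) N(1)]]) (use openin_imp_subset[OF V(1)] in auto)
    then have "openin (top_of_set (ball 0 1)) (\<psi> ` (V \<inter> N))"
      by (rule homeomorphism_imp_open_map[OF V(3)])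
    then have "open (\<psi> ` (V \<inter> N))" by (simp add: openin_open_eq)
    moreover have "0 \<in> \<psi> ` (V \<inter> N)" using V(2,4) N(2) by (metis IntI image_eqI)
    ultimately obtain r where r: "r > 0" "ball 0 r \<subseteq> \<psi> ` (V \<inter> N)" using open_contains_ball by blast
    have "\<theta> z \<in> O'" if z: "z \<in> ball 0 1" "z \<in> ball 0 r" for z
    proof -
      have "cmod z ^ k \<le> cmod z ^ 1" by (rule power_decreasing) (use z k(1) in auto)
      then have "z ^ k \<in> ball 0 r" using z by (simp add: norm_power)
      then obtain v where "v \<in> V \<inter> N" "z ^ k = \<psi> v" using r(2) by auto
      then have "p (\<theta> z) \<in> N" using \<theta>p[OF z(1)] \<psi>V(2) by auto
      then show ?thesis using N(3) \<theta>U(1)[OF z(1)] by blast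
    qed
    then show "\<exists>A. open A \<and> 0 \<in> A \<and> (\<forall>z\<in>ball 0 1. z \<in> A \<longrightarrow> \<theta> z \<in> O')"
      using r(1) by (intro exI[of _ "ball 0 r"]) auto
  qed
  have cont: "continuous_on (ball 0 1) \<theta>"
    unfolding continuous_on_eq_continuous_within
  proof
    fix x :: complex assume x: "x \<in> ball 0 1"
    show "continuous (at x within ball 0 1) \<theta>"
    proof (cases "x = 0")
      case False
      let ?B = "ball x (cmod x)"
      have "continuous_on ?B (\<lambda>x. x)" "\<And>z. z \<in> ?B \<Longrightarrow> z \<noteq> 0" by (auto simp: dist_norm continuous_on_id)
      then obtain L where L: "continuous_on ?B L" "\<And>x. x \<in> ?B \<Longrightarrow> x = exp (L x)"
        by (rule continuous_logarithm_on_ball) auto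
      have "continuous_on (ball 0 1 \<inter> ?B) (\<lambda>x. g (of_nat k * L x))"
      proof (rule continuous_on_compose2[OF g(1)])
        show "continuous_on (ball 0 1 \<inter> ?B) (\<lambda>x. of_nat k * L x)"
          by (intro continuous_intros continuous_on_subset[OF L(1)]) auto
        show "(\<lambda>x. of_nat k * L x) ` (ball 0 1 \<inter> ?B) \<subseteq> H"
          using LnH L(2) by (metis (no_types, lifting) IntD1 IntD2 image_subsetI)
      qed
      then have "continuous_on (ball 0 1 \<inter> ?B) \<theta>"
        by (rule continuous_on_eq) (use \<theta>L L(2) in \<open>metis IntD1 IntD2\<close>)
      moreover have "at x within ball 0 1 = at x within (ball 0 1 \<inter> ?B)"
        using False by (intro at_within_nhd[of x ?B]) auto
      ultimately show ?thesis using x False by (simp add: continuous_on_eq_continuous_within)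
    qed (use at0 in simp)
  qed
  have "homeomorphism U (ball 0 1) (inv_into (ball 0 1) \<theta>) \<theta>"
  proof (rule homeomorphism_of_proper_modulus[OF cont im inj _ _ k(1)])
    show "continuous_on U (\<lambda>u. cmod (\<psi> (p u)))"
      by (intro continuous_on_norm continuous_on_compose2[OF \<psi>V(5) pU]) (use U(4) in auto)
    fix z :: complex assume z: "z \<in> ball 0 1"
    have "z ^ k \<in> ball 0 1"
      using z k(1) power_strict_mono[of "cmod z" 1 k] by (simp add: norm_power)
    then show "cmod (\<psi> (p (\<theta> z))) = cmod z ^ k" using \<theta>p[OF z] \<psi>V(3) by (simp add: norm_power)
  qed
  moreover have "inv_into (ball 0 1) \<theta> y = 0"
    using inv_into_f_f[OF inj, of 0] by (simp add: \<theta>_def)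
  moreover have "\<forall>u\<in>U. p u \<in> V \<and> \<psi> (p u) = inv_into (ball 0 1) \<theta> u ^ k"
  proof
    fix u assume "u \<in> U"
    then obtain z where z: "z \<in> ball 0 1" "u = \<theta> z" using im by blast
    have "z ^ k \<in> ball 0 1"
      using z k(1) power_strict_mono[of "cmod z" 1 k] by (simp add: norm_power)
    then show "p u \<in> V \<and> \<psi> (p u) = inv_into (ball 0 1) \<theta> u ^ k"
      using \<theta>p[OF z(1)] \<psi>V(3,4) inv_into_f_f[OF inj z(1)] z by auto
  qed
  ultimately have "power_model p U V y k"
    unfolding power_model_def using k(1) U V by blast
  then show ?thesis ..
qed

section \<open>Maps that are locally injective off a finite set\<close>

text \<open>
  By invariance of domain, continuous maps between spheres that are locally injective are local
  homeomorphisms. Injectivity is easier to check for maps that are glued from pieces.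
\<close>

definition locally_injective_at :: "'a::topological_space set \<Rightarrow> ('a \<Rightarrow> 'b) \<Rightarrow> 'a \<Rightarrow> bool"
  where "locally_injective_at S p y \<longleftrightarrow> (\<exists>W. openin (top_of_set S) W \<and> y \<in> W \<and> inj_on p W)"

text \<open>
  A criterion for branched coverings that mentions no local models: local injectivity off a finite
  set, finite fibres, and fibres of size \<open>d\<close> over a dense set of points.
\<close>

locale almost_local_homeomorphism =
  fixes p :: "real^3 \<Rightarrow> real^3" and C :: "(real^3) set" and d :: nat
  assumes cont: "continuous_on S2 p" and into: "p ` S2 \<subseteq> S2"
    and finite_C: "finite C"
    and inj: "y \<in> S2 - C \<Longrightarrow> locally_injective_at S2 p y"
    and finite_fibre: "x \<in> S2 \<Longrightarrow> finite {y\<in>S2. p y = x}"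
    and degree_dense: "openin (top_of_set S2) N \<Longrightarrow> N \<noteq> {} \<Longrightarrow> \<exists>x\<in>N. card {y\<in>S2. p y = x} = d"
    and d_pos: "d > 0"
begin

lemma surj: "p ` S2 = S2"
proof (rule ccontr)
  assume "\<not> ?thesis"
  then have "S2 - p ` S2 \<noteq> {}" using into by auto
  moreover have "compact (p ` S2)" using cont by (intro compact_continuous_image) auto
  then have "open (- p ` S2)" by (simp add: compact_imp_closed open_Compl)
  then have "openin (top_of_set S2) (S2 \<inter> - p ` S2)" by (rule openin_open_Int)
  then have "openin (top_of_set S2) (S2 - p ` S2)" by (simp add: Diff_eq)
  ultimately obtain x where x: "x \<in> S2 - p ` S2" "card {y\<in>S2. p y = x} = d"
    using degree_dense by blast
  then have e: "{y\<in>S2. p y = x} = {}" by auto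
  show False using x(2) d_pos unfolding e by simp
qed

text \<open>
  Over a point that is not the image of an exceptional point, the preimage of a small neighbourhood
  \<open>N\<close> lies in disjoint sets \<open>W y\<close>, each of which maps injectively onto a set containing \<open>N\<close>.
\<close>

lemma regular_fibre:
  assumes x: "x \<in> S2" "x \<notin> p ` C"
  obtains N W where "openin (top_of_set S2) N" "x \<in> N" "N \<inter> p ` C = {}"
    "\<And>y. y \<in> S2 \<Longrightarrow> p y = x \<Longrightarrow> openin (top_of_set S2) (W y) \<and> y \<in> W y \<and> inj_on p (W y) \<and> N \<subseteq> p ` W y"
    "\<And>y z. y \<in> S2 \<Longrightarrow> p y = x \<Longrightarrow> z \<in> S2 \<Longrightarrow> p z = x \<Longrightarrow> y \<noteq> z \<Longrightarrow> W y \<inter> W z = {}"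
    "\<And>u. u \<in> S2 \<Longrightarrow> p u \<in> N \<Longrightarrow> \<exists>y\<in>S2. p y = x \<and> u \<in> W y"
proof -
  let ?Y = "{y\<in>S2. p y = x}"
  have fin: "finite ?Y" using finite_fibre[OF x(1)] .
  obtain W0 where W0: "\<And>y. y \<in> ?Y \<Longrightarrow> open (W0 y) \<and> y \<in> W0 y"
     "\<And>y z. y \<in> ?Y \<Longrightarrow> z \<in> ?Y \<Longrightarrow> y \<noteq> z \<Longrightarrow> W0 y \<inter> W0 z = {}"
    by (rule separate_fibre[OF fin]) (rule that)
  have "\<exists>W. openin (top_of_set S2) W \<and> y \<in> W \<and> inj_on p W" if y: "y \<in> ?Y" for y
  proof -
    have "y \<in> S2 - C" using y x(2) by auto
    then show ?thesis using inj[of y] by (simp add: locally_injective_at_def)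
  qed
  then have "\<forall>y\<in>?Y. \<exists>W. openin (top_of_set S2) W \<and> y \<in> W \<and> inj_on p W" by (rule ballI)
  then obtain W1 where W1: "\<And>y. y \<in> ?Y \<Longrightarrow> openin (top_of_set S2) (W1 y) \<and> y \<in> W1 y \<and> inj_on p (W1 y)"
    by (rule bchoice[THEN exE]) auto
  define W where "W = (\<lambda>y. W1 y \<inter> W0 y)"
  have W: "openin (top_of_set S2) (W y)" "y \<in> W y" "inj_on p (W y)" if "y \<in> ?Y" for y
    using W1[OF that] W0(1)[OF that] unfolding W_def
    by (auto intro: openin_Int_open inj_on_subset)
  have pW: "openin (top_of_set S2) (p ` W y)" if "y \<in> ?Y" for y
  proof (rule openin_image_inj_sphere[OF _ _ W(1)[OF that]])
    have "W y \<subseteq> S2" using W(1)[OF that] by (rule openin_imp_subset)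
    then show "continuous_on (W y) p" "p ` W y \<subseteq> S2" using cont into by (auto intro: continuous_on_subset)
  qed (use W(3)[OF that] in auto)
  have "openin (top_of_set S2) (\<Union>y\<in>?Y. W y)" using W by (intro openin_Union) auto
  then obtain M where M: "openin (top_of_set S2) M" "x \<in> M" "\<And>u. u \<in> S2 \<Longrightarrow> p u \<in> M \<Longrightarrow> u \<in> (\<Union>y\<in>?Y. W y)"
    by (rule fibre_neighbourhood[OF cont into compact_sphere _ _ x(1), of "\<Union>y\<in>?Y. W y"]) (use W(2) in auto)
  have "x \<in> p ` S2" unfolding surj by (rule x(1))
  then have ne: "?Y \<noteq> {}" by blast
  define N where "N = (M \<inter> (\<Inter>y\<in>?Y. p ` W y)) - p ` C"
  have "openin (top_of_set S2) (\<Inter>y\<in>?Y. p ` W y)" using fin pW ne by (intro openin_INT2) auto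
  then have N: "openin (top_of_set S2) N"
    unfolding N_def using M(1) finite_C by (intro openin_sphere_delete_finite openin_Int) auto
  show ?thesis
  proof (rule that[OF N, of W])
    have "x \<in> p ` W y" if "y \<in> ?Y" for y using W(2)[OF that] that by blast
    then show "x \<in> N" using M(2) x(2) by (auto simp: N_def)
    show "N \<inter> p ` C = {}" by (auto simp: N_def)
    show "openin (top_of_set S2) (W y) \<and> y \<in> W y \<and> inj_on p (W y) \<and> N \<subseteq> p ` W y" if "y \<in> S2" "p y = x" for y
      using W[of y] that by (auto simp: N_def)
    show "W y \<inter> W z = {}" if "y \<in> S2" "p y = x" "z \<in> S2" "p z = x" "y \<noteq> z" for y z
      using W0(2)[of y z] that by (auto simp: W_def)
    show "\<exists>y\<in>S2. p y = x \<and> u \<in> W y" if "u \<in> S2" "p u \<in> N" for u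
      using M(3)[of u] that by (auto simp: N_def)
  qed
qed

text \<open>
  The size of the fibre is locally constant off the exceptional values, hence equal to \<open>d\<close>.
\<close>

lemma card_regular_fibre:
  assumes x: "x \<in> S2" "x \<notin> p ` C"
  shows "card {y\<in>S2. p y = x} = d"
proof -
  obtain N W where N: "openin (top_of_set S2) N" "x \<in> N" "N \<inter> p ` C = {}"
    and W: "\<And>y. y \<in> S2 \<Longrightarrow> p y = x \<Longrightarrow> openin (top_of_set S2) (W y) \<and> y \<in> W y \<and> inj_on p (W y) \<and> N \<subseteq> p ` W y"
    and disj: "\<And>y z. y \<in> S2 \<Longrightarrow> p y = x \<Longrightarrow> z \<in> S2 \<Longrightarrow> p z = x \<Longrightarrow> y \<noteq> z \<Longrightarrow> W y \<inter> W z = {}"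
    and cover: "\<And>u. u \<in> S2 \<Longrightarrow> p u \<in> N \<Longrightarrow> \<exists>y\<in>S2. p y = x \<and> u \<in> W y"
    by (rule regular_fibre[OF x]) (rule that)
  obtain x' where x': "x' \<in> N" "card {y\<in>S2. p y = x'} = d" using degree_dense[OF N(1)] N(2) by blast
  have "bij_betw (\<lambda>y. inv_into (W y) p x') {y\<in>S2. p y = x} {y\<in>S2. p y = x'}"
    unfolding bij_betw_def
  proof
    have i: "inv_into (W y) p x' \<in> W y" "p (inv_into (W y) p x') = x'" if "y \<in> S2" "p y = x" for y
      using W[OF that] x'(1) by (auto intro: inv_into_into f_inv_into_f)
    show "inj_on (\<lambda>y. inv_into (W y) p x') {y\<in>S2. p y = x}"
    proof (rule inj_onI)
      fix y z assume yz: "y \<in> {y\<in>S2. p y = x}" "z \<in> {y\<in>S2. p y = x}"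
        "inv_into (W y) p x' = inv_into (W z) p x'"
      then have "W y \<inter> W z \<noteq> {}" using i[of y] i[of z] by auto
      then show "y = z" using disj[of y z] yz by auto
    qed
    show "(\<lambda>y. inv_into (W y) p x') ` {y\<in>S2. p y = x} = {y\<in>S2. p y = x'}"
    proof (intro set_eqI iffI)
      fix u assume "u \<in> (\<lambda>y. inv_into (W y) p x') ` {y\<in>S2. p y = x}"
      then obtain y where y: "y \<in> S2" "p y = x" "u = inv_into (W y) p x'" by auto
      have "W y \<subseteq> S2" using W[OF y(1,2)] openin_imp_subset by blast
      then show "u \<in> {y\<in>S2. p y = x'}" using i[OF y(1,2)] y(3) by auto
    next
      fix u assume u: "u \<in> {y\<in>S2. p y = x'}"
      then obtain y where y: "y \<in> S2" "p y = x" "u \<in> W y" using cover[of u] x'(1) by auto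
      then have "u = inv_into (W y) p x'" using W[OF y(1,2)] u by (metis (mono_tags, lifting) inv_into_f_f mem_Collect_eq)
      then show "u \<in> (\<lambda>y. inv_into (W y) p x') ` {y\<in>S2. p y = x}" using y by blast
    qed
  qed
  then show ?thesis using x'(2) by (simp add: bij_betw_same_card)
qed

lemma covering: "covering_space (S2 - p -` p ` C) p (S2 - p ` C)"
proof
  let ?X = "S2 - p -` p ` C" and ?Z = "S2 - p ` C"
  show "continuous_on ?X p" using cont by (rule continuous_on_subset) auto
  show "p ` ?X = ?Z" using surj by auto
  have opX: "openin (top_of_set ?X) T" if "openin (top_of_set S2) T" "T \<subseteq> ?X" for T
    by (rule openin_subset_trans[OF that]) auto
  fix x assume "x \<in> ?Z"
  then have x: "x \<in> S2" "x \<notin> p ` C" by auto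
  obtain N W where N: "openin (top_of_set S2) N" "x \<in> N" "N \<inter> p ` C = {}"
    and W: "\<And>y. y \<in> S2 \<Longrightarrow> p y = x \<Longrightarrow> openin (top_of_set S2) (W y) \<and> y \<in> W y \<and> inj_on p (W y) \<and> N \<subseteq> p ` W y"
    and disj: "\<And>y z. y \<in> S2 \<Longrightarrow> p y = x \<Longrightarrow> z \<in> S2 \<Longrightarrow> p z = x \<Longrightarrow> y \<noteq> z \<Longrightarrow> W y \<inter> W z = {}"
    and cover: "\<And>u. u \<in> S2 \<Longrightarrow> p u \<in> N \<Longrightarrow> \<exists>y\<in>S2. p y = x \<and> u \<in> W y"
    by (rule regular_fibre[OF x]) (rule that)
  have NS: "N \<subseteq> S2" using N(1) by (rule openin_imp_subset)
  define v where "v = (\<lambda>y. W y \<inter> p -` N) ` {y\<in>S2. p y = x}"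
  have vop: "openin (top_of_set S2) (W y \<inter> p -` N)" and WS: "W y \<subseteq> S2" if y: "y \<in> S2" "p y = x" for y
  proof -
    show WS: "W y \<subseteq> S2" using W[OF y] openin_imp_subset by blast
    have o1: "openin (top_of_set S2) (S2 \<inter> p -` N)"
      by (rule continuous_openin_preimage[OF cont _ N(1)]) (use into in auto)
    have "openin (top_of_set S2) (W y \<inter> (S2 \<inter> p -` N))" by (rule openin_Int[OF _ o1]) (use W[OF y] in blast)
    moreover have "W y \<inter> (S2 \<inter> p -` N) = W y \<inter> p -` N" using WS by blast
    ultimately show "openin (top_of_set S2) (W y \<inter> p -` N)" by simp
  qed
  have vX: "W y \<inter> p -` N \<subseteq> ?X" if y: "y \<in> S2" "p y = x" for y using WS[OF y] N(3) by auto
  have 1: "openin (top_of_set ?Z) N" by (rule openin_subset_trans[OF N(1)]) (use N(3) NS in auto)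
  have 2: "\<Union>v = ?X \<inter> p -` N"
  proof
    show "\<Union>v \<subseteq> ?X \<inter> p -` N" using vX unfolding v_def by blast
    show "?X \<inter> p -` N \<subseteq> \<Union>v" using cover unfolding v_def by blast
  qed
  have 3: "\<forall>u\<in>v. openin (top_of_set ?X) u" using opX[OF vop vX] unfolding v_def by blast
  have 4: "pairwise disjnt v" unfolding v_def pairwise_def disjnt_def using disj by blast
  have 5: "\<forall>u\<in>v. \<exists>q. homeomorphism u N p q"
  proof
    fix u assume "u \<in> v"
    then obtain y where y: "y \<in> S2" "p y = x" "u = W y \<inter> p -` N" unfolding v_def by blast
    have u: "openin (top_of_set S2) u" "u \<subseteq> S2" "inj_on p u"
      using vop[OF y(1,2)] WS[OF y(1,2)] W[OF y(1,2)] y(3) by (auto intro: inj_on_subset)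
    have im: "p ` u = N" using W[OF y(1,2)] y(3) by blast
    show "\<exists>q. homeomorphism u N p q"
    proof (rule homeomorphism_injective_open_map[OF _ im u(3)])
      show "continuous_on u p" using cont u(2) by (rule continuous_on_subset)
      fix T assume T: "openin (top_of_set u) T"
      then have T': "openin (top_of_set S2) T" "T \<subseteq> u" using u(1) openin_imp_subset openin_trans by blast+
      have "openin (top_of_set S2) (p ` T)"
      proof (rule openin_image_inj_sphere[OF _ _ T'(1)])
        show "continuous_on T p" using cont T'(2) u(2) by (blast intro: continuous_on_subset)
        show "inj_on p T" using u(3) T'(2) by (rule inj_on_subset)
        show "p ` T \<subseteq> S2" using into T'(2) u(2) by blast
      qed auto
      then show "openin (top_of_set N) (p ` T)"
        by (rule openin_subset_trans) (use im T'(2) NS in auto)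
    qed blast
  qed
  show "\<exists>T. x \<in> T \<and> openin (top_of_set ?Z) T \<and> (\<exists>v. \<Union>v = ?X \<inter> p -` T \<and>
      (\<forall>u \<in> v. openin (top_of_set ?X) u) \<and> pairwise disjnt v \<and> (\<forall>u \<in> v. \<exists>q. homeomorphism u T p q))"
    by (intro exI[of _ N] exI[of _ v] conjI N(2) 1 2 3 4 5)
qed

text \<open>
  One small disc \<open>V\<close> around \<open>x\<close> serves all points above \<open>x\<close>: the component of its preimage that
  contains such a point \<open>y\<close> stays close to \<open>y\<close>, and over the punctured disc \<open>p\<close> is a covering.
\<close>

lemma local_power_models:
  assumes x: "x \<in> S2"
  obtains V where "openin (top_of_set S2) V" "x \<in> V"
    "\<And>y. y \<in> S2 \<Longrightarrow> p y = x \<Longrightarrow> \<exists>U k. power_model p U V y k"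
proof -
  let ?X = "S2 - p -` p ` C" and ?Z = "S2 - p ` C"
  let ?Y = "{y\<in>S2. p y = x}"
  have fin: "finite ?Y" using finite_fibre[OF x] .
  obtain W where W: "\<And>y. y \<in> ?Y \<Longrightarrow> open (W y) \<and> y \<in> W y"
     "\<And>y z. y \<in> ?Y \<Longrightarrow> z \<in> ?Y \<Longrightarrow> y \<noteq> z \<Longrightarrow> W y \<inter> W z = {}"
    by (rule separate_fibre[OF fin]) (rule that)
  have opW: "openin (top_of_set S2) (S2 \<inter> (\<Union>y\<in>?Y. W y))"
    using W(1) by (intro openin_open_Int open_UN) auto
  obtain M where M: "openin (top_of_set S2) M" "x \<in> M" "\<And>u. u \<in> S2 \<Longrightarrow> p u \<in> M \<Longrightarrow> u \<in> S2 \<inter> (\<Union>y\<in>?Y. W y)"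
    by (rule fibre_neighbourhood[OF cont into compact_sphere opW _ x]) (use W(1) that in auto)
  \<comment> \<open>V has to avoid the other exceptional values, and some point of the sphere, so that U has one in
    its complement\<close>
  define B where "B = insert (-x) (p ` C - {x})"
  have "x \<noteq> -x"
  proof
    assume "x = -x"
    then have "2 *\<^sub>R x = 0" by (metis add.right_inverse scaleR_2)
    then show False using x by simp
  qed
  then have xB: "x \<notin> B" by (auto simp: B_def)
  have "openin (top_of_set S2) (M - B)"
    using M(1) finite_C by (intro openin_sphere_delete_finite) (auto simp: B_def)
  moreover have "x \<in> M - B" using M(2) xB by auto
  ultimately obtain V \<psi> \<psi>' where V: "openin (top_of_set S2) V" "x \<in> V" "V \<subseteq> M - B"
    "homeomorphism V (ball (0::complex) 1) \<psi> \<psi>'" "\<psi> x = 0"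
    by (rule sphere_disc_chart[rotated]) auto
  have VS: "V \<subseteq> S2" using V(1) by (rule openin_imp_subset)
  let ?A = "S2 \<inter> p -` V"
  have opA: "openin (top_of_set S2) ?A"
    by (rule continuous_openin_preimage[OF cont _ V(1)]) (use into in auto)
  have "-x \<in> S2" using x by simp
  then obtain b where b: "b \<in> S2" "p b = -x" using surj by (metis imageE)
  have bA: "b \<notin> ?A" using b V(3) by (auto simp: B_def)
  have "\<exists>U k. power_model p U V y k" if "y \<in> S2" "p y = x" for y
  proof -
    have yY: "y \<in> ?Y" and yA: "y \<in> ?A" using that V(2) by auto
    define U where "U = connected_component_set ?A y"
    have UA: "U \<subseteq> ?A" unfolding U_def by (rule connected_component_subset)
    have "locally connected ?A"
      by (rule locally_open_subset[OF locally_connected_sphere opA])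
    then have "openin (top_of_set ?A) U" unfolding U_def by (rule openin_connected_component_locally_connected)
    then have opU: "openin (top_of_set S2) U" using opA by (rule openin_trans)
    have yU: "y \<in> U" using yA unfolding U_def by simp
    have cU: "connected U" unfolding U_def by (rule connected_connected_component)
    have maxU: "T \<subseteq> U" if T: "connected T" "T \<subseteq> ?A" "T \<inter> U \<noteq> {}" for T
    proof -
      obtain t where t: "t \<in> T" "t \<in> U" using T(3) by blast
      have "T \<subseteq> connected_component_set ?A t" using t(1) T(1,2) by (rule connected_component_maximal)
      also have "\<dots> = U" using t(2) unfolding U_def by (metis connected_component_eq)
      finally show ?thesis .
    qed
    have UW: "U \<subseteq> W y"
    proof (rule ccontr)
      assume "\<not> ?thesis"
      then obtain u where u: "u \<in> U" "u \<notin> W y" by blast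
      let ?W' = "\<Union>z\<in>?Y - {y}. W z"
      have UWW: "U \<subseteq> W y \<union> ?W'"
      proof
        fix u assume "u \<in> U"
        then have "u \<in> S2" "p u \<in> M" using UA V(3) by auto
        then show "u \<in> W y \<union> ?W'" using M(3) by blast
      qed
      have "open ?W'" using W(1) by (intro open_UN) auto
      moreover have "W y \<inter> ?W' = {}" using W(2)[OF yY] by blast
      ultimately have "W y \<inter> U = {} \<or> ?W' \<inter> U = {}"
        using connectedD[OF cU, of "W y" ?W'] W(1)[OF yY] UWW by blast
      then show False using u UWW yU W(1)[OF yY] by blast
    qed
    have "\<exists>k. power_model p U V y k"
    proof (rule power_model_of_punctured_covering[OF covering _ _ V(1,2,4,5) opU yU that(2)])
      show "V - {x} \<subseteq> ?Z" using V(3) VS by (auto simp: B_def)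
      show "finite {u \<in> ?X. p u = z}" if "z \<in> ?Z" for z
        using finite_fibre[of z] that by (auto intro: rev_finite_subset)
      show "p ` U \<subseteq> V" using UA by auto
      show "connected (U - {y})"
        by (rule connected_openin_sphere_delete[OF _ opU cU b(1)]) (use bA UA in auto)
      show "continuous_on U p" using cont UA by (auto intro: continuous_on_subset)
      show yonly: "u = y" if "u \<in> U" "p u = x" for u
      proof (rule ccontr)
        assume "u \<noteq> y"
        have "u \<in> ?Y" using that UA by auto
        then have "u \<in> W u \<inter> W y" using W(1) UW that(1) by blast
        then show False using W(2)[OF \<open>u \<in> ?Y\<close> yY \<open>u \<noteq> y\<close>] by blast
      qed
      show "U - {y} \<subseteq> ?X"
      proof
        fix u assume u: "u \<in> U - {y}"
        then have "p u \<noteq> x" "p u \<in> V" "u \<in> S2" using yonly UA by auto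
        then show "u \<in> ?X" using V(3) by (auto simp: B_def)
      qed
      show "T \<subseteq> U" if "connected T" "T \<subseteq> ?X" "p ` T \<subseteq> V" "T \<inter> U \<noteq> {}" for T
        by (rule maxU) (use that in auto)
      show "\<exists>N. openin (top_of_set S2) N \<and> x \<in> N \<and> (\<forall>u\<in>U. p u \<in> N \<longrightarrow> u \<in> O')"
        if O': "openin (top_of_set S2) O'" "y \<in> O'" for O'
      proof -
        let ?O = "O' \<union> (S2 \<inter> (\<Union>z\<in>?Y - {y}. W z))"
        have opO: "openin (top_of_set S2) ?O"
          using W(1) by (intro openin_Un O' openin_open_Int open_UN) auto
        obtain N where N: "openin (top_of_set S2) N" "x \<in> N" "\<And>u. u \<in> S2 \<Longrightarrow> p u \<in> N \<Longrightarrow> u \<in> ?O"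
          by (rule fibre_neighbourhood[OF cont into compact_sphere opO _ x]) (use W(1) O'(2) that in auto)
        have "u \<in> O'" if "u \<in> U" "p u \<in> N" for u
        proof -
          have "u \<in> S2" using that(1) UA by auto
          then have "u \<in> ?O" using N(3) that by blast
          moreover have "u \<in> W y" using UW that(1) by blast
          ultimately show ?thesis using W(2)[OF yY] by blast
        qed
        then show ?thesis using N by blast
      qed
    qed
    then show ?thesis by blast
  qed
  then show ?thesis using that V(1,2) by blast
qed

theorem branched: "branched_covering d p"
  unfolding branched_covering_def
proof (intro conjI exI[of _ "p ` C \<inter> S2"])
  have eq: "S2 - p -` (p ` C \<inter> S2) = S2 - p -` p ` C" "S2 - p ` C \<inter> S2 = S2 - p ` C"
    using into by auto
  show "covering_space (S2 - p -` (p ` C \<inter> S2)) p (S2 - p ` C \<inter> S2)"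
    unfolding eq by (rule covering)
  show "\<forall>x\<in>S2 - p ` C \<inter> S2. finite {y \<in> S2. p y = x} \<and> card {y \<in> S2. p y = x} = d"
    using finite_fibre card_regular_fibre by blast
  show "\<forall>x\<in>p ` C \<inter> S2. \<exists>V. openin (top_of_set S2) V \<and> x \<in> V \<and>
          (\<forall>y\<in>S2. p y = x \<longrightarrow> (\<exists>U k. power_model p U V y k))"
  proof
    fix x assume "x \<in> p ` C \<inter> S2"
    then have "x \<in> S2" by simp
    then obtain V where "openin (top_of_set S2) V" "x \<in> V"
      "\<And>y. y \<in> S2 \<Longrightarrow> p y = x \<Longrightarrow> \<exists>U k. power_model p U V y k"
      by (rule local_power_models) (rule that)
    then show "\<exists>V. openin (top_of_set S2) V \<and> x \<in> V \<and>
          (\<forall>y\<in>S2. p y = x \<longrightarrow> (\<exists>U k. power_model p U V y k))" by blast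
  qed
qed (use cont into finite_C in auto)

text \<open>
  It suffices to know the number of preimages near \<open>y\<close> for some points arbitrarily close to \<open>p y\<close>,
  since in a power model it is the same for all of them.
\<close>

lemma ramification_number_eq_local_count:
  assumes y: "y \<in> S2"
    and cnt: "\<And>W. openin (top_of_set S2) W \<Longrightarrow> y \<in> W \<Longrightarrow> \<exists>W'. openin (top_of_set S2) W' \<and> y \<in> W' \<and> W' \<subseteq> W \<and>
        (\<forall>N. openin (top_of_set S2) N \<longrightarrow> p y \<in> N \<longrightarrow> (\<exists>x\<in>N - {p y}. card {u\<in>W'. p u = x} = n))"
  shows "ramification_number p y = n"
proof -
  have "p y \<in> S2" using y into by blast
  then obtain V where "\<And>z. z \<in> S2 \<Longrightarrow> p z = p y \<Longrightarrow> \<exists>U k. power_model p U V z k"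
    by (rule local_power_models) (rule that)
  then obtain U k where pm: "power_model p U V y k" using y by blast
  have U: "openin (top_of_set S2) U" "y \<in> U" using pm by (auto simp: power_model_def)
  obtain W' where W': "openin (top_of_set S2) W'" "y \<in> W'" "W' \<subseteq> U"
    and c: "\<forall>N. openin (top_of_set S2) N \<longrightarrow> p y \<in> N \<longrightarrow> (\<exists>x\<in>N - {p y}. card {u\<in>W'. p u = x} = n)"
    using cnt[OF U] by blast
  obtain N where N: "openin (top_of_set S2) N" "p y \<in> N" "N \<subseteq> V"
    "\<And>x. x \<in> N - {p y} \<Longrightarrow> card {u \<in> U \<inter> W'. p u = x} = k \<and> finite {u \<in> U \<inter> W'. p u = x}"
    by (rule power_model_count[OF pm W'(1,2)]) (rule that)
  obtain x where x: "x \<in> N - {p y}" "card {u\<in>W'. p u = x} = n" using c N(1,2) by blast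
  have "U \<inter> W' = W'" using W'(3) by blast
  then have "k = n" using N(4)[OF x(1)] x(2) by simp
  then show ?thesis using ramification_number_eq[OF pm] by simp
qed

end

section \<open>Suspended circle homeomorphisms\<close>

text \<open>
  The sphere in coordinates for which the equator \<open>snd x = 0\<close> is the unit circle of the complex plane.
\<close>

abbreviation S2c :: "(complex \<times> real) set"
  where "S2c \<equiv> sphere 0 1"

lemma S2c_iff: "x \<in> S2c \<longleftrightarrow> (cmod (fst x))\<^sup>2 + (snd x)\<^sup>2 = 1"
  by (cases x) (simp add: norm_prod_def real_sqrt_eq_1_iff)

text \<open>
  A circle map acts on all parallels of latitude at once. Latitudes are preserved, and so are both
  hemispheres.
\<close>

definition suspension :: "(complex \<Rightarrow> complex) \<Rightarrow> complex \<times> real \<Rightarrow> complex \<times> real"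
  where "suspension f x = (of_real (cmod (fst x)) * f (sgn (fst x)), snd x)"

lemma continuous_on_suspension:
  assumes f: "continuous_on (sphere 0 1) f" and im: "f ` sphere 0 1 \<subseteq> sphere 0 1"
  shows "continuous_on UNIV (suspension f)"
proof -
  have nf: "cmod (of_real (cmod z) * f (sgn z)) \<le> cmod z" for z
  proof (cases "z = 0")
    case False
    then have "sgn z \<in> sphere 0 1" by (simp add: norm_sgn)
    then have "cmod (f (sgn z)) = 1" using im by (auto simp: image_subset_iff)
    then show ?thesis by (simp add: norm_mult)
  qed simp
  have "isCont (\<lambda>z. of_real (cmod z) * f (sgn z)) z" for z
  proof (cases "z = 0")
    case True
    have "((\<lambda>z. of_real (cmod z) * f (sgn z)) \<longlongrightarrow> 0) (at 0)"
      by (rule Lim_null_comparison[of _ cmod]) (use nf in \<open>auto intro!: tendsto_norm_zero always_eventually tendsto_ident_at\<close>)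
    then show ?thesis using True by (simp add: isCont_def)
  next
    case False
    have "continuous_on (- {0}) (\<lambda>z. of_real (cmod z) * f (sgn z))"
      by (intro continuous_intros continuous_on_compose2[OF f]) (auto simp: norm_sgn split: if_splits)
    then show ?thesis using False by (simp add: continuous_on_eq_continuous_at open_Compl)
  qed
  then have "continuous_on UNIV (\<lambda>z. of_real (cmod z) * f (sgn z))"
    by (simp add: continuous_on_eq_continuous_at)
  then have "continuous_on UNIV (\<lambda>x::complex \<times> real. of_real (cmod (fst x)) * f (sgn (fst x)))"
    by (rule continuous_on_compose2) (auto intro!: continuous_intros)
  then show ?thesis unfolding suspension_def by (intro continuous_on_Pair continuous_on_snd continuous_on_id)
qed

lemma suspension_inverse:
  assumes "f ` sphere 0 1 \<subseteq> sphere 0 1" "\<And>z. z \<in> sphere 0 1 \<Longrightarrow> g (f z) = z"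
  shows "suspension g (suspension f x) = x"
proof (cases "fst x = 0")
  case False
  then have s: "sgn (fst x) \<in> sphere 0 1" by (simp add: norm_sgn)
  then have n: "cmod (f (sgn (fst x))) = 1" using assms(1) by (auto simp: image_subset_iff)
  then have "sgn (f (sgn (fst x))) = f (sgn (fst x))" by (simp add: sgn_eq)
  then have "sgn (of_real (cmod (fst x)) * f (sgn (fst x))) = f (sgn (fst x))"
    using False by (simp add: sgn_mult sgn_of_real)
  moreover have "of_real (cmod (fst x)) * sgn (fst x) = fst x" using False by (simp add: sgn_eq)
  ultimately show ?thesis
    using n assms(2)[OF s] by (cases x) (simp add: suspension_def norm_mult)
qed (cases x, simp add: suspension_def)

lemma suspension_in_sphere:
  assumes "f ` sphere 0 1 \<subseteq> sphere 0 1" "x \<in> S2c"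
  shows "suspension f x \<in> S2c"
proof (cases "fst x = 0")
  case False
  then have "sgn (fst x) \<in> sphere 0 1" by (simp add: norm_sgn)
  then have "cmod (f (sgn (fst x))) = 1" using assms(1) by (auto simp: image_subset_iff)
  then show ?thesis using assms(2) unfolding S2c_iff suspension_def by (simp add: norm_mult)
next
  case True
  then show ?thesis using assms(2) unfolding S2c_iff suspension_def by simp
qed

lemma homeomorphism_suspension:
  assumes "homeomorphism (sphere 0 1) (sphere 0 1) f g"
  shows "homeomorphism S2c S2c (suspension f) (suspension g)"
proof -
  have f: "continuous_on (sphere 0 1) f" "f ` sphere 0 1 \<subseteq> sphere 0 1" "\<And>z. z \<in> sphere 0 1 \<Longrightarrow> g (f z) = z"
    and g: "continuous_on (sphere 0 1) g" "g ` sphere 0 1 \<subseteq> sphere 0 1" "\<And>z. z \<in> sphere 0 1 \<Longrightarrow> f (g z) = z"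
    using assms by (auto simp: homeomorphism_def)
  show ?thesis
  proof (rule homeomorphismI)
    show "continuous_on S2c (suspension f)"
      by (rule continuous_on_subset[OF continuous_on_suspension[OF f(1,2)] subset_UNIV])
    show "continuous_on S2c (suspension g)"
      by (rule continuous_on_subset[OF continuous_on_suspension[OF g(1,2)] subset_UNIV])
    show "suspension f ` S2c \<subseteq> S2c" "suspension g ` S2c \<subseteq> S2c"
      using suspension_in_sphere[OF f(2)] suspension_in_sphere[OF g(2)] by blast+
    show "suspension g (suspension f x) = x" for x by (rule suspension_inverse[OF f(2,3)])
    show "suspension f (suspension g x) = x" for x by (rule suspension_inverse[OF g(2,3)])
  qed
qed

text \<open>
  For \<open>\<bar>\<tau>\<bar> < 1\<close> this Moebius transformation preserves the unit circle.
\<close>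

definition blaschke :: "real \<Rightarrow> complex \<Rightarrow> complex"
  where "blaschke \<tau> z = (z - of_real \<tau>) / (1 - of_real \<tau> * z)"

lemma blaschke_denom:
  assumes "\<bar>\<tau>\<bar> < 1" "cmod z = 1"
  shows "1 - of_real \<tau> * z \<noteq> 0"
proof
  assume "1 - of_real \<tau> * z = 0"
  then have "cmod (of_real \<tau> * z) = 1" by (metis eq_iff_diff_eq_0 norm_one)
  then show False using assms by (simp add: norm_mult)
qed

lemma blaschke_Re:
  assumes "\<bar>\<tau>\<bar> < 1" "cmod z = 1"
  shows "Re (blaschke \<tau> z) = ((1 + \<tau>\<^sup>2) * Re z - 2 * \<tau>) / (cmod (1 - of_real \<tau> * z))\<^sup>2"
proof -
  have z2: "(Re z)\<^sup>2 + (Im z)\<^sup>2 = 1" using assms(2) by (simp add: cmod_power2[symmetric])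
  have "(Re z - \<tau>) * (1 - \<tau> * Re z) + Im z * (- (\<tau> * Im z)) = Re z + \<tau>\<^sup>2 * Re z - \<tau> - \<tau> * ((Re z)\<^sup>2 + (Im z)\<^sup>2)"
    by (simp add: algebra_simps power2_eq_square)
  also have "\<dots> = (1 + \<tau>\<^sup>2) * Re z - 2 * \<tau>" unfolding z2 by (simp add: algebra_simps)
  finally show ?thesis by (simp add: blaschke_def Re_divide cmod_power2)
qed

lemma blaschke_norm:
  assumes "\<bar>\<tau>\<bar> < 1" "cmod z = 1"
  shows "cmod (blaschke \<tau> z) = 1"
proof -
  have z2: "(Re z)\<^sup>2 + (Im z)\<^sup>2 = 1" using assms(2) by (simp add: cmod_power2[symmetric])
  have "(cmod (z - of_real \<tau>))\<^sup>2 = ((Re z)\<^sup>2 + (Im z)\<^sup>2) + \<tau>\<^sup>2 - 2 * \<tau> * Re z"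
    unfolding cmod_power2 by (simp add: power2_eq_square algebra_simps)
  moreover have "(cmod (1 - of_real \<tau> * z))\<^sup>2 = 1 + \<tau>\<^sup>2 * ((Re z)\<^sup>2 + (Im z)\<^sup>2) - 2 * \<tau> * Re z"
    unfolding cmod_power2 by (simp add: power2_eq_square algebra_simps)
  ultimately have "(cmod (z - of_real \<tau>))\<^sup>2 = (cmod (1 - of_real \<tau> * z))\<^sup>2" unfolding z2 by simp
  then have "cmod (z - of_real \<tau>) = cmod (1 - of_real \<tau> * z)" by (simp add: power2_eq_iff_nonneg)
  then show ?thesis using blaschke_denom[OF assms] by (simp add: blaschke_def norm_divide)
qed

lemma blaschke_inverse:
  assumes "\<bar>\<tau>\<bar> < 1" "cmod z = 1"
  shows "blaschke (- \<tau>) (blaschke \<tau> z) = z"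
proof -
  let ?d = "1 - of_real \<tau> * z"
  have d: "?d \<noteq> 0" using blaschke_denom[OF assms] .
  have t: "1 - (of_real \<tau>)\<^sup>2 \<noteq> (0::complex)"
  proof
    assume "1 - (of_real \<tau>)\<^sup>2 = (0::complex)"
    then have "complex_of_real (\<tau>\<^sup>2) = of_real 1" by simp
    then have "\<tau>\<^sup>2 = 1" by (simp only: of_real_eq_iff)
    then show False using assms(1) by (simp add: power2_eq_1_iff abs_if split: if_splits)
  qed
  have "blaschke \<tau> z + of_real \<tau> = (z - of_real \<tau> + of_real \<tau> * ?d) / ?d"
    unfolding blaschke_def using d by (simp add: add_divide_distrib)
  also have "z - of_real \<tau> + of_real \<tau> * ?d = z * (1 - (of_real \<tau>)\<^sup>2)"
    by (simp add: algebra_simps power2_eq_square)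
  finally have 1: "blaschke \<tau> z + of_real \<tau> = z * (1 - (of_real \<tau>)\<^sup>2) / ?d" .
  have "1 + of_real \<tau> * blaschke \<tau> z = (?d + of_real \<tau> * (z - of_real \<tau>)) / ?d"
    unfolding blaschke_def using d by (simp add: add_divide_distrib)
  also have "?d + of_real \<tau> * (z - of_real \<tau>) = 1 - (of_real \<tau>)\<^sup>2"
    by (simp add: algebra_simps power2_eq_square)
  finally have 2: "1 + of_real \<tau> * blaschke \<tau> z = (1 - (of_real \<tau>)\<^sup>2) / ?d" .
  have "blaschke (- \<tau>) (blaschke \<tau> z) = (blaschke \<tau> z + of_real \<tau>) / (1 + of_real \<tau> * blaschke \<tau> z)"
    by (simp add: blaschke_def[of "-\<tau>"])
  also have "\<dots> = z" unfolding 1 2 using d t by simp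
  finally show ?thesis .
qed

lemma continuous_on_blaschke:
  assumes "\<bar>\<tau>\<bar> < 1"
  shows "continuous_on (sphere 0 1) (blaschke \<tau>)"
  unfolding blaschke_def using blaschke_denom[OF assms] by (intro continuous_intros) auto

text \<open>
  The point of the equator at longitude \<open>\<theta>\<close>. Only longitudes in \<open>{0..3}\<close> are used, so that no two
  of them give the same point.
\<close>

definition pt :: "real \<Rightarrow> complex \<times> real" where "pt \<theta> = (cis \<theta>, 0)"

lemma pt_simps [simp]: "pt \<theta> \<in> S2c" "snd (pt \<theta>) = 0" "fst (pt \<theta>) = cis \<theta>"
  unfolding S2c_iff by (simp_all add: pt_def)

lemma norm_pt [simp]: "norm (pt \<theta>) = 1"
  using pt_simps(1)[of \<theta>] unfolding mem_sphere_0 .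

lemma pt_inj: "pt \<theta> = pt \<theta>' \<longleftrightarrow> \<theta> = \<theta>'" if "0 \<le> \<theta>" "\<theta> \<le> 3" "0 \<le> \<theta>'" "\<theta>' \<le> 3"
proof
  assume "pt \<theta> = pt \<theta>'"
  then have "cos \<theta> = cos \<theta>'" unfolding pt_def by (metis cis.sel(1) prod.inject)
  moreover have "\<theta> \<le> pi" "\<theta>' \<le> pi" using that pi_gt3 by linarith+
  ultimately show "\<theta> = \<theta>'" using cos_inj_pi[of \<theta> \<theta>'] that by simp
qed simp

text \<open>
  A homeomorphism \<open>L\<close> of the circle that takes the arc from \<open>s\<close> to \<open>t\<close> to the left half-circle: a
  rotation centres the arc at \<open>-1\<close> and a Blaschke factor adjusts its length.
\<close>

lemma circle_coordinate:
  assumes "0 \<le> s" "s < t" "t \<le> 3"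
  obtains K L where "homeomorphism (sphere 0 1) (sphere 0 1) K L"
    "\<And>z. z \<in> sphere 0 1 \<Longrightarrow> Re (L z) < 0 \<longleftrightarrow> (\<exists>\<theta>\<in>{s<..<t}. z = cis \<theta>)"
    "\<And>z. z \<in> sphere 0 1 \<Longrightarrow> Re (L z) \<le> 0 \<longleftrightarrow> (\<exists>\<theta>\<in>{s..t}. z = cis \<theta>)"
proof -
  define c h where "c = (s + t) / 2" and "h = (t - s) / 2"
  have h: "0 < h" "h \<le> 3/2" using assms by (auto simp: h_def)
  have hpi: "h < pi / 2" "h < pi" using h pi_gt3 by auto
  define \<kappa> \<sigma> where "\<kappa> = cos h" and "\<sigma> = sin h"
  have \<kappa>: "0 < \<kappa>" unfolding \<kappa>_def using h hpi by (intro cos_gt_zero) auto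
  have \<sigma>: "0 < \<sigma>" unfolding \<sigma>_def using h hpi by (intro sin_gt_zero) auto
  have \<kappa>\<sigma>: "\<kappa>\<^sup>2 + \<sigma>\<^sup>2 = 1" by (simp add: \<kappa>_def \<sigma>_def)
  have \<sigma>1: "\<sigma> < 1"
  proof (rule ccontr)
    assume "\<not> \<sigma> < 1"
    then have "1 \<le> \<sigma>\<^sup>2" using \<sigma> by (simp add: power2_eq_square mult_ge1_I)
    then show False using \<kappa>\<sigma> \<kappa> by (metis add_le_same_cancel2 linorder_not_less zero_less_power)
  qed
  \<comment> \<open>the tangent of \<open>pi / 4 - h / 2\<close>; with this value \<open>blaschke (- \<tau>)\<close> takes the points of the circle
    with real part \<open>- \<kappa>\<close> to the imaginary axis\<close>
  define \<tau> where "\<tau> = (1 - \<sigma>) / \<kappa>"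
  have \<kappa>2: "\<kappa>\<^sup>2 = (1 - \<sigma>) * (1 + \<sigma>)" using \<kappa>\<sigma> by (simp add: algebra_simps power2_eq_square)
  have \<tau>0: "0 < \<tau>" using \<sigma>1 \<kappa> by (simp add: \<tau>_def)
  have \<tau>1: "\<tau> < 1"
  proof -
    have "(1 - \<sigma>)\<^sup>2 < \<kappa>\<^sup>2" unfolding \<kappa>2 unfolding power2_eq_square[of "1 - \<sigma>"]
      by (rule mult_strict_left_mono) (use \<sigma> \<sigma>1 in linarith)+
    then have "1 - \<sigma> < \<kappa>" by (rule power2_less_imp_less) (use \<kappa> in linarith)
    then show ?thesis using \<kappa> by (simp add: \<tau>_def)
  qed
  have \<tau>: "\<bar>\<tau>\<bar> < 1" "\<bar>-\<tau>\<bar> < 1" using \<tau>0 \<tau>1 by auto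
  have key: "2 * \<tau> = \<kappa> * (1 + \<tau>\<^sup>2)"
  proof -
    have "\<kappa> * (1 + \<tau>\<^sup>2) = (\<kappa>\<^sup>2 + (1 - \<sigma>)\<^sup>2) / \<kappa>"
      using \<kappa> by (simp add: \<tau>_def field_simps power2_eq_square)
    also have "\<kappa>\<^sup>2 + (1 - \<sigma>)\<^sup>2 = 2 * (1 - \<sigma>)" unfolding \<kappa>2 by (simp add: algebra_simps power2_eq_square)
    finally show ?thesis by (simp add: \<tau>_def)
  qed
  define K where "K = (\<lambda>z. - cis c * blaschke \<tau> z)"
  define L where "L = (\<lambda>z. blaschke (- \<tau>) (- (cis (- c) * z)))"
  have cc: "cis c * cis (- c) = 1" "cis (- c) * cis c = 1" by (simp_all add: cis_mult)
  have nL: "cmod (L z) = 1" if "cmod z = 1" for z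
    unfolding L_def by (rule blaschke_norm[OF \<tau>(2)]) (simp add: norm_mult that)
  have nK: "cmod (K z) = 1" if "cmod z = 1" for z
    using blaschke_norm[OF \<tau>(1) that] by (simp add: K_def norm_mult)
  have LK: "L (K z) = z" if "cmod z = 1" for z
  proof -
    have "- (cis (- c) * K z) = (cis (- c) * cis c) * blaschke \<tau> z" by (simp add: K_def)
    then show ?thesis using blaschke_inverse[OF \<tau>(1) that] by (simp add: L_def cc)
  qed
  have KL: "K (L z) = z" if "cmod z = 1" for z
  proof -
    have "blaschke \<tau> (L z) = - (cis (- c) * z)"
      using blaschke_inverse[OF \<tau>(2), of "- (cis (- c) * z)"] that by (simp add: L_def norm_mult)
    then show ?thesis by (simp add: K_def mult.assoc[symmetric] cc)
  qed
  have hom: "homeomorphism (sphere 0 1) (sphere 0 1) K L"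
  proof (rule homeomorphismI)
    show "continuous_on (sphere 0 1) K"
      unfolding K_def by (intro continuous_intros continuous_on_blaschke[OF \<tau>(1)])
    show "continuous_on (sphere 0 1) L"
      unfolding L_def by (intro continuous_on_compose2[OF continuous_on_blaschke[OF \<tau>(2)]] continuous_intros)
        (auto simp: norm_mult)
  qed (auto simp: nK nL LK KL)
  have sg: "Re (L z) < 0 \<longleftrightarrow> Re (cis (- c) * z) > \<kappa>" "Re (L z) \<le> 0 \<longleftrightarrow> Re (cis (- c) * z) \<ge> \<kappa>" if z: "cmod z = 1" for z
  proof -
    let ?w = "- (cis (- c) * z)"
    have w: "cmod ?w = 1" by (simp add: norm_mult z)
    have pos: "(cmod (1 - of_real (- \<tau>) * ?w))\<^sup>2 > 0"
      using blaschke_denom[OF \<tau>(2) w] by simp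
    have "(1 + (-\<tau>)\<^sup>2) * Re ?w - 2 * (-\<tau>) = (1 + \<tau>\<^sup>2) * (\<kappa> - Re (cis (- c) * z))"
      unfolding mult_minus_right minus_minus key by (simp add: algebra_simps key)
    then have e: "Re (L z) = (1 + \<tau>\<^sup>2) * (\<kappa> - Re (cis (- c) * z)) / (cmod (1 - of_real (- \<tau>) * ?w))\<^sup>2"
      unfolding L_def blaschke_Re[OF \<tau>(2) w] by simp
    have p: "1 + \<tau>\<^sup>2 > 0" by (simp add: add_pos_nonneg)
    show "Re (L z) < 0 \<longleftrightarrow> Re (cis (- c) * z) > \<kappa>" "Re (L z) \<le> 0 \<longleftrightarrow> Re (cis (- c) * z) \<ge> \<kappa>"
      unfolding e using pos p by (auto simp: divide_less_0_iff divide_le_0_iff mult_less_0_iff mult_le_0_iff not_less)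
  qed
  have ang: "\<exists>\<phi>. -pi < \<phi> \<and> \<phi> \<le> pi \<and> cis (- c) * z = cis \<phi> \<and> z = cis (c + \<phi>)" if z: "cmod z = 1" for z
  proof -
    have "cmod (cis (- c) * z) = 1" by (simp add: norm_mult z)
    then have "cis (Arg (cis (- c) * z)) = cis (- c) * z"
      by (metis cis_Arg norm_zero sgn_eq div_by_1 of_real_1 zero_neq_one)
    moreover from this have "z = cis (c + Arg (cis (- c) * z))"
      by (metis cc(1) cis_mult mult.assoc mult_1)
    ultimately show ?thesis using Arg_bounded by metis
  qed
  have cosh: "cos \<phi> > \<kappa> \<longleftrightarrow> \<bar>\<phi>\<bar> < h" "cos \<phi> \<ge> \<kappa> \<longleftrightarrow> \<bar>\<phi>\<bar> \<le> h" if "\<bar>\<phi>\<bar> \<le> pi" for \<phi>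
    using cos_mono_less_eq[of "\<bar>\<phi>\<bar>" h] cos_mono_le_eq[of h "\<bar>\<phi>\<bar>"] cos_mono_less_eq[of h "\<bar>\<phi>\<bar>"] cos_mono_le_eq[of "\<bar>\<phi>\<bar>" h] that h hpi
    by (auto simp: \<kappa>_def)
  have cst: "c - h = s" "c + h = t" by (simp_all add: c_def h_def field_simps)
  show ?thesis
  proof (rule that[OF hom])
    fix z :: complex assume "z \<in> sphere 0 1"
    then have z: "cmod z = 1" by simp
    obtain \<phi> where \<phi>: "-pi < \<phi>" "\<phi> \<le> pi" "cis (- c) * z = cis \<phi>" "z = cis (c + \<phi>)" using ang[OF z] by blast
    have b: "\<bar>\<phi>\<bar> \<le> pi" using \<phi> by auto
    have cos_eq: "cos \<phi> = cos (\<theta> - c)" if "z = cis \<theta>" for \<theta>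
    proof -
      have "cis \<phi> = cis (\<theta> - c)" using \<phi>(3) that by (simp add: cis_mult)
      then show ?thesis by (metis cis.sel(1))
    qed
    have bd: "\<bar>\<theta> - c\<bar> \<le> pi" if "\<theta> \<in> {s..t}" for \<theta>
      using that cst hpi by (auto simp: abs_le_iff)
    show "Re (L z) < 0 \<longleftrightarrow> (\<exists>\<theta>\<in>{s<..<t}. z = cis \<theta>)"
    proof
      assume "Re (L z) < 0"
      then have "\<bar>\<phi>\<bar> < h" using sg(1)[OF z] cosh(1)[OF b] by (simp add: \<phi>(3))
      then show "\<exists>\<theta>\<in>{s<..<t}. z = cis \<theta>" using \<phi>(4) cst by (intro bexI[of _ "c + \<phi>"]) auto
    next
      assume "\<exists>\<theta>\<in>{s<..<t}. z = cis \<theta>"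
      then obtain \<theta> where \<theta>: "\<theta> \<in> {s<..<t}" "z = cis \<theta>" by blast
      then have "\<bar>\<theta> - c\<bar> < h" using cst by (auto simp: abs_less_iff)
      then have "cos (\<theta> - c) > \<kappa>" using cosh(1)[of "\<theta> - c"] bd[of \<theta>] \<theta>(1) by auto
      then show "Re (L z) < 0" using sg(1)[OF z] cos_eq[OF \<theta>(2)] by (simp add: \<phi>(3))
    qed
    show "Re (L z) \<le> 0 \<longleftrightarrow> (\<exists>\<theta>\<in>{s..t}. z = cis \<theta>)"
    proof
      assume "Re (L z) \<le> 0"
      then have "\<bar>\<phi>\<bar> \<le> h" using sg(2)[OF z] cosh(2)[OF b] by (simp add: \<phi>(3))
      then show "\<exists>\<theta>\<in>{s..t}. z = cis \<theta>" using \<phi>(4) cst by (intro bexI[of _ "c + \<phi>"]) auto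
    next
      assume "\<exists>\<theta>\<in>{s..t}. z = cis \<theta>"
      then obtain \<theta> where \<theta>: "\<theta> \<in> {s..t}" "z = cis \<theta>" by blast
      then have "\<bar>\<theta> - c\<bar> \<le> h" using cst by (auto simp: abs_le_iff)
      then have "cos (\<theta> - c) \<ge> \<kappa>" using cosh(2)[of "\<theta> - c"] bd[of \<theta>] \<theta>(1) by auto
      then show "Re (L z) \<le> 0" using sg(2)[OF z] cos_eq[OF \<theta>(2)] by (simp add: \<phi>(3))
    qed
  qed
qed

section \<open>Folding the sphere along an arc\<close>

text \<open>
  The map that doubles angles and preserves moduli. It folds the imaginary axis onto the negative real
  axis and is a bijection from each of the two open half-planes to the complement of the closed
  negative axis.
\<close>

definition half_fold :: "complex \<Rightarrow> complex"
  where "half_fold w = w\<^sup>2 / of_real (cmod w)"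

lemma norm_half_fold [simp]: "cmod (half_fold w) = cmod w"
  by (cases "w = 0") (simp_all add: half_fold_def norm_divide norm_mult power2_eq_square)

lemma half_fold_minus [simp]: "half_fold (- w) = half_fold w"
  by (simp add: half_fold_def)

lemma continuous_on_half_fold: "continuous_on S half_fold"
proof -
  have "isCont half_fold w" for w
  proof (cases "w = 0")
    case True
    have "(half_fold \<longlongrightarrow> 0) (at 0)"
      by (rule Lim_null_comparison[of _ cmod]) (auto intro!: tendsto_norm_zero always_eventually tendsto_ident_at)
    then show ?thesis using True by (simp add: isCont_def half_fold_def)
  next
    case False
    then show ?thesis unfolding half_fold_def by (intro continuous_intros) auto
  qed
  then show ?thesis using continuous_at_imp_continuous_on by blast
qed

lemma half_fold_eqD:
  assumes "half_fold w = half_fold w'"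
  shows "w' = w \<or> w' = - w"
proof -
  have "cmod w = cmod w'" using arg_cong[OF assms, of cmod] by simp
  then have "w\<^sup>2 = w'\<^sup>2" using assms by (cases "w' = 0") (auto simp: half_fold_def)
  then show ?thesis by (auto simp: power2_eq_iff)
qed

lemma half_fold_onto:
  assumes "\<not> (Im w' = 0 \<and> Re w' \<le> 0)"
  obtains w where "Re w > 0" "half_fold w = w'"
proof -
  have w0: "w' \<noteq> 0" using assms by auto
  obtain c where c2: "c\<^sup>2 = w'" and cp: "0 < Re c \<or> Re c = 0 \<and> 0 \<le> Im c"
    using power2_csqrt csqrt_principal by blast
  have "Re c \<noteq> 0"
  proof
    assume "Re c = 0"
    then have "Im w' = 0" "Re w' = - (Im c * Im c)"
      using arg_cong[OF c2, of Im] arg_cong[OF c2, of Re] by (simp_all add: power2_eq_square)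
    moreover from this(2) have "Re w' \<le> 0" by simp
    ultimately show False using assms by simp
  qed
  then have c: "Re c > 0" using cp by auto
  let ?r = "sqrt (cmod w')"
  have r: "?r > 0" using w0 by simp
  have nc: "cmod c = ?r"
  proof -
    have "(cmod c)\<^sup>2 = cmod w'" using arg_cong[OF c2, of cmod] by (simp add: norm_power)
    then show ?thesis by (metis norm_ge_zero real_sqrt_unique)
  qed
  have "half_fold (of_real ?r * c) = w'"
  proof -
    have "cmod (of_real ?r * c) = cmod w'" using nc r by (simp add: norm_mult)
    moreover have "(of_real ?r * c)\<^sup>2 = of_real (cmod w') * w'"
      by (simp add: power_mult_distrib c2 flip: of_real_power)
    ultimately have "half_fold (of_real ?r * c) = of_real (cmod w') * w' / of_real (cmod w')"
      unfolding half_fold_def by (simp only:)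
    also have "\<dots> = w'" by (rule nonzero_mult_div_cancel_left) (use w0 in simp)
    finally show ?thesis .
  qed
  moreover have "Re (of_real ?r * c) > 0" using c r by simp
  ultimately show ?thesis using that by blast
qed

lemma Im_half_fold: "Im (half_fold w) = 2 * Re w * Im w / cmod w"
  by (simp add: half_fold_def power2_eq_square)

lemma of_real_square_over_abs: "complex_of_real r * of_real r / of_real \<bar>r\<bar> = of_real \<bar>r\<bar>"
  by (simp add: abs_if)

lemma half_fold_imaginary: "Re w = 0 \<Longrightarrow> half_fold w = - of_real \<bar>Im w\<bar>"
proof -
  assume "Re w = 0"
  then have w: "w = \<i> * of_real (Im w)" by (simp add: complex_eq_iff)
  show ?thesis
  proof (cases "Im w = 0")
    case False
    have "cmod w = \<bar>Im w\<bar>" using \<open>Re w = 0\<close> by (simp add: cmod_def)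
    moreover have "w\<^sup>2 = - of_real (\<bar>Im w\<bar> * \<bar>Im w\<bar>)"
      using \<open>Re w = 0\<close> by (simp add: complex_eq_iff power2_eq_square)
    ultimately show ?thesis by (simp add: half_fold_def of_real_square_over_abs)
  next
    case True
    then have "w = 0" using \<open>Re w = 0\<close> by (simp add: complex_eq_iff)
    then show ?thesis by (simp add: half_fold_def)
  qed
qed

lemma half_fold_real: "Im w = 0 \<Longrightarrow> half_fold w = of_real \<bar>Re w\<bar>"
proof -
  assume "Im w = 0"
  then have w: "w = of_real (Re w)" by (simp add: complex_eq_iff)
  have "half_fold (of_real r) = of_real \<bar>r\<bar>" for r
    using of_real_square_over_abs[of r] by (simp add: half_fold_def power2_eq_square)
  then show ?thesis using w by metis
qed

text \<open>
  The sphere is cut into circles orthogonal to the imaginary direction of the first component; \<open>slice\<close>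
  gives the position in the plane of such a circle.
\<close>

definition slice :: "complex \<times> real \<Rightarrow> complex" where "slice x = Complex (Re (fst x)) (snd x)"
definition unslice :: "complex \<Rightarrow> real \<Rightarrow> complex \<times> real" where "unslice w h = (Complex (Re w) h, Im w)"

lemma slice_simps [simp]: "slice (unslice w h) = w" "Im (fst (unslice w h)) = h"
  "unslice (slice x) (Im (fst x)) = x" "Re (slice x) = Re (fst x)" "Im (slice x) = snd x"
  "snd (unslice w h) = Im w" "Re (fst (unslice w h)) = Re w"
  by (simp_all add: slice_def unslice_def complex_eq_iff prod_eq_iff)

lemma unslice_in_sphere: "unslice w h \<in> S2c \<longleftrightarrow> (cmod w)\<^sup>2 + h\<^sup>2 = 1"
  unfolding S2c_iff by (simp add: cmod_power2 ac_simps)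

lemma in_sphere_slice: "x \<in> S2c \<longleftrightarrow> (cmod (slice x))\<^sup>2 + (Im (fst x))\<^sup>2 = 1"
  using unslice_in_sphere[of "slice x" "Im (fst x)"] by simp

lemma slice_eqI: "slice x = slice y \<Longrightarrow> Im (fst x) = Im (fst y) \<Longrightarrow> x = y"
  by (metis slice_simps(3))

text \<open>
  Angles are doubled about the axis through \<open>(\<i>, 0)\<close> and \<open>(-\<i>, 0)\<close>. The great circle through these
  two points and \<open>(0, 1)\<close> is folded onto the left half of the equator, and each of its two
  complementary hemispheres is opened up to the complement of that arc.
\<close>

definition fold_map :: "complex \<times> real \<Rightarrow> complex \<times> real"
  where "fold_map x = unslice (half_fold (slice x)) (Im (fst x))"

lemma fold_map_simps [simp]: "slice (fold_map x) = half_fold (slice x)" "Im (fst (fold_map x)) = Im (fst x)"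
  by (simp_all add: fold_map_def)

lemma fold_map_in_sphere: "fold_map x \<in> S2c \<longleftrightarrow> x \<in> S2c"
  unfolding in_sphere_slice by simp

lemma continuous_on_fold_map: "continuous_on S fold_map"
  unfolding fold_map_def unslice_def slice_def Complex_eq
  by (intro continuous_intros continuous_on_compose2[OF continuous_on_half_fold[of UNIV]]) auto

lemma snd_fold_map: "snd (fold_map x) = 2 * Re (fst x) * snd x / cmod (slice x)"
  using Im_half_fold[of "slice x"] by (simp add: fold_map_def)

lemma sgn_snd_fold_map:
  "Re (fst x) > 0 \<Longrightarrow> sgn (snd (fold_map x)) = sgn (snd x)"
  "Re (fst x) < 0 \<Longrightarrow> sgn (snd (fold_map x)) = - sgn (snd x)"
proof -
  have "slice x \<noteq> 0" if "Re (fst x) \<noteq> 0" using that by (metis slice_simps(4) zero_complex.sel(1))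
  then show "Re (fst x) > 0 \<Longrightarrow> sgn (snd (fold_map x)) = sgn (snd x)"
    "Re (fst x) < 0 \<Longrightarrow> sgn (snd (fold_map x)) = - sgn (snd x)"
    by (auto simp: snd_fold_map sgn_mult sgn_divide)
qed

lemma fold_map_eqD:
  assumes "fold_map x = fold_map y" "Re (fst x) * Re (fst y) > 0"
  shows "x = y"
proof -
  have h: "half_fold (slice x) = half_fold (slice y)" and i: "Im (fst x) = Im (fst y)"
    using assms(1) by (metis fold_map_simps)+
  have "slice y \<noteq> - slice x"
  proof
    assume "slice y = - slice x"
    then have "Re (fst y) = - Re (fst x)" by (metis slice_simps(4) uminus_complex.sel(1))
    then have "Re (fst x) * Re (fst y) = - (Re (fst x))\<^sup>2" by (simp add: power2_eq_square)
    then show False using assms(2) zero_le_power2[of "Re (fst x)"] by linarith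
  qed
  then have "slice x = slice y" using half_fold_eqD[OF h] by metis
  then show ?thesis using i by (rule slice_eqI)
qed

lemma fold_map_onto:
  assumes "x \<in> S2c" "\<not> (snd x = 0 \<and> Re (fst x) \<le> 0)" "e = 1 \<or> e = -1"
  obtains y where "y \<in> S2c" "e * Re (fst y) > 0" "fold_map y = x"
proof -
  obtain w where w: "Re w > 0" "half_fold w = slice x"
    using half_fold_onto[of "slice x"] assms(2) by auto
  let ?y = "unslice (of_real e * w) (Im (fst x))"
  have "half_fold (of_real e * w) = half_fold w" using assms(3) by auto
  then have f: "fold_map ?y = x" using w by (intro slice_eqI) simp_all
  moreover have "?y \<in> S2c" using f fold_map_in_sphere assms(1) by metis
  moreover have "e * Re (fst ?y) > 0" using w(1) assms(3) by auto
  ultimately show ?thesis using that by blast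
qed

lemma fold_map_equator:
  assumes "Re (fst x) = 0"
  shows "snd (fold_map x) = 0" "Re (fst (fold_map x)) = - \<bar>snd x\<bar>"
proof -
  have "half_fold (slice x) = - of_real \<bar>snd x\<bar>" using half_fold_imaginary[of "slice x"] assms by simp
  then show "snd (fold_map x) = 0" "Re (fst (fold_map x)) = - \<bar>snd x\<bar>"
    by (simp_all add: fold_map_def)
qed

lemma fold_map_meridian:
  assumes "snd x = 0"
  shows "snd (fold_map x) = 0" "Re (fst (fold_map x)) = \<bar>Re (fst x)\<bar>"
proof -
  have "half_fold (slice x) = of_real \<bar>Re (fst x)\<bar>" using half_fold_real[of "slice x"] assms by simp
  then show "snd (fold_map x) = 0" "Re (fst (fold_map x)) = \<bar>Re (fst x)\<bar>"
    by (simp_all add: fold_map_def)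
qed

text \<open>
  The half-turn about the axis through \<open>(\<i>, 0)\<close> and \<open>(-\<i>, 0)\<close>. It coincides with \<open>fold_map\<close> on the
  left half of the equator and exchanges the northern and the southern hemisphere.
\<close>

definition half_turn :: "complex \<times> real \<Rightarrow> complex \<times> real"
  where "half_turn x = (- cnj (fst x), - snd x)"

definition open_arc :: "real \<Rightarrow> real \<Rightarrow> (complex \<times> real) set" where "open_arc s t = pt ` {s<..<t}"
definition closed_arc :: "real \<Rightarrow> real \<Rightarrow> (complex \<times> real) set" where "closed_arc s t = pt ` {s..t}"

text \<open>
  A map that folds the sphere along the arc of the equator from \<open>s\<close> to \<open>t\<close>. The sphere is the
  disjoint union of the open discs \<open>Out\<close> and \<open>In\<close> and of a circle that is folded onto the arc; each
  disc is mapped bijectively to the complement of the arc. On \<open>Out\<close> hemispheres are preserved, on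
  \<open>In\<close> they are exchanged. The rest of the equator stays fixed. The interior of the arc lies in
  \<open>In\<close>, and on the arc \<open>F\<close> agrees with a homeomorphism \<open>G\<close> of the sphere.
\<close>

locale arc_fold =
  fixes s t :: real and F :: "complex \<times> real \<Rightarrow> complex \<times> real" and Out In :: "(complex \<times> real) set"
    and G G' :: "complex \<times> real \<Rightarrow> complex \<times> real"
  assumes F: "continuous_on S2c F" "F ` S2c \<subseteq> S2c"
    and op: "openin (top_of_set S2c) Out" "openin (top_of_set S2c) In" and disj: "Out \<inter> In = {}"
    and FOut: "inj_on F Out" "F ` Out = S2c - closed_arc s t"
    and FIn: "inj_on F In" "F ` In = S2c - closed_arc s t"
    and FE: "x \<in> S2c - Out - In \<Longrightarrow> F x \<in> closed_arc s t"
    and FEinj: "x \<in> S2c - Out - In \<Longrightarrow> y \<in> S2c - Out - In \<Longrightarrow> snd x * snd y > 0 \<Longrightarrow> F x = F y \<Longrightarrow> x = y"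
    and Ereal: "x \<in> S2c - Out - In \<Longrightarrow> snd x = 0 \<Longrightarrow> x = pt s \<or> x = pt t"
    and Fs: "x \<in> S2c \<Longrightarrow> F x = pt s \<Longrightarrow> x = pt s"
    and Ft: "x \<in> S2c \<Longrightarrow> F x = pt t \<Longrightarrow> x = pt t"
    and sOut: "x \<in> Out \<Longrightarrow> sgn (snd (F x)) = sgn (snd x)"
    and sIn: "x \<in> In \<Longrightarrow> sgn (snd (F x)) = - sgn (snd x)"
    and Ffix: "x \<in> S2c \<Longrightarrow> snd x = 0 \<Longrightarrow> x \<notin> open_arc s t \<Longrightarrow> F x = x \<and> x \<notin> In"
    and arcIn: "open_arc s t \<subseteq> In" and ends: "pt s \<notin> Out \<union> In" "pt t \<notin> Out \<union> In"
    and G: "homeomorphism S2c S2c G G'" "x \<in> S2c \<Longrightarrow> sgn (snd (G x)) = - sgn (snd x)"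
    and FG: "x \<in> closed_arc s t \<Longrightarrow> F x = G x"

text \<open>
  The map \<open>fold_map\<close> folds along the left half of the equator; a suspended circle homeomorphism
  transports it to an arbitrary arc.
\<close>

lemma fold_along_arc:
  assumes st: "0 \<le> s" "s < t" "t \<le> 3"
  obtains j Out In G where "arc_fold s t j Out In G G"
proof -
  obtain K L where KL: "homeomorphism (sphere 0 1) (sphere 0 1) K L"
    and L1: "\<And>z. z \<in> sphere 0 1 \<Longrightarrow> Re (L z) < 0 \<longleftrightarrow> (\<exists>\<theta>\<in>{s<..<t}. z = cis \<theta>)"
    and L2: "\<And>z. z \<in> sphere 0 1 \<Longrightarrow> Re (L z) \<le> 0 \<longleftrightarrow> (\<exists>\<theta>\<in>{s..t}. z = cis \<theta>)"
    by (rule circle_coordinate[OF st]) (rule that)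
  define k l where "k = suspension K" and "l = suspension L"
  have hom: "homeomorphism S2c S2c k l" unfolding k_def l_def by (rule homeomorphism_suspension[OF KL])
  have ck: "continuous_on S2c k" "continuous_on S2c l" using hom by (auto simp: homeomorphism_def)
  have k: "k x \<in> S2c" "l (k x) = x" and l: "l x \<in> S2c" "k (l x) = x" if "x \<in> S2c" for x
    using hom that by (auto simp: homeomorphism_def)
  have sk [simp]: "snd (k x) = snd x" "snd (l x) = snd x" for x by (simp_all add: k_def l_def suspension_def)
  have circ: "fst x \<in> sphere 0 1" "fst (l x) = L (fst x)" if "x \<in> S2c" "snd x = 0" for x
  proof -
    have n: "cmod (fst x) = 1" using that unfolding S2c_iff by (intro power2_eq_imp_eq[of _ 1]) auto
    then show "fst x \<in> sphere 0 1" by simp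
    show "fst (l x) = L (fst x)" using n by (simp add: l_def suspension_def sgn_eq)
  qed
  have oa: "x \<in> open_arc s t \<longleftrightarrow> x \<in> S2c \<and> snd x = 0 \<and> Re (fst (l x)) < 0" for x
  proof
    assume "x \<in> open_arc s t"
    then obtain \<theta> where \<theta>: "\<theta> \<in> {s<..<t}" "x = pt \<theta>" by (auto simp: open_arc_def)
    have x: "x \<in> S2c" "snd x = 0" "fst x = cis \<theta>" unfolding \<theta>(2) by simp_all
    then show "x \<in> S2c \<and> snd x = 0 \<and> Re (fst (l x)) < 0" using circ[OF x(1,2)] L1[of "fst x"] \<theta>(1) by auto
  next
    assume x: "x \<in> S2c \<and> snd x = 0 \<and> Re (fst (l x)) < 0"
    then obtain \<theta> where "\<theta> \<in> {s<..<t}" "fst x = cis \<theta>" using circ[of x] L1[of "fst x"] by auto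
    then show "x \<in> open_arc s t" using x by (auto simp: open_arc_def pt_def prod_eq_iff)
  qed
  have ca: "x \<in> closed_arc s t \<longleftrightarrow> x \<in> S2c \<and> snd x = 0 \<and> Re (fst (l x)) \<le> 0" for x
  proof
    assume "x \<in> closed_arc s t"
    then obtain \<theta> where \<theta>: "\<theta> \<in> {s..t}" "x = pt \<theta>" by (auto simp: closed_arc_def)
    have x: "x \<in> S2c" "snd x = 0" "fst x = cis \<theta>" unfolding \<theta>(2) by simp_all
    then show "x \<in> S2c \<and> snd x = 0 \<and> Re (fst (l x)) \<le> 0" using circ[OF x(1,2)] L2[of "fst x"] \<theta>(1) by auto
  next
    assume x: "x \<in> S2c \<and> snd x = 0 \<and> Re (fst (l x)) \<le> 0"
    then obtain \<theta> where "\<theta> \<in> {s..t}" "fst x = cis \<theta>" using circ[of x] L2[of "fst x"] by auto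
    then show "x \<in> closed_arc s t" using x by (auto simp: closed_arc_def pt_def prod_eq_iff)
  qed
  have ends: "Re (fst (l (pt s))) = 0" "Re (fst (l (pt t))) = 0"
  proof -
    have "pt s \<in> closed_arc s t" "pt t \<in> closed_arc s t" using st by (auto simp: closed_arc_def)
    moreover have "pt s \<notin> open_arc s t" "pt t \<notin> open_arc s t"
      using st by (auto simp: open_arc_def pt_inj)
    ultimately show "Re (fst (l (pt s))) = 0" "Re (fst (l (pt t))) = 0"
      unfolding oa ca by auto
  qed
  have ends': "x = pt s \<or> x = pt t" if x: "x \<in> S2c" "snd x = 0" "Re (fst (l x)) = 0" for x
  proof -
    have "x \<in> closed_arc s t" "x \<notin> open_arc s t" using x unfolding oa ca by auto
    then obtain \<theta> where \<theta>: "\<theta> \<in> {s..t}" "x = pt \<theta>" by (auto simp: closed_arc_def)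
    then have "\<theta> \<notin> {s<..<t}" using \<open>x \<notin> open_arc s t\<close> by (auto simp: open_arc_def)
    with \<theta> have "\<theta> = s \<or> \<theta> = t" by auto
    then show ?thesis using \<open>x = pt \<theta>\<close> by auto
  qed
  define j where "j = (\<lambda>x. k (fold_map (l x)))"
  define G where "G = (\<lambda>x. k (half_turn (l x)))"
  define Out where "Out = S2c \<inter> (\<lambda>x. Re (fst (l x))) -` {0<..}"
  define In where "In = S2c \<inter> (\<lambda>x. Re (fst (l x))) -` {..<0}"
  have jS: "j x \<in> S2c" "l (j x) = fold_map (l x)" if "x \<in> S2c" for x
    using l(1)[OF that] k fold_map_in_sphere by (auto simp: j_def simp del: mem_sphere mem_sphere_0)
  have cre: "continuous_on S2c (\<lambda>x. Re (fst (l x)))" using ck by (intro continuous_intros)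
  have jinj: "x = y" if "x \<in> S2c" "y \<in> S2c" "j x = j y" "Re (fst (l x)) * Re (fst (l y)) > 0" for x y
  proof -
    have "fold_map (l x) = fold_map (l y)" using jS that by metis
    then have "l x = l y" using fold_map_eqD that(4) by blast
    then show ?thesis using l that by metis
  qed
  have jonto: "\<exists>y\<in>S2c. e * Re (fst (l y)) > 0 \<and> j y = x"
    if x: "x \<in> S2c" "x \<notin> closed_arc s t" and e: "e = 1 \<or> e = -1" for x e
  proof -
    have "\<not> (snd (l x) = 0 \<and> Re (fst (l x)) \<le> 0)" using x ca[of x] by simp
    then obtain y where y: "y \<in> S2c" "e * Re (fst y) > 0" "fold_map y = l x"
      by (rule fold_map_onto[OF l(1)[OF x(1)] _ e]) (rule that)
    then show ?thesis using k[OF y(1)] l[OF x(1)] by (intro bexI[of _ "k y"]) (simp_all add: j_def)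
  qed
  have jneg: "j x \<notin> closed_arc s t" if "x \<in> S2c" "Re (fst (l x)) \<noteq> 0" for x
  proof
    assume "j x \<in> closed_arc s t"
    then have f: "snd (fold_map (l x)) = 0" "Re (fst (fold_map (l x))) \<le> 0"
      using ca[of "j x"] jS[OF that(1)] by (auto simp: j_def)
    have "sgn (snd (fold_map (l x))) = sgn (snd (l x)) \<or> sgn (snd (fold_map (l x))) = - sgn (snd (l x))"
      using that(2) sgn_snd_fold_map[of "l x"] by linarith
    then have "snd (l x) = 0" using f(1) by (auto simp: sgn_zero_iff)
    then show False using fold_map_meridian(2)[of "l x"] f(2) that(2) by simp
  qed
  have jfix: "j x = pt s \<Longrightarrow> x = pt s" "j x = pt t \<Longrightarrow> x = pt t" if x: "x \<in> S2c" for x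
  proof -
    have "x = e" if e: "e \<in> S2c" "snd e = 0" "Re (fst (l e)) = 0" "j x = e" for e
    proof -
      have le: "fold_map (l x) = l e" using jS(2)[OF x] e(4) by simp
      have "slice (l e) = 0" using e(2,3) by (simp add: slice_def complex_eq_iff)
      then have "half_fold (slice (l x)) = 0" using le by (metis fold_map_simps(1))
      then have "slice (l x) = 0" using norm_half_fold[of "slice (l x)"] by simp
      then have "l x = l e" using \<open>slice (l e) = 0\<close> le by (intro slice_eqI) (metis, metis fold_map_simps(2))
      then show ?thesis using l x e(1) by metis
    qed
    then show "j x = pt s \<Longrightarrow> x = pt s" "j x = pt t \<Longrightarrow> x = pt t" using ends by (meson pt_simps)+
  qed
  have ht: "half_turn x \<in> S2c" "half_turn (half_turn x) = x" if "x \<in> S2c" for x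
    using that unfolding S2c_iff by (simp_all add: half_turn_def)
  have homG: "homeomorphism S2c S2c G G"
  proof (rule homeomorphismI)
    have "continuous_on S2c (\<lambda>x. half_turn (l x))"
      unfolding half_turn_def using ck by (intro continuous_intros)
    then show "continuous_on S2c G" "continuous_on S2c G"
      unfolding G_def by (rule continuous_on_compose2[OF ck(1)], use ht l in blast)+
    show "G ` S2c \<subseteq> S2c" "G ` S2c \<subseteq> S2c" using ht l k unfolding G_def by blast+
    show "G (G x) = x" "G (G x) = x" if "x \<in> S2c" for x
      using that ht l k by (simp_all add: G_def del: mem_sphere mem_sphere_0)
  qed
  have Enot: "Re (fst (l x)) = 0" if "x \<in> S2c - Out - In" for x
    using that by (auto simp: Out_def In_def)
  show ?thesis
  proof (rule that[of j Out In G], unfold_locales)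
    show "continuous_on S2c j" unfolding j_def
      by (rule continuous_on_compose2[OF ck(1) continuous_on_compose2[OF continuous_on_fold_map ck(2)]])
         (use l fold_map_in_sphere in blast)+
    show "j ` S2c \<subseteq> S2c" using jS(1) by blast
    show "openin (top_of_set S2c) Out" "openin (top_of_set S2c) In"
      unfolding Out_def In_def by (intro continuous_openin_preimage_gen cre; simp)+
    show "Out \<inter> In = {}" by (auto simp: Out_def In_def)
    show "inj_on j Out"
    proof (rule inj_onI)
      fix x y assume xy: "x \<in> Out" "y \<in> Out" "j x = j y"
      show "x = y" by (rule jinj[OF _ _ xy(3)]) (use xy in \<open>simp_all add: Out_def del: mem_sphere mem_sphere_0\<close>)
    qed
    show "inj_on j In"
    proof (rule inj_onI)
      fix x y assume xy: "x \<in> In" "y \<in> In" "j x = j y"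
      show "x = y" by (rule jinj[OF _ _ xy(3)]) (use xy in \<open>simp_all add: In_def mult_neg_neg del: mem_sphere mem_sphere_0\<close>)
    qed
    show "j ` Out = S2c - closed_arc s t"
    proof
      show "j ` Out \<subseteq> S2c - closed_arc s t" using jS(1) jneg by (auto simp: Out_def simp del: mem_sphere mem_sphere_0)
      show "S2c - closed_arc s t \<subseteq> j ` Out"
      proof
        fix x assume "x \<in> S2c - closed_arc s t"
        then obtain y where "y \<in> S2c" "1 * Re (fst (l y)) > 0" "j y = x" using jonto[of x 1] by blast
        then show "x \<in> j ` Out" by (auto simp: Out_def simp del: mem_sphere mem_sphere_0)
      qed
    qed
    show "j ` In = S2c - closed_arc s t"
    proof
      show "j ` In \<subseteq> S2c - closed_arc s t" using jS(1) jneg by (auto simp: In_def simp del: mem_sphere mem_sphere_0)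
      show "S2c - closed_arc s t \<subseteq> j ` In"
      proof
        fix x assume "x \<in> S2c - closed_arc s t"
        then obtain y where "y \<in> S2c" "-1 * Re (fst (l y)) > 0" "j y = x" using jonto[of x "-1"] by blast
        then show "x \<in> j ` In" by (auto simp: In_def simp del: mem_sphere mem_sphere_0)
      qed
    qed
    show "j x \<in> closed_arc s t" if "x \<in> S2c - Out - In" for x
    proof -
      have "x \<in> S2c" "Re (fst (l x)) = 0" using that Enot by blast+
      then show ?thesis unfolding ca using jS[of x] fold_map_equator[of "l x"] by (simp add: j_def del: mem_sphere mem_sphere_0)
    qed
    show "x = y" if xy: "x \<in> S2c - Out - In" "y \<in> S2c - Out - In" "snd x * snd y > 0" "j x = j y" for x y
    proof -
      have x: "x \<in> S2c" "Re (fst (l x)) = 0" "y \<in> S2c" "Re (fst (l y)) = 0" using xy Enot by blast+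
      have f: "fold_map (l x) = fold_map (l y)" using jS(2) x xy(4) by metis
      then have "\<bar>snd x\<bar> = \<bar>snd y\<bar>" using fold_map_equator(2) x by (metis neg_equal_iff_equal sk(2))
      then have "snd x = snd y" using xy(3) by (auto simp: abs_if zero_less_mult_iff split: if_splits)
      then have "slice (l x) = slice (l y)" using x by (simp add: slice_def)
      then have "l x = l y" using f by (intro slice_eqI) (metis fold_map_simps(2))+
      then show ?thesis using l x by metis
    qed
    show "x = pt s \<or> x = pt t" if "x \<in> S2c - Out - In" "snd x = 0" for x
      using ends'[of x] Enot[OF that(1)] that by blast
    show "j x = pt s \<Longrightarrow> x = pt s" "j x = pt t \<Longrightarrow> x = pt t" if "x \<in> S2c" for x using jfix[OF that] by blast+
    show "sgn (snd (j x)) = sgn (snd x)" if "x \<in> Out" for x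
      using that sgn_snd_fold_map(1)[of "l x"] by (simp add: j_def Out_def)
    show "sgn (snd (j x)) = - sgn (snd x)" if "x \<in> In" for x
      using that sgn_snd_fold_map(2)[of "l x"] by (simp add: j_def In_def)
    show "j x = x \<and> x \<notin> In" if x: "x \<in> S2c" "snd x = 0" "x \<notin> open_arc s t" for x
    proof
      have r: "Re (fst (l x)) \<ge> 0" using x oa[of x] by auto
      then show "x \<notin> In" by (simp add: In_def)
      have "half_fold (slice (l x)) = slice (l x)"
        using half_fold_real[of "slice (l x)"] r x(2) by (simp add: complex_eq_iff)
      then have "fold_map (l x) = l x" by (intro slice_eqI) simp_all
      then show "j x = x" using l[OF x(1)] by (simp add: j_def)
    qed
    show "open_arc s t \<subseteq> In" unfolding In_def using oa by (auto simp del: mem_sphere mem_sphere_0)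
    show "pt s \<notin> Out \<union> In" "pt t \<notin> Out \<union> In" using ends by (auto simp: Out_def In_def)
    show "sgn (snd (G x)) = - sgn (snd x)" if "x \<in> S2c" for x
      by (simp add: G_def half_turn_def sgn_minus)
    show "j x = G x" if "x \<in> closed_arc s t" for x
    proof -
      have x: "x \<in> S2c" "snd x = 0" "Re (fst (l x)) \<le> 0" using that ca by blast+
      then have "fold_map (l x) = half_turn (l x)"
        by (simp add: prod_eq_iff complex_eq_iff half_turn_def fold_map_meridian)
      then show ?thesis by (simp add: j_def G_def)
    qed
  qed (rule homG)
qed

section \<open>Blowing up an arc\<close>

text \<open>
  Any increasing sequence of longitudes in \<open>{0..3}\<close> would do.
\<close>

definition mark_angle :: "nat \<Rightarrow> real" where "mark_angle i = 3 - 3 / real (Suc i)"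

lemma mark_angle_bounds: "0 \<le> mark_angle i" "mark_angle i \<le> 3"
  by (simp_all add: mark_angle_def field_simps)

lemma mark_angle_less_iff [simp]: "mark_angle i < mark_angle j \<longleftrightarrow> i < j"
  by (simp add: mark_angle_def field_simps)

lemma mark_angle_le_iff [simp]: "mark_angle i \<le> mark_angle j \<longleftrightarrow> i \<le> j"
  by (simp add: mark_angle_def field_simps)

abbreviation mark :: "nat \<Rightarrow> complex \<times> real" where "mark i \<equiv> pt (mark_angle i)"

lemma mark_inj [simp]: "mark i = mark j \<longleftrightarrow> i = j"
  using pt_inj[of "mark_angle i" "mark_angle j"] mark_angle_bounds by (metis order_antisym mark_angle_le_iff order_refl)

lemma arc_simps:
  "x \<in> open_arc s t \<Longrightarrow> x \<in> S2c" "x \<in> open_arc s t \<Longrightarrow> snd x = 0"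
  "x \<in> closed_arc s t \<Longrightarrow> x \<in> S2c" "x \<in> closed_arc s t \<Longrightarrow> snd x = 0"
  "open_arc s t \<subseteq> closed_arc s t"
  by (auto simp: open_arc_def closed_arc_def)

lemma pt_in_open_arc: "0 \<le> \<theta> \<Longrightarrow> \<theta> \<le> 3 \<Longrightarrow> 0 \<le> s \<Longrightarrow> t \<le> 3 \<Longrightarrow> pt \<theta> \<in> open_arc s t \<longleftrightarrow> s < \<theta> \<and> \<theta> < t"
  unfolding open_arc_def using pt_inj by (auto simp: image_iff)

lemma pt_in_closed_arc: "0 \<le> \<theta> \<Longrightarrow> \<theta> \<le> 3 \<Longrightarrow> 0 \<le> s \<Longrightarrow> t \<le> 3 \<Longrightarrow> pt \<theta> \<in> closed_arc s t \<longleftrightarrow> s \<le> \<theta> \<and> \<theta> \<le> t"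
  unfolding closed_arc_def using pt_inj by (auto simp: image_iff)

lemma closed_arc_minus_ends: "x \<in> closed_arc s t \<Longrightarrow> x \<noteq> pt s \<Longrightarrow> x \<noteq> pt t \<Longrightarrow> x \<in> open_arc s t"
proof -
  assume x: "x \<in> closed_arc s t" "x \<noteq> pt s" "x \<noteq> pt t"
  then obtain \<theta> where \<theta>: "s \<le> \<theta>" "\<theta> \<le> t" "x = pt \<theta>" by (auto simp: closed_arc_def)
  with x have "\<theta> \<noteq> s" "\<theta> \<noteq> t" by auto
  with \<theta> show ?thesis by (auto simp: open_arc_def)
qed

lemma closed_closed_arc: "closed (closed_arc s t)"
proof -
  have "continuous_on {s..t} pt" unfolding pt_def by (intro continuous_intros)
  then have "compact (closed_arc s t)" unfolding closed_arc_def by (intro compact_continuous_image) auto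
  then show ?thesis by (rule compact_imp_closed)
qed

text \<open>
  The number of preimages near \<open>y\<close>, for points off the equator that are close to \<open>p y\<close>. Points on the
  equator are avoided because they may have preimages on the circle along which a map is glued.
\<close>

definition local_count :: "(complex \<times> real \<Rightarrow> complex \<times> real) \<Rightarrow> complex \<times> real \<Rightarrow> nat \<Rightarrow> bool"
  where "local_count p y n \<longleftrightarrow> (\<forall>W. openin (top_of_set S2c) W \<and> y \<in> W \<longrightarrow>
    (\<exists>W' N. openin (top_of_set S2c) W' \<and> y \<in> W' \<and> W' \<subseteq> W \<and> openin (top_of_set S2c) N \<and> p y \<in> N \<and>
      (\<forall>x\<in>N. snd x \<noteq> 0 \<longrightarrow> card {u\<in>W'. p u = x} = n)))"

text \<open>
  The arc can be blown up: \<open>p\<close> agrees on it with a homeomorphism \<open>L\<close> of the sphere, and near its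
  interior \<open>p\<close> and \<open>L\<close> send each hemisphere to the same side. Here \<open>e\<close> is \<open>1\<close> or \<open>-1\<close>, according to
  whether \<open>L\<close> preserves or exchanges the hemispheres; \<open>e = 0\<close> is excluded by surjectivity of \<open>L\<close>.
\<close>

definition tame_on_arc :: "(complex \<times> real \<Rightarrow> complex \<times> real) \<Rightarrow> real \<Rightarrow> real \<Rightarrow> bool"
  where "tame_on_arc p s t \<longleftrightarrow> (\<exists>L L' e. homeomorphism S2c S2c L L' \<and>
    (\<forall>x\<in>S2c. sgn (snd (L x)) = e * sgn (snd x)) \<and>
    (\<forall>x\<in>closed_arc s t. p x = L x) \<and>
    (\<forall>x\<in>open_arc s t. \<exists>N. openin (top_of_set S2c) N \<and> x \<in> N \<and> (\<forall>u\<in>N. sgn (snd (p u)) = e * sgn (snd u))))"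

text \<open>
  The induction hypothesis of the construction. The map \<open>p\<close> has degree \<open>d\<close>, sends the equator to
  itself, and its critical points are the marked points with \<open>\<delta> k > 0\<close>, where the ramification number
  is \<open>\<delta> k + 1\<close>. Every arc of the equator between two marked points with no critical point in between
  is tame.
\<close>

definition real_branched :: "nat \<Rightarrow> (complex \<times> real \<Rightarrow> complex \<times> real) \<Rightarrow> (nat \<Rightarrow> nat) \<Rightarrow> bool"
  where "real_branched d p \<delta> \<longleftrightarrow>
    continuous_on S2c p \<and> p ` S2c \<subseteq> S2c \<and>
    (\<forall>x\<in>S2c. finite {y\<in>S2c. p y = x}) \<and>
    (\<forall>x\<in>S2c. snd x \<noteq> 0 \<longrightarrow> card {y\<in>S2c. p y = x} = d) \<and>
    (\<forall>y\<in>S2c. snd y = 0 \<longrightarrow> snd (p y) = 0) \<and>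
    (\<forall>y\<in>S2c. (\<forall>k. \<delta> k > 0 \<longrightarrow> y \<noteq> mark k) \<longrightarrow> locally_injective_at S2c p y) \<and>
    (\<forall>k. \<delta> k > 0 \<longrightarrow> local_count p (mark k) (Suc (\<delta> k))) \<and>
    (\<forall>i j. i < j \<longrightarrow> (\<forall>k. i < k \<and> k < j \<longrightarrow> \<delta> k = 0) \<longrightarrow> tame_on_arc p (mark_angle i) (mark_angle j))"

text \<open>
  Invariance of domain turns an injective neighbourhood into a neighbourhood of the image.
\<close>

lemma local_count_locally_injective:
  assumes "continuous_on S2c p" "p ` S2c \<subseteq> S2c" "locally_injective_at S2c p y"
  shows "local_count p y 1"
  unfolding local_count_def
proof (intro allI impI)
  fix W assume W: "openin (top_of_set S2c) W \<and> y \<in> W"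
  obtain W0 where W0: "openin (top_of_set S2c) W0" "y \<in> W0" "inj_on p W0"
    using assms(3) by (auto simp: locally_injective_at_def)
  let ?W = "W \<inter> W0"
  have W': "openin (top_of_set S2c) ?W" using W W0 by (intro openin_Int) auto
  have sub: "?W \<subseteq> S2c" using W' by (rule openin_imp_subset)
  have inj: "inj_on p ?W" using W0(3) by (rule inj_on_subset) auto
  have "openin (top_of_set S2c) (p ` ?W)"
  proof (rule openin_image_inj_sphere[OF _ _ W' _ inj])
    show "continuous_on ?W p" using assms(1) sub by (rule continuous_on_subset)
    show "p ` ?W \<subseteq> S2c" using assms(2) sub by blast
  qed simp_all
  moreover have "card {u\<in>?W. p u = x} = 1" if "x \<in> p ` ?W" for x
  proof -
    obtain u where "u \<in> ?W" "p u = x" using \<open>x \<in> p ` ?W\<close> by blast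
    then have "{u\<in>?W. p u = x} = {u}" using inj by (auto dest: inj_onD)
    then show ?thesis by simp
  qed
  ultimately show "\<exists>W' N. openin (top_of_set S2c) W' \<and> y \<in> W' \<and> W' \<subseteq> W \<and> openin (top_of_set S2c) N \<and> p y \<in> N \<and>
      (\<forall>x\<in>N. snd x \<noteq> 0 \<longrightarrow> card {u\<in>W'. p u = x} = 1)"
    using W W0 W' by (intro exI[of _ ?W] exI[of _ "p ` ?W"]) auto
qed

lemma real_branched_local_count:
  assumes "real_branched d p \<delta>"
  shows "local_count p (mark k) (Suc (\<delta> k))"
proof (cases "\<delta> k > 0")
  case True
  then show ?thesis using assms by (simp add: real_branched_def)
next
  case False
  then have "\<And>k'. \<delta> k' > 0 \<Longrightarrow> mark k \<noteq> mark k'" by auto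
  then have "locally_injective_at S2c p (mark k)"
    using assms pt_simps(1)[of "mark_angle k"] unfolding real_branched_def by blast
  then show ?thesis using assms False local_count_locally_injective[of p "mark k"]
    by (simp add: real_branched_def del: mem_sphere mem_sphere_0)
qed

lemma real_branched_id: "real_branched 1 id (\<lambda>_. 0)"
proof -
  have "{y \<in> S2c. id y = x} = {x}" if "x \<in> S2c" for x using that by auto
  moreover have "locally_injective_at S2c id y" if "y \<in> S2c" for y
    unfolding locally_injective_at_def by (intro exI[of _ S2c]) (use that in \<open>simp del: mem_sphere mem_sphere_0\<close>)
  moreover have "tame_on_arc id s t" for s t
    unfolding tame_on_arc_def
    by (intro exI[of _ id] exI[of _ "1::real"])
       (use arc_simps in \<open>auto simp: homeomorphism_def continuous_on_id simp del: mem_sphere mem_sphere_0 intro!: exI[of _ S2c]\<close>)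
  ultimately show ?thesis unfolding real_branched_def
    by (simp add: continuous_on_id del: mem_sphere mem_sphere_0)
qed

lemma preimage_neighbourhood:
  fixes F :: "'a::metric_space \<Rightarrow> 'b::metric_space"
  assumes F: "continuous_on S F" "F ` S \<subseteq> T" and S: "compact S" and W: "openin (top_of_set S) W"
  shows "openin (top_of_set T) (T - F ` (S - W))" "\<And>u. u \<in> S \<Longrightarrow> F u \<in> T - F ` (S - W) \<Longrightarrow> u \<in> W"
proof -
  obtain O' where O': "open O'" "W = S \<inter> O'" using W by (auto simp: openin_open)
  have "S - W = S \<inter> - O'" using O' by auto
  then have "compact (S - W)" using S O' by (simp add: compact_Int_closed closed_Compl)
  then have "compact (F ` (S - W))" using F by (intro compact_continuous_image) (auto intro: continuous_on_subset)
  then have "open (- F ` (S - W))" by (simp add: compact_imp_closed open_Compl)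
  then have "openin (top_of_set T) (T \<inter> - F ` (S - W))" by (rule openin_open_Int)
  then show "openin (top_of_set T) (T - F ` (S - W))" by (simp add: Diff_eq)
  show "\<And>u. u \<in> S \<Longrightarrow> F u \<in> T - F ` (S - W) \<Longrightarrow> u \<in> W" by blast
qed

text \<open>
  Let \<open>F\<close> fold the sphere along the arc, and let \<open>L\<close> be the homeomorphism that agrees with \<open>p\<close> on it.
  The new map is \<open>p \<circ> F\<close> on \<open>Out\<close> and \<open>L \<circ> F\<close> on \<open>In\<close>; on the circle between them \<open>F\<close> takes values in
  the arc, so both formulas agree. A point off the equator has its old preimages in \<open>Out\<close> and one
  more in \<open>In\<close>, globally as well as near each end of the arc. Across the interior of the circle
  the new map is locally injective because \<open>Out\<close> and \<open>In\<close> are sent to opposite hemispheres there. On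
  the arc itself the new map is \<open>L \<circ> G\<close>, with the sides exchanged, so that it remains tame; on the
  rest of the equator nothing has changed.
\<close>

theorem real_branched_blow_up:
  assumes rb: "real_branched d p \<delta>" and ij: "i < j" and gap: "\<And>k. i < k \<Longrightarrow> k < j \<Longrightarrow> \<delta> k = 0"
  shows "\<exists>p'. real_branched (Suc d) p' (\<delta>(i := Suc (\<delta> i), j := Suc (\<delta> j)))"
proof -
  note [simp del] = mem_sphere mem_sphere_0
  define s t where "s = mark_angle i" and "t = mark_angle j"
  have st: "0 \<le> s" "s < t" "t \<le> 3" using ij mark_angle_bounds by (auto simp: s_def t_def)
  have p: "continuous_on S2c p" "p ` S2c \<subseteq> S2c"
    and pfin: "\<And>x. x \<in> S2c \<Longrightarrow> finite {y\<in>S2c. p y = x}"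
    and pdeg: "\<And>x. x \<in> S2c \<Longrightarrow> snd x \<noteq> 0 \<Longrightarrow> card {y\<in>S2c. p y = x} = d"
    and preal: "\<And>y. y \<in> S2c \<Longrightarrow> snd y = 0 \<Longrightarrow> snd (p y) = 0"
    and pinj: "\<And>y. y \<in> S2c \<Longrightarrow> (\<And>k. \<delta> k > 0 \<Longrightarrow> y \<noteq> mark k) \<Longrightarrow> locally_injective_at S2c p y"
    and ptame: "\<And>i j. i < j \<Longrightarrow> (\<And>k. i < k \<Longrightarrow> k < j \<Longrightarrow> \<delta> k = 0) \<Longrightarrow> tame_on_arc p (mark_angle i) (mark_angle j)"
    using rb unfolding real_branched_def by blast+
  obtain F Out In G where "arc_fold s t F Out In G G"
    using fold_along_arc[OF st] .
  then interpret arc_fold s t F Out In G G .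
  have "tame_on_arc p s t" unfolding s_def t_def using ij gap by (rule ptame)
  then obtain L L' e where L: "homeomorphism S2c S2c L L'" "\<And>x. x \<in> S2c \<Longrightarrow> sgn (snd (L x)) = e * sgn (snd x)"
    "\<And>x. x \<in> closed_arc s t \<Longrightarrow> p x = L x"
    and side: "\<And>x. x \<in> open_arc s t \<Longrightarrow> \<exists>N. openin (top_of_set S2c) N \<and> x \<in> N \<and> (\<forall>u\<in>N. sgn (snd (p u)) = e * sgn (snd u))"
    unfolding tame_on_arc_def by blast
  have FS: "F x \<in> S2c" if "x \<in> S2c" for x using F(2) that by blast
  have LL: "L x \<in> S2c" "L' x \<in> S2c" "L' (L x) = x" "L (L' x) = x" if "x \<in> S2c" for x
    using L(1) that unfolding homeomorphism_def by blast+
  have Linj: "F u = F v" if "L (F u) = L (F v)" "u \<in> S2c" "v \<in> S2c" for u v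
    using arg_cong[OF that(1), of L'] LL(3)[OF FS[OF that(2)]] LL(3)[OF FS[OF that(3)]] by simp
  have cL: "continuous_on S2c L" "continuous_on S2c L'" using L(1) by (simp_all add: homeomorphism_def)
  have e0: "e \<noteq> 0"
  proof
    assume "e = 0"
    have x: "(0, 1) \<in> S2c" unfolding S2c_iff by simp
    have "snd (L (L' (0,1))) = 0" using L(2)[OF LL(2)[OF x]] \<open>e = 0\<close> by (simp add: sgn_zero_iff)
    then show False using LL(4)[OF x] by simp
  qed
  have Lzero: "snd (L x) = 0 \<longleftrightarrow> snd x = 0" if "x \<in> S2c" for x
    using L(2)[OF that] e0 by (metis mult_eq_0_iff sgn_zero_iff)
  have OS: "Out \<subseteq> S2c" "In \<subseteq> S2c" using op by (auto dest: openin_imp_subset)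
  have Fzero: "snd (F x) = 0" if "x \<in> S2c" "snd x = 0" for x
  proof -
    consider "x \<in> Out" | "x \<in> In" | "x \<in> S2c - Out - In" using \<open>x \<in> S2c\<close> by blast
    then show ?thesis
      using sOut[of x] sIn[of x] FE[of x] arc_simps(4) \<open>snd x = 0\<close> by cases (auto simp: sgn_zero_iff)
  qed
  have closed_arcD: "x \<in> S2c" "snd x = 0" if "x \<in> closed_arc s t" for x using arc_simps that by blast+
  define p' where "p' = (\<lambda>x. if x \<in> In then L (F x) else p (F x))"
  have p'In: "p' x = L (F x)" if "x \<in> S2c" "x \<notin> Out" for x
    using L(3)[OF FE] that by (auto simp: p'_def)
  have p'Out: "p' x = p (F x)" if "x \<in> S2c" "x \<notin> In" for x using that by (simp add: p'_def)
  have p'Out': "p' x = p (F x)" if "x \<in> Out" for x using that disj by (auto simp: p'_def)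
  have cont': "continuous_on S2c p'"
  proof -
    have un: "(S2c - Out) \<union> (S2c - In) = S2c" using disj by blast
    have "continuous_on ((S2c - Out) \<union> (S2c - In)) (\<lambda>x. if x \<in> In then L (F x) else p (F x))"
    proof (rule continuous_on_cases_local)
      show "closedin (top_of_set (S2c - Out \<union> (S2c - In))) (S2c - Out)" "closedin (top_of_set (S2c - Out \<union> (S2c - In))) (S2c - In)"
        unfolding un using op by (auto intro: closedin_diff)
      show "continuous_on (S2c - Out) (\<lambda>x. L (F x))"
        by (intro continuous_on_compose2[OF cL(1)] continuous_on_subset[OF F(1)]) (use F(2) in auto)
      show "continuous_on (S2c - In) (\<lambda>x. p (F x))"
        by (intro continuous_on_compose2[OF p(1)] continuous_on_subset[OF F(1)]) (use F(2) in auto)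
      show "L (F x) = p (F x)" if "x \<in> S2c - Out \<and> x \<notin> In \<or> x \<in> S2c - In \<and> x \<in> In" for x
        using L(3)[OF FE] that by auto
    qed
    then show ?thesis unfolding un p'_def .
  qed
  have into': "p' ` S2c \<subseteq> S2c"
  proof
    fix y assume "y \<in> p' ` S2c"
    then obtain x where "x \<in> S2c" "y = p' x" by blast
    then have "F x \<in> S2c" using FS by blast
    then have "L (F x) \<in> S2c" "p (F x) \<in> S2c" using LL(1) p(2) by blast+
    then show "y \<in> S2c" using \<open>y = p' x\<close> by (simp add: p'_def)
  qed
  have real': "snd (p' y) = 0" if y: "y \<in> S2c" "snd y = 0" for y
    using preal[OF FS[OF y(1)] Fzero[OF y]] Lzero[OF FS[OF y(1)]] Fzero[OF y] by (simp add: p'_def)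
  have count_Out: "card {u\<in>Out. F u \<in> W \<and> p (F u) = x} = card {w\<in>W. p w = x}"
    if W: "W \<subseteq> S2c" and x: "snd x \<noteq> 0" for W x
  proof -
    have im: "F ` {u\<in>Out. F u \<in> W \<and> p (F u) = x} = {w\<in>W. p w = x}"
    proof
      show "{w\<in>W. p w = x} \<subseteq> F ` {u\<in>Out. F u \<in> W \<and> p (F u) = x}"
      proof
        fix w assume w: "w \<in> {w\<in>W. p w = x}"
        have "w \<in> S2c" using w W by blast
        have "w \<notin> closed_arc s t" using closed_arcD(2)[of w] preal[OF \<open>w \<in> S2c\<close>] w x by auto
        then have "w \<in> F ` Out" unfolding FOut(2) using \<open>w \<in> S2c\<close> by blast
        then obtain u where "u \<in> Out" "F u = w" by blast
        then show "w \<in> F ` {u\<in>Out. F u \<in> W \<and> p (F u) = x}" using w by auto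
      qed
    qed blast
    have "inj_on F {u\<in>Out. F u \<in> W \<and> p (F u) = x}" using FOut(1) by (rule inj_on_subset) blast
    from card_image[OF this] show ?thesis unfolding im by (rule sym)
  qed
  have count_In: "card {u\<in>In. F u \<in> W \<and> L (F u) = x} = 1"
    if W: "L' x \<in> W" and x: "x \<in> S2c" "snd x \<noteq> 0" for W x
  proof -
    have z: "L' x \<in> S2c" "snd (L' x) \<noteq> 0" using LL[OF x(1)] Lzero[of "L' x"] x(2) by auto
    then have "L' x \<notin> closed_arc s t" using closed_arcD by blast
    then have "L' x \<in> F ` In" unfolding FIn(2) using z by blast
    then obtain u where u: "u \<in> In" "F u = L' x" by auto
    have "{u\<in>In. F u \<in> W \<and> L (F u) = x} = {u}"
    proof -
      have "v = u" if "v \<in> In" "L (F v) = x" for v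
      proof -
        have "F v \<in> S2c" using FS that(1) OS by blast
        then have "F v = L' x" using LL(3)[of "F v"] that(2) by simp
        then show ?thesis using inj_onD[OF FIn(1), of v u] u that(1) by simp
      qed
      moreover have "F u \<in> W \<and> L (F u) = x" unfolding u(2) using W LL(4)[OF x(1)] by blast
      ultimately show ?thesis using u(1) by blast
    qed
    then show ?thesis by simp
  qed
  \<comment> \<open>the points above x are those of the old map, moved into Out, and one more point in In\<close>
  have count: "card {u\<in>S2c. F u \<in> W \<and> p' u = x} = Suc (card {w\<in>W. p w = x})"
    if W: "W \<subseteq> S2c" "L' x \<in> W" and x: "x \<in> S2c" "snd x \<noteq> 0" for W x
  proof -
    have "{u\<in>S2c. F u \<in> W \<and> p' u = x} = {u\<in>Out. F u \<in> W \<and> p (F u) = x} \<union> {u\<in>In. F u \<in> W \<and> L (F u) = x}"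
    proof (intro set_eqI iffI)
      fix u assume u: "u \<in> {u\<in>S2c. F u \<in> W \<and> p' u = x}"
      then have uS: "u \<in> S2c" by blast
      have "u \<in> Out \<or> u \<in> In"
      proof (rule ccontr)
        assume nin: "\<not> ?thesis"
        then have "F u \<in> closed_arc s t" using FE uS by blast
        then have "snd (p (F u)) = 0" using closed_arcD preal by blast
        then show False using p'Out[OF uS] nin u x by auto
      qed
      then show "u \<in> {u\<in>Out. F u \<in> W \<and> p (F u) = x} \<union> {u\<in>In. F u \<in> W \<and> L (F u) = x}"
      proof
        assume o: "u \<in> Out"
        show ?thesis using u o p'Out'[OF o] by simp
      next
        assume i: "u \<in> In"
        then have "p' u = L (F u)" by (simp add: p'_def)
        then show ?thesis using u i by simp
      qed
    next
      fix u assume "u \<in> {u\<in>Out. F u \<in> W \<and> p (F u) = x} \<union> {u\<in>In. F u \<in> W \<and> L (F u) = x}"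
      then consider "u \<in> Out" "F u \<in> W" "p (F u) = x" | "u \<in> In" "F u \<in> W" "L (F u) = x" by blast
      then show "u \<in> {u\<in>S2c. F u \<in> W \<and> p' u = x}"
      proof cases
        case 1
        then show ?thesis using p'Out'[OF 1(1)] OS(1) by auto
      next
        case 2
        then show ?thesis using OS(2) by (auto simp: p'_def)
      qed
    qed
    moreover have "finite {u\<in>Out. F u \<in> W \<and> p (F u) = x}"
    proof -
      have "finite (F -` {w\<in>S2c. p w = x} \<inter> Out)" using pfin[OF x(1)] FOut(1) by (rule finite_vimage_IntI)
      then show ?thesis by (rule rev_finite_subset) (use W in auto)
    qed
    moreover have "finite {u\<in>In. F u \<in> W \<and> L (F u) = x}"
      using count_In[OF W(2) x] by (simp add: card_ge_0_finite)
    moreover have "{u\<in>Out. F u \<in> W \<and> p (F u) = x} \<inter> {u\<in>In. F u \<in> W \<and> L (F u) = x} = {}" using disj by blast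
    ultimately show ?thesis using count_Out[OF W(1) x(2), of] count_In[OF W(2) x] by (simp add: card_Un_disjoint)
  qed
  have deg': "card {y\<in>S2c. p' y = x} = Suc d" if x: "x \<in> S2c" "snd x \<noteq> 0" for x
  proof -
    have "{y\<in>S2c. p' y = x} = {y\<in>S2c. F y \<in> S2c \<and> p' y = x}" using FS by blast
    then show ?thesis using count[OF subset_refl LL(2)[OF x(1)] x] pdeg[OF x] by simp
  qed
  have fin': "finite {y\<in>S2c. p' y = x}" if x: "x \<in> S2c" for x
  proof -
    let ?E = "S2c - Out - In"
    have "inj_on F {u\<in>?E. snd u > 0}" "inj_on F {u\<in>?E. snd u < 0}"
    proof -
      show "inj_on F {u\<in>?E. snd u > 0}"
      proof (rule inj_onI)
        fix u v assume "u \<in> {u\<in>?E. snd u > 0}" "v \<in> {u\<in>?E. snd u > 0}" "F u = F v"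
        then show "u = v" using FEinj[of u v] by simp
      qed
      show "inj_on F {u\<in>?E. snd u < 0}"
      proof (rule inj_onI)
        fix u v assume "u \<in> {u\<in>?E. snd u < 0}" "v \<in> {u\<in>?E. snd u < 0}" "F u = F v"
        then show "u = v" using FEinj[of u v] by (simp add: mult_neg_neg)
      qed
    qed
    then have "finite (F -` {L' x} \<inter> {u\<in>?E. snd u > 0})" "finite (F -` {L' x} \<inter> {u\<in>?E. snd u < 0})"
      by (auto intro: finite_vimage_IntI)
    moreover have "finite (F -` {w\<in>S2c. p w = x} \<inter> Out)" using pfin[OF x] FOut(1) by (rule finite_vimage_IntI)
    moreover have "finite (F -` {L' x} \<inter> In)" using FIn(1) by (intro finite_vimage_IntI) auto
    ultimately have "finite ((F -` {L' x} \<inter> {u\<in>?E. snd u > 0}) \<union> (F -` {L' x} \<inter> {u\<in>?E. snd u < 0})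
      \<union> (F -` {w\<in>S2c. p w = x} \<inter> Out) \<union> (F -` {L' x} \<inter> In) \<union> {pt s, pt t})" by simp
    then show ?thesis
    proof (rule rev_finite_subset, intro subsetI)
      fix u assume u: "u \<in> {y\<in>S2c. p' y = x}"
      then have uS: "u \<in> S2c" "p' u = x" by auto
      show "u \<in> (F -` {L' x} \<inter> {u\<in>?E. snd u > 0}) \<union> (F -` {L' x} \<inter> {u\<in>?E. snd u < 0})
      \<union> (F -` {w\<in>S2c. p w = x} \<inter> Out) \<union> (F -` {L' x} \<inter> In) \<union> {pt s, pt t}"
      proof (cases "u \<in> Out")
        case True
        then show ?thesis using p'Out'[OF True] uS FS by auto
      next
        case False
        then have "F u = L' x" using p'In[OF uS(1)] uS LL(3)[OF FS[OF uS(1)]] by auto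
        moreover have "u \<in> In \<or> u \<in> ?E" using False uS by blast
        moreover have "snd u > 0 \<or> snd u < 0 \<or> u = pt s \<or> u = pt t" if "u \<in> ?E" using Ereal[OF that] by linarith
        ultimately show ?thesis by auto
      qed
    qed
  qed
  let ?\<delta>' = "\<delta>(i := Suc (\<delta> i), j := Suc (\<delta> j))"
  have mark_ij: "mark i = pt s" "mark j = pt t" by (simp_all add: s_def t_def)
  have mark_arc: "mark k \<in> open_arc s t \<longleftrightarrow> i < k \<and> k < j" "mark k \<in> closed_arc s t \<longleftrightarrow> i \<le> k \<and> k \<le> j" for k
    using mark_angle_bounds[of k] mark_angle_bounds[of i] mark_angle_bounds[of j] by (simp_all add: pt_in_open_arc pt_in_closed_arc s_def t_def)
  have real_Out: "x \<in> Out" "F x = x" if x: "x \<in> S2c" "snd x = 0" "x \<notin> closed_arc s t" for x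
  proof -
    have no: "x \<notin> open_arc s t" using x(3) arc_simps(5) by blast
    then show "F x = x" using Ffix x by blast
    have "pt s \<in> closed_arc s t" "pt t \<in> closed_arc s t" using st by (auto simp: closed_arc_def)
    then show "x \<in> Out" using Ereal[of x] Ffix[OF x(1,2) no] x by blast
  qed
  \<comment> \<open>marked points inside the arc have \<open>\<delta> k = 0\<close>, so p is locally injective there\<close>
  have inj': "locally_injective_at S2c p' y" if y: "y \<in> S2c" and ny: "\<And>k. ?\<delta>' k > 0 \<Longrightarrow> y \<noteq> mark k" for y
  proof -
    have yst: "y \<noteq> pt s" "y \<noteq> pt t" using ny[of i] ny[of j] by (auto simp: mark_ij)
    have n\<delta>: "y \<noteq> mark k" if "\<delta> k > 0" for k using ny[of k] that by (auto split: if_splits)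
    consider "y \<in> Out" | "y \<in> In" | "y \<in> S2c - Out - In" using y by blast
    then show ?thesis
    proof cases
      case 1
      have "F y \<noteq> mark k" if "\<delta> k > 0" for k
      proof
        assume m: "F y = mark k"
        have "F y \<in> F ` Out" using 1 by blast
        then have "mark k \<notin> closed_arc s t" unfolding FOut(2) m by blast
        then have "mark k \<in> Out" "F (mark k) = mark k" using real_Out[of "mark k"] by simp_all
        then have "y = mark k" using m 1 inj_onD[OF FOut(1), of y "mark k"] by simp
        then show False using n\<delta> that by blast
      qed
      then have "locally_injective_at S2c p (F y)" by (rule pinj[OF FS[OF y]])
      then obtain W where W: "openin (top_of_set S2c) W" "F y \<in> W" "inj_on p W"
        unfolding locally_injective_at_def by blast
      have "openin (top_of_set S2c) (Out \<inter> (S2c \<inter> F -` W))"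
        by (rule openin_Int[OF op(1) continuous_openin_preimage[OF F(1) _ W(1)]]) (use F(2) in blast)
      moreover have "y \<in> Out \<inter> (S2c \<inter> F -` W)" using 1 y W(2) by blast
      moreover have "inj_on p' (Out \<inter> (S2c \<inter> F -` W))"
      proof (rule inj_onI)
        fix u v assume uv: "u \<in> Out \<inter> (S2c \<inter> F -` W)" "v \<in> Out \<inter> (S2c \<inter> F -` W)" "p' u = p' v"
        then have "p (F u) = p (F v)" using p'Out'[of u] p'Out'[of v] by simp
        then have "F u = F v" using inj_onD[OF W(3), of "F u" "F v"] uv by blast
        then show "u = v" using inj_onD[OF FOut(1), of u v] uv by blast
      qed
      ultimately show ?thesis unfolding locally_injective_at_def by blast
    next
      case 2
      have "inj_on p' In"
      proof (rule inj_onI)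
        fix u v assume uv: "u \<in> In" "v \<in> In" "p' u = p' v"
        then have "L (F u) = L (F v)" by (simp add: p'_def)
        then have "F u = F v" by (rule Linj) (use uv OS in blast)+
        then show "u = v" using inj_onD[OF FIn(1), of u v] uv by blast
      qed
      then show ?thesis unfolding locally_injective_at_def using op(2) 2 by blast
    next
      case 3
      have sy: "snd y \<noteq> 0" using Ereal[OF 3] yst by blast
      have Fy: "F y \<in> open_arc s t"
        using closed_arc_minus_ends[OF FE[OF 3]] Fs[OF y] Ft[OF y] yst by blast
      have "F y \<noteq> mark k" if "\<delta> k > 0" for k
        using Fy mark_arc(1)[of k] gap[of k] that by auto
      then have "locally_injective_at S2c p (F y)" by (rule pinj[OF FS[OF y]])
      then obtain W where W: "openin (top_of_set S2c) W" "F y \<in> W" "inj_on p W"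
        unfolding locally_injective_at_def by blast
      obtain N where N: "openin (top_of_set S2c) N" "F y \<in> N" "\<forall>u\<in>N. sgn (snd (p u)) = e * sgn (snd u)"
        using side[OF Fy] by blast
      \<comment> \<open>V stays on one side of the equator, where Out, In and the folded circle are sent to one
        hemisphere, to the other one, and to the equator, respectively\<close>
      define V where "V = (S2c \<inter> F -` (W \<inter> N)) \<inter> (S2c \<inter> (\<lambda>u. snd u * snd y) -` {0<..})"
      have "openin (top_of_set S2c) V" unfolding V_def
      proof (rule openin_Int)
        show "openin (top_of_set S2c) (S2c \<inter> F -` (W \<inter> N))"
          by (rule continuous_openin_preimage[OF F(1) _ openin_Int[OF W(1) N(1)]]) (use F(2) in blast)
        show "openin (top_of_set S2c) (S2c \<inter> (\<lambda>u. snd u * snd y) -` {0<..})"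
          by (intro continuous_openin_preimage_gen continuous_intros)
      qed
      moreover have "y \<in> V" using y W(2) N(2) sy by (auto simp: V_def zero_less_mult_iff)
      moreover have "inj_on p' V"
      proof (rule inj_onI)
        fix u v assume uv: "u \<in> V" "v \<in> V" "p' u = p' v"
        have uS: "u \<in> S2c" "F u \<in> W" "F u \<in> N" "sgn (snd u) = sgn (snd y)"
          and vS: "v \<in> S2c" "F v \<in> W" "F v \<in> N" "sgn (snd v) = sgn (snd y)"
          using uv(1,2) by (auto simp: V_def zero_less_mult_iff)
        have cls: "(z \<in> Out \<and> sgn (snd (p' z)) = e * sgn (snd y)) \<or> (z \<in> In \<and> sgn (snd (p' z)) = - (e * sgn (snd y))) \<or>
            (z \<in> S2c - Out - In \<and> sgn (snd (p' z)) = 0)"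
          if z: "z \<in> S2c" "F z \<in> N" "sgn (snd z) = sgn (snd y)" for z
        proof -
          consider "z \<in> Out" | "z \<in> In" | "z \<in> S2c - Out - In" using z(1) by blast
          then show ?thesis
          proof cases
            case 1
            then show ?thesis using N(3) z sOut[OF 1] p'Out'[OF 1] by auto
          next
            case 2
            then show ?thesis using L(2)[OF FS[OF z(1)]] z sIn[OF 2] by (auto simp: p'_def)
          next
            case 3
            have "snd (p' z) = 0" using preal[OF FS[OF z(1)]] closed_arcD(2)[OF FE[OF 3]] 3 by (simp add: p'_def)
            then show ?thesis using 3 by simp
          qed
        qed
        have "e * sgn (snd y) \<noteq> 0" using e0 sy by (simp add: sgn_zero_iff)
        then consider "u \<in> Out" "v \<in> Out" | "u \<in> In" "v \<in> In" | "u \<in> S2c - Out - In" "v \<in> S2c - Out - In"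
          using cls[OF uS(1,3,4)] cls[OF vS(1,3,4)] uv(3) by auto
        then show "u = v"
        proof cases
          case 1
          then have "p (F u) = p (F v)" using uv(3) p'Out'[of u] p'Out'[of v] by simp
          then have "F u = F v" using inj_onD[OF W(3), of "F u" "F v"] uS vS by blast
          then show ?thesis using inj_onD[OF FOut(1), of u v] 1 by blast
        next
          case 2
          then have "L (F u) = L (F v)" using uv(3) by (simp add: p'_def)
          then have "F u = F v" by (rule Linj) (use uS vS in blast)+
          then show ?thesis using inj_onD[OF FIn(1), of u v] 2 by blast
        next
          case 3
          then have "L (F u) = L (F v)" using uv(3) p'In[of u] p'In[of v] by auto
          then have "F u = F v" by (rule Linj) (use uS vS in blast)+
          moreover have "snd u * snd v > 0" using uS(4) vS(4) sy by (auto simp: sgn_if zero_less_mult_iff split: if_splits)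
          ultimately show ?thesis using FEinj 3 by blast
        qed
      qed
      ultimately show ?thesis unfolding locally_injective_at_def by blast
    qed
  qed
  have end_count: "local_count p' (mark k) (Suc (Suc (\<delta> k)))"
    if k: "mark k = pt s \<or> mark k = pt t" for k
    unfolding local_count_def
  proof (intro allI impI)
    let ?y = "mark k"
    fix W assume W: "openin (top_of_set S2c) W \<and> ?y \<in> W"
    have yc: "?y \<in> closed_arc s t" "?y \<notin> open_arc s t" "?y \<notin> In" using k st ends arcIn by (auto simp: closed_arc_def)
    have Fy: "F ?y = ?y" using Ffix[of ?y] yc by simp
    have p'y: "p' ?y = p ?y" "p ?y = L ?y" using yc Fy L(3) by (simp_all add: p'_def)
    \<comment> \<open>F folds no other point onto the end of the arc, so W contains the F-preimage of a neighbourhood\<close>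
    let ?W2 = "S2c - F ` (S2c - W)"
    have W2: "openin (top_of_set S2c) ?W2" "\<And>u. u \<in> S2c \<Longrightarrow> F u \<in> ?W2 \<Longrightarrow> u \<in> W"
      using preimage_neighbourhood[OF F compact_sphere, of W] W by blast+
    have only: "u = ?y" if "u \<in> S2c" "F u = ?y" for u
      using k Fs[OF that(1)] Ft[OF that(1)] that(2) by (elim disjE) simp_all
    have "?y \<notin> F ` (S2c - W)"
    proof
      assume "?y \<in> F ` (S2c - W)"
      then obtain u where u: "?y = F u" "u \<in> S2c - W" by (rule imageE)
      have "u = ?y" by (rule only) (use u in simp_all)
      then show False using u(2) W by simp
    qed
    then have yW2: "?y \<in> ?W2" using pt_simps(1)[of "mark_angle k"] by simp
    obtain W' N where W': "openin (top_of_set S2c) W'" "?y \<in> W'" "W' \<subseteq> ?W2"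
      and N: "openin (top_of_set S2c) N" "p ?y \<in> N" "\<forall>x\<in>N. snd x \<noteq> 0 \<longrightarrow> card {u\<in>W'. p u = x} = Suc (\<delta> k)"
      using real_branched_local_count[OF rb, of k, unfolded local_count_def, rule_format, OF conjI[OF W2(1) yW2]]
      by (elim exE conjE) (rule that, assumption+)
    have W'S: "W' \<subseteq> S2c" using W'(1) by (rule openin_imp_subset)
    let ?W1 = "S2c \<inter> F -` W'" and ?N1 = "N \<inter> (S2c \<inter> L' -` W')"
    have "openin (top_of_set S2c) ?W1"
      by (rule continuous_openin_preimage[OF F(1) _ W'(1)]) (use F(2) in blast)
    moreover have "?y \<in> ?W1" using Fy W'(2) by simp
    moreover have "?W1 \<subseteq> W" using W2(2) W'(3) by blast
    moreover have "openin (top_of_set S2c) ?N1"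
      by (rule openin_Int[OF N(1) continuous_openin_preimage[OF cL(2) _ W'(1)]]) (use LL in blast)
    moreover have "p' ?y \<in> ?N1" using p'y N(2) LL(1,3)[of ?y] W'(2) by simp
    moreover have "card {u\<in>?W1. p' u = x} = Suc (Suc (\<delta> k))" if x: "x \<in> ?N1" "snd x \<noteq> 0" for x
    proof -
      have "{u\<in>?W1. p' u = x} = {u\<in>S2c. F u \<in> W' \<and> p' u = x}" by blast
      then show ?thesis using count[OF W'S, of x] x N(3) by simp
    qed
    ultimately show "\<exists>W' N. openin (top_of_set S2c) W' \<and> ?y \<in> W' \<and> W' \<subseteq> W \<and> openin (top_of_set S2c) N \<and> p' ?y \<in> N \<and>
      (\<forall>x\<in>N. snd x \<noteq> 0 \<longrightarrow> card {u\<in>W'. p' u = x} = Suc (Suc (\<delta> k)))" by blast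
  qed
  have other_count: "local_count p' (mark k) (Suc (\<delta> k))" if k: "mark k \<notin> closed_arc s t" for k
    unfolding local_count_def
  proof (intro allI impI)
    let ?y = "mark k"
    fix W assume W: "openin (top_of_set S2c) W \<and> ?y \<in> W"
    have y: "?y \<in> Out" "F ?y = ?y" using real_Out[of ?y] k by simp_all
    have p'y: "p' ?y = p ?y" using p'Out'[OF y(1)] y(2) by simp
    let ?W2 = "S2c - F ` (S2c - (In \<union> (W \<inter> Out)))"
    have oW: "openin (top_of_set S2c) (In \<union> (W \<inter> Out))" using W op by (intro openin_Un openin_Int) auto
    have W2: "openin (top_of_set S2c) ?W2" "\<And>u. u \<in> S2c \<Longrightarrow> F u \<in> ?W2 \<Longrightarrow> u \<in> In \<union> (W \<inter> Out)"
      using preimage_neighbourhood[OF F compact_sphere oW] by blast+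
    have "?y \<in> ?W2"
    proof -
      have no: False if u: "u \<in> S2c" "u \<notin> In" "u \<notin> W \<inter> Out" "F u = ?y" for u
      proof (cases "u \<in> Out")
        case True
        then have "u = ?y" using u(4) y inj_onD[OF FOut(1) _ True y(1)] by simp
        then show False using u(3) W y by blast
      next
        case False
        then show False using FE[of u] u k by auto
      qed
      have "?y \<notin> F ` (S2c - (In \<union> (W \<inter> Out)))"
      proof
        assume "?y \<in> F ` (S2c - (In \<union> (W \<inter> Out)))"
        then obtain u where "?y = F u" "u \<in> S2c - (In \<union> (W \<inter> Out))" by (rule imageE)
        then show False using no[of u] by simp
      qed
      then show ?thesis using pt_simps(1)[of "mark_angle k"] by simp
    qed
    moreover have "openin (top_of_set S2c) (?W2 - closed_arc s t)"
    proof -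
      have "openin (top_of_set S2c) (?W2 \<inter> - closed_arc s t)"
        by (rule openin_Int_open[OF W2(1)]) (simp add: open_Compl closed_closed_arc)
      then show ?thesis by (simp add: Diff_eq)
    qed
    ultimately have oy: "openin (top_of_set S2c) (?W2 - closed_arc s t) \<and> ?y \<in> ?W2 - closed_arc s t"
      using k by simp
    obtain W' N where W': "openin (top_of_set S2c) W'" "?y \<in> W'" "W' \<subseteq> ?W2 - closed_arc s t"
      and N: "openin (top_of_set S2c) N" "p ?y \<in> N" "\<forall>x\<in>N. snd x \<noteq> 0 \<longrightarrow> card {u\<in>W'. p u = x} = Suc (\<delta> k)"
      using real_branched_local_count[OF rb, of k, unfolded local_count_def, rule_format, OF oy]
      by (elim exE conjE) (rule that, assumption+)
    have W'S: "W' \<subseteq> S2c" using W'(1) by (rule openin_imp_subset)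
    let ?W1 = "Out \<inter> (S2c \<inter> F -` W')"
    have "openin (top_of_set S2c) ?W1"
      by (rule openin_Int[OF op(1) continuous_openin_preimage[OF F(1) _ W'(1)]]) (use F(2) in blast)
    moreover have "?y \<in> ?W1" using y W'(2) by simp
    moreover have "?W1 \<subseteq> W" using W2(2) W'(3) disj by blast
    moreover have "card {u\<in>?W1. p' u = x} = Suc (\<delta> k)" if x: "x \<in> N" "snd x \<noteq> 0" for x
    proof -
      have "{u\<in>?W1. p' u = x} = {u\<in>Out. F u \<in> W' \<and> p (F u) = x}" using p'Out' OS by auto
      then show ?thesis using count_Out[OF W'S x(2)] x N(3) by simp
    qed
    ultimately show "\<exists>W' N. openin (top_of_set S2c) W' \<and> ?y \<in> W' \<and> W' \<subseteq> W \<and> openin (top_of_set S2c) N \<and> p' ?y \<in> N \<and>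
      (\<forall>x\<in>N. snd x \<noteq> 0 \<longrightarrow> card {u\<in>W'. p' u = x} = Suc (\<delta> k))"
      using N(1,2) p'y by (intro exI[of _ ?W1] exI[of _ N]) simp
  qed
  have count': "local_count p' (mark k) (Suc (?\<delta>' k))" if k: "?\<delta>' k > 0" for k
  proof (cases "k = i \<or> k = j")
    case True
    then show ?thesis using end_count[of k] ij by (auto simp: mark_ij)
  next
    case False
    then have "\<delta> k > 0" using k by auto
    then have "\<not> (i < k \<and> k < j)" using gap by fastforce
    then have "mark k \<notin> closed_arc s t" using False mark_arc(2)[of k] by auto
    then show ?thesis using other_count False by simp
  qed
  have tame': "tame_on_arc p' (mark_angle i') (mark_angle j')"
    if ij': "i' < j'" and gap': "\<And>k. i' < k \<Longrightarrow> k < j' \<Longrightarrow> ?\<delta>' k = 0" for i' j'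
  proof -
    have "\<not> (i' < i \<and> i < j')" "\<not> (i' < j \<and> j < j')" using gap'[of i] gap'[of j] ij by (auto split: if_splits)
    then consider "j' \<le> i \<or> j \<le> i'" | "i \<le> i'" "j' \<le> j" using ij' ij by linarith
    then show ?thesis
    proof cases
      case 1
      have "\<delta> k = 0" if "i' < k" "k < j'" for k using gap'[OF that] by (auto split: if_splits)
      then have "tame_on_arc p (mark_angle i') (mark_angle j')" by (rule ptame[OF ij'])
      then obtain L0 L0' e0 where L0: "homeomorphism S2c S2c L0 L0'" "\<forall>x\<in>S2c. sgn (snd (L0 x)) = e0 * sgn (snd x)"
        "\<forall>x\<in>closed_arc (mark_angle i') (mark_angle j'). p x = L0 x"
        and side0: "\<forall>x\<in>open_arc (mark_angle i') (mark_angle j'). \<exists>N. openin (top_of_set S2c) N \<and> x \<in> N \<and> (\<forall>u\<in>N. sgn (snd (p u)) = e0 * sgn (snd u))"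
        unfolding tame_on_arc_def by blast
      have far: "\<theta> \<le> s \<or> t \<le> \<theta>" if "\<theta> \<in> {mark_angle i'..mark_angle j'}" for \<theta>
        using 1 that mark_angle_le_iff[of j' i] mark_angle_le_iff[of j i'] unfolding s_def t_def atLeastAtMost_iff by linarith
      have far': "\<theta> < s \<or> t < \<theta>" if "\<theta> \<in> {mark_angle i'<..<mark_angle j'}" for \<theta>
        using 1 that mark_angle_le_iff[of j' i] mark_angle_le_iff[of j i'] unfolding s_def t_def greaterThanLessThan_iff by linarith
      have b: "0 \<le> \<theta>" "\<theta> \<le> 3" if "\<theta> \<in> {mark_angle i'..mark_angle j'}" for \<theta>
        using that mark_angle_bounds[of i'] mark_angle_bounds[of j'] by auto
      have eq: "p' x = L0 x" if x: "x \<in> closed_arc (mark_angle i') (mark_angle j')" for x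
      proof -
        obtain \<theta> where \<theta>: "\<theta> \<in> {mark_angle i'..mark_angle j'}" "x = pt \<theta>" using x by (auto simp: closed_arc_def)
        have "x \<notin> open_arc s t" using far[OF \<theta>(1)] b[OF \<theta>(1)] st by (auto simp: \<theta>(2) pt_in_open_arc)
        then have "F x = x" "x \<notin> In" using Ffix[of x] by (auto simp: \<theta>(2))
        then show ?thesis using L0(3) x by (simp add: p'_def)
      qed
      have "\<exists>N. openin (top_of_set S2c) N \<and> x \<in> N \<and> (\<forall>u\<in>N. sgn (snd (p' u)) = e0 * sgn (snd u))"
        if x: "x \<in> open_arc (mark_angle i') (mark_angle j')" for x
      proof -
        obtain \<theta> where \<theta>: "\<theta> \<in> {mark_angle i'<..<mark_angle j'}" "x = pt \<theta>" using x by (auto simp: open_arc_def)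
        have "x \<notin> closed_arc s t" using far'[OF \<theta>(1)] b[of \<theta>] \<theta>(1) st by (auto simp: \<theta>(2) pt_in_closed_arc)
        then have xO: "x \<in> Out" "F x = x" using real_Out[of x] by (auto simp: \<theta>(2))
        obtain N where N: "openin (top_of_set S2c) N" "x \<in> N" "\<forall>u\<in>N. sgn (snd (p u)) = e0 * sgn (snd u)"
          using side0 x by blast
        let ?N = "Out \<inter> (S2c \<inter> F -` N)"
        have "openin (top_of_set S2c) ?N"
          by (rule openin_Int[OF op(1) continuous_openin_preimage[OF F(1) _ N(1)]]) (use F(2) in blast)
        moreover have "x \<in> ?N" using xO N(2) OS by auto
        moreover have "sgn (snd (p' u)) = e0 * sgn (snd u)" if "u \<in> ?N" for u
          using that N(3) sOut[of u] p'Out'[of u] by auto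
        ultimately show ?thesis by blast
      qed
      then show ?thesis unfolding tame_on_arc_def using L0(1,2) eq by blast
    next
      case 2
      have sub: "closed_arc (mark_angle i') (mark_angle j') \<subseteq> closed_arc s t" "open_arc (mark_angle i') (mark_angle j') \<subseteq> open_arc s t"
        using 2 mark_angle_le_iff[of i i'] mark_angle_le_iff[of j' j] unfolding closed_arc_def open_arc_def s_def t_def
        by (auto simp del: mark_angle_le_iff mark_angle_less_iff)
      have "homeomorphism S2c S2c (L \<circ> G) (G \<circ> L')" by (rule homeomorphism_compose[OF G(1) L(1)])
      moreover have "\<forall>x\<in>S2c. sgn (snd ((L \<circ> G) x)) = (- e) * sgn (snd x)"
      proof
        fix x assume x: "x \<in> S2c"
        then have "G x \<in> S2c" using G(1) unfolding homeomorphism_def by blast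
        then show "sgn (snd ((L \<circ> G) x)) = (- e) * sgn (snd x)" using L(2) G(2)[OF x] by simp
      qed
      moreover have "\<forall>x\<in>closed_arc (mark_angle i') (mark_angle j'). p' x = (L \<circ> G) x"
      proof
        fix x assume "x \<in> closed_arc (mark_angle i') (mark_angle j')"
        then have x: "x \<in> closed_arc s t" using sub by blast
        have "p' x = L (F x)"
        proof (cases "x \<in> open_arc s t")
          case True
          then show ?thesis using arcIn by (auto simp: p'_def)
        next
          case False
          then have "F x = x" "x \<notin> In" using Ffix closed_arcD[OF x] by blast+
          then show ?thesis using L(3)[OF x] by (simp add: p'_def)
        qed
        then show "p' x = (L \<circ> G) x" using FG[OF x] by simp
      qed
      moreover have "\<forall>x\<in>open_arc (mark_angle i') (mark_angle j'). \<exists>N. openin (top_of_set S2c) N \<and> x \<in> N \<and> (\<forall>u\<in>N. sgn (snd (p' u)) = (- e) * sgn (snd u))"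
      proof
        fix x assume "x \<in> open_arc (mark_angle i') (mark_angle j')"
        then have "x \<in> In" using sub arcIn by blast
        moreover have "\<forall>u\<in>In. sgn (snd (p' u)) = (- e) * sgn (snd u)"
        proof
          fix u assume u: "u \<in> In"
          then have "F u \<in> S2c" using FS OS by blast
          then show "sgn (snd (p' u)) = (- e) * sgn (snd u)" using u L(2) sIn[OF u] by (simp add: p'_def)
        qed
        ultimately show "\<exists>N. openin (top_of_set S2c) N \<and> x \<in> N \<and> (\<forall>u\<in>N. sgn (snd (p' u)) = (- e) * sgn (snd u))"
          using op(2) by blast
      qed
      ultimately show ?thesis unfolding tame_on_arc_def by blast
    qed
  qed
  have "real_branched (Suc d) p' ?\<delta>'"
    unfolding real_branched_def
  proof (intro conjI cont' into')
    show "\<forall>x\<in>S2c. finite {y \<in> S2c. p' y = x}" using fin' by (rule ballI)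
    show "\<forall>x\<in>S2c. snd x \<noteq> 0 \<longrightarrow> card {y \<in> S2c. p' y = x} = Suc d" using deg' by (intro ballI impI)
    show "\<forall>y\<in>S2c. snd y = 0 \<longrightarrow> snd (p' y) = 0" using real' by (intro ballI impI)
    show "\<forall>y\<in>S2c. (\<forall>k. ?\<delta>' k > 0 \<longrightarrow> y \<noteq> mark k) \<longrightarrow> locally_injective_at S2c p' y"
    proof (intro ballI impI)
      fix y assume y: "y \<in> S2c" and "\<forall>k. ?\<delta>' k > 0 \<longrightarrow> y \<noteq> mark k"
      then show "locally_injective_at S2c p' y" by (intro inj'[OF y]) blast
    qed
    show "\<forall>k. ?\<delta>' k > 0 \<longrightarrow> local_count p' (mark k) (Suc (?\<delta>' k))" using count' by (intro allI impI)
    show "\<forall>i' j'. i' < j' \<longrightarrow> (\<forall>k. i' < k \<and> k < j' \<longrightarrow> ?\<delta>' k = 0) \<longrightarrow> tame_on_arc p' (mark_angle i') (mark_angle j')"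
    proof (intro allI impI)
      fix i' j' :: nat assume "i' < j'" and "\<forall>k. i' < k \<and> k < j' \<longrightarrow> ?\<delta>' k = 0"
      then show "tame_on_arc p' (mark_angle i') (mark_angle j')" by (intro tame') blast+
    qed
  qed
  then show ?thesis by blast
qed

section \<open>Branched coverings with prescribed ramification\<close>

text \<open>
  Going down from \<open>N + 1\<close> to \<open>N\<close>, two positive entries with only zeros between them are decreased. If
  some entry equals the bound \<open>N + 1\<close>, it must be among the two. There are at most two such entries,
  and if there are two, all others vanish.
\<close>

lemma real_branched_exists:
  assumes "\<And>k. k \<ge> m \<Longrightarrow> \<delta> k = 0" "(\<Sum>k<m. \<delta> k) = 2 * N" "\<And>k. \<delta> k \<le> N"
  shows "\<exists>p. real_branched (Suc N) p \<delta>"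
  using assms
proof (induction N arbitrary: \<delta>)
  case 0
  then have "\<delta> = (\<lambda>_. 0)" by auto
  then show ?case using real_branched_id by (metis One_nat_def)
next
  case (Suc N)
  define S where "S = {k. \<delta> k > 0}"
  have S: "S \<subseteq> {..<m}" using Suc.prems(1) by (force simp: S_def not_less[symmetric])
  then have finS: "finite S" by (rule finite_subset) simp
  have sumS: "(\<Sum>k\<in>S. \<delta> k) = 2 * Suc N"
    unfolding Suc.prems(2)[symmetric] using S by (intro sum.mono_neutral_left) (auto simp: S_def)
  have "S \<noteq> {}" using sumS by auto
  \<comment> \<open>an entry equal to the bound if there is one, and then the nearest other positive entry\<close>
  then obtain a where a: "a \<in> S" "(\<exists>k. \<delta> k = Suc N) \<longrightarrow> \<delta> a = Suc N"
  proof (cases "\<exists>k. \<delta> k = Suc N")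
    case True
    then obtain k where "\<delta> k = Suc N" by blast
    then show ?thesis using that[of k] by (auto simp: S_def)
  next
    case False
    then show ?thesis using \<open>S \<noteq> {}\<close> that by blast
  qed
  have "S - {a} \<noteq> {}"
  proof
    assume "S - {a} = {}"
    then have "S = {a}" using a(1) by blast
    then have "2 * Suc N = \<delta> a" using sumS by simp
    then show False using Suc.prems(3)[of a] by simp
  qed
  then obtain b where b: "b \<in> S - {a}" "\<And>c. c \<in> S - {a} \<Longrightarrow> \<bar>int a - int b\<bar> \<le> \<bar>int a - int c\<bar>"
    using ex_min_if_finite[of "(\<lambda>c. \<bar>int a - int c\<bar>) ` (S - {a})"] finS
    by (auto simp: not_less)
  define i j where "i = min a b" and "j = max a b"
  have ij: "i < j" "{i, j} = {a, b}" using b(1) by (auto simp: i_def j_def)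
  have gap: "\<delta> k = 0" if k: "i < k" "k < j" for k
  proof (rule ccontr)
    assume "\<delta> k \<noteq> 0"
    then have "k \<in> S - {a}" using k by (auto simp: S_def i_def j_def)
    then have "\<bar>int a - int b\<bar> \<le> \<bar>int a - int k\<bar>" by (rule b(2))
    then show False using k by (auto simp: i_def j_def min_def max_def split: if_splits)
  qed
  have pos: "\<delta> i > 0" "\<delta> j > 0"
  proof -
    have "i \<in> {a, b}" "j \<in> {a, b}" using ij(2) by blast+
    then show "\<delta> i > 0" "\<delta> j > 0" using a(1) b(1) by (auto simp: S_def)
  qed
  have small: "\<delta> k \<le> N" if k: "k \<noteq> i" "k \<noteq> j" for k
  proof (rule ccontr)
    assume "\<not> \<delta> k \<le> N"
    then have dk: "\<delta> k = Suc N" using Suc.prems(3)[of k] by simp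
    then have da: "\<delta> a = Suc N" using a(2) by blast
    have "k \<noteq> a" "k \<noteq> b" using k ij(2) by blast+
    moreover have "a \<noteq> b" using b(1) by blast
    ultimately have "(\<Sum>k\<in>{a, b, k}. \<delta> k) = Suc N + \<delta> b + Suc N" using dk da by simp
    moreover have "(\<Sum>k\<in>{a, b, k}. \<delta> k) \<le> (\<Sum>k\<in>S. \<delta> k)"
      using finS a(1) b(1) dk by (intro sum_mono2) (auto simp: S_def)
    moreover have "\<delta> b > 0" using b(1) by (simp add: S_def)
    ultimately show False using sumS by simp
  qed
  define \<delta>' where "\<delta>' = \<delta>(i := \<delta> i - 1, j := \<delta> j - 1)"
  have \<delta>: "\<delta> = \<delta>'(i := Suc (\<delta>' i), j := Suc (\<delta>' j))"
    using pos ij(1) by (auto simp: \<delta>'_def fun_eq_iff)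
  have lt: "i < m" "j < m" using pos Suc.prems(1) by (metis less_irrefl not_less)+
  have "(\<Sum>k<m. \<delta> k) = (\<Sum>k<m. \<delta>' k + (if k = i then 1 else 0) + (if k = j then 1 else 0))"
    using pos ij(1) by (intro sum.cong) (auto simp: \<delta>'_def)
  also have "\<dots> = (\<Sum>k<m. \<delta>' k) + 2" using lt by (simp add: sum.distrib)
  finally have "(\<Sum>k<m. \<delta>' k) = 2 * N" using Suc.prems(2) by simp
  moreover have "\<delta>' k = 0" if "k \<ge> m" for k using that lt Suc.prems(1) by (auto simp: \<delta>'_def)
  moreover have "\<delta>' k \<le> N" for k
    using small[of k] Suc.prems(3)[of i] Suc.prems(3)[of j] by (auto simp: \<delta>'_def)
  ultimately obtain p where "real_branched (Suc N) p \<delta>'" using Suc.IH by blast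
  moreover have "\<delta>' k = 0" if "i < k" "k < j" for k using gap[OF that] that by (simp add: \<delta>'_def)
  ultimately show ?case using real_branched_blow_up[OF _ ij(1)] \<delta> by metis
qed

text \<open>
  Rotating a point of the equator towards the pole \<open>(0, 1)\<close> leaves the equator.
\<close>

lemma nonreal_point:
  assumes M: "openin (top_of_set S2c) M" "M \<noteq> {}"
  obtains z where "z \<in> M" "snd z \<noteq> 0"
proof -
  obtain w where w: "w \<in> M" using M(2) by blast
  show ?thesis
  proof (cases "snd w = 0")
    case False
    then show ?thesis using that w by blast
  next
    case True
    have wS: "w \<in> S2c" using w M(1) openin_imp_subset by blast
    have nw: "(cmod (fst w))\<^sup>2 = 1" using wS True unfolding S2c_iff by simp
    define \<gamma> where "\<gamma> = (\<lambda>t::real. (of_real (cos t) * fst w, sin t))"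
    have \<gamma>S: "\<gamma> t \<in> S2c" for t
      unfolding S2c_iff using nw by (simp add: \<gamma>_def norm_mult power_mult_distrib)
    have "continuous_on UNIV \<gamma>" unfolding \<gamma>_def by (intro continuous_intros)
    then have "openin (top_of_set UNIV) (UNIV \<inter> \<gamma> -` M)"
      by (rule continuous_openin_preimage[OF _ _ M(1)]) (use \<gamma>S in blast)
    then have "open (\<gamma> -` M)" by simp
    moreover have "\<gamma> 0 = w" using True by (simp add: \<gamma>_def prod_eq_iff)
    then have "0 \<in> \<gamma> -` M" using w by simp
    ultimately obtain r where r: "r > 0" "ball 0 r \<subseteq> \<gamma> -` M" using open_contains_ball by blast
    define t where "t = min (r / 2) 1"
    have t: "0 < t" "t < r" "t \<le> 1" using r(1) by (auto simp: t_def)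
    then have "t \<in> ball 0 r" by simp
    then have "\<gamma> t \<in> M" using r(2) by blast
    moreover have "sin t > 0" using t pi_gt3 by (intro sin_gt_zero) auto
    ultimately show ?thesis using that[of "\<gamma> t"] by (simp add: \<gamma>_def)
  qed
qed

text \<open>
  Any homeomorphism between the two models of the sphere transports the map to \<open>S2\<close>, where the
  criterion for branched coverings applies.
\<close>

theorem branched_covering_of_real_branched:
  assumes rb: "real_branched d p \<delta>" and d: "d > 0" and fin: "finite {k. \<delta> k > 0}"
  obtains P h' where "branched_covering d P" "inj_on h' (range mark)"
    "critical_points P = h' ` mark ` {k. \<delta> k > 0}"
    "\<And>k. \<delta> k > 0 \<Longrightarrow> ramification_number P (h' (mark k)) = Suc (\<delta> k)"
proof -
  note [simp del] = mem_sphere mem_sphere_0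
  have p: "continuous_on S2c p" "p ` S2c \<subseteq> S2c"
    and pfin: "\<And>x. x \<in> S2c \<Longrightarrow> finite {y\<in>S2c. p y = x}"
    and pdeg: "\<And>x. x \<in> S2c \<Longrightarrow> snd x \<noteq> 0 \<Longrightarrow> card {y\<in>S2c. p y = x} = d"
    and pinj: "\<And>y. y \<in> S2c \<Longrightarrow> (\<And>k. \<delta> k > 0 \<Longrightarrow> y \<noteq> mark k) \<Longrightarrow> locally_injective_at S2c p y"
    using rb unfolding real_branched_def by blast+
  have "S2 homeomorphic S2c" by (rule homeomorphic_spheres_gen) simp_all
  then obtain h h' where hom: "homeomorphism S2 S2c h h'" unfolding homeomorphic_def by blast
  have h: "h x \<in> S2c" "h' (h x) = x" if "x \<in> S2" for x using hom that unfolding homeomorphism_def by blast+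
  have h': "h' x \<in> S2" "h (h' x) = x" if "x \<in> S2c" for x using hom that unfolding homeomorphism_def by blast+
  have ch: "continuous_on S2 h" "continuous_on S2c h'" using hom by (simp_all add: homeomorphism_def)
  have oh: "openin (top_of_set S2c) (h ` T)" if "openin (top_of_set S2) T" for T
    using homeomorphism_imp_open_map[OF hom that] .
  have oh': "openin (top_of_set S2) (h' ` T)" if "openin (top_of_set S2c) T" for T
    using homeomorphism_imp_open_map[OF homeomorphism_symD[OF hom] that] .
  define P where "P = (\<lambda>x. h' (p (h x)))"
  have pS: "p z \<in> S2c" if "z \<in> S2c" for z using p(2) that by blast
  have hP: "h (P x) = p (h x)" if "x \<in> S2" for x using h'(2)[OF pS[OF h(1)[OF that]]] by (simp add: P_def)
  have PS: "P x \<in> S2" if "x \<in> S2" for x using h'(1)[OF pS[OF h(1)[OF that]]] by (simp add: P_def)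
  have bij: "bij_betw h' {w\<in>W. p w = h x} {u\<in>h' ` W. P u = x}" if W: "W \<subseteq> S2c" and x: "x \<in> S2" for W x
    unfolding bij_betw_def
  proof
    show "inj_on h' {w\<in>W. p w = h x}"
      by (rule inj_on_inverseI[of _ h]) (use h'(2) W in blast)
    show "h' ` {w\<in>W. p w = h x} = {u\<in>h' ` W. P u = x}"
    proof (intro set_eqI iffI)
      fix u assume "u \<in> h' ` {w\<in>W. p w = h x}"
      then obtain w where w: "w \<in> W" "p w = h x" "u = h' w" by blast
      have "h u = w" using h'(2) w W by blast
      then show "u \<in> {u\<in>h' ` W. P u = x}" using w h(2)[OF x] by (auto simp: P_def)
    next
      fix u assume u: "u \<in> {u\<in>h' ` W. P u = x}"
      then obtain w where w: "w \<in> W" "u = h' w" by blast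
      have wS: "w \<in> S2c" using w W by blast
      then have "h u = w" "u \<in> S2" using h' w by blast+
      then have "p w = h x" using hP[of u] u by simp
      then show "u \<in> h' ` {w\<in>W. p w = h x}" using w by blast
    qed
  qed
  have im: "h' ` S2c = S2" using hom by (simp add: homeomorphism_def)
  have fib: "bij_betw h' {w\<in>S2c. p w = h x} {u\<in>S2. P u = x}" if "x \<in> S2" for x
    using bij[OF subset_refl that] unfolding im .
  define C where "C = h' ` mark ` {k. \<delta> k > 0}"
  have notC: "h y \<noteq> mark k" if "y \<in> S2" "y \<notin> C" "\<delta> k > 0" for y k
    using h(2)[OF that(1)] that(2,3) unfolding C_def by (metis (mono_tags, lifting) image_eqI mem_Collect_eq)
  interpret almost_local_homeomorphism P C d
  proof
    show "continuous_on S2 P"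
      unfolding P_def
      by (rule continuous_on_compose2[OF ch(2) continuous_on_compose2[OF p(1) ch(1)]]) (use h pS in blast)+
    show "P ` S2 \<subseteq> S2" using PS by blast
    show "finite C" using fin by (simp add: C_def)
    show "d > 0" by (rule d)
    show "finite {y\<in>S2. P y = x}" if "x \<in> S2" for x
      using bij_betw_finite[OF fib[OF that]] pfin[OF h(1)[OF that]] by simp
    show "\<exists>x\<in>N. card {y\<in>S2. P y = x} = d" if N: "openin (top_of_set S2) N" "N \<noteq> {}" for N
    proof -
      obtain z where z: "z \<in> h ` N" "snd z \<noteq> 0" using nonreal_point[OF oh[OF N(1)]] N(2) by blast
      then obtain x where x: "x \<in> N" "z = h x" by blast
      have xS: "x \<in> S2" using x(1) N(1) openin_imp_subset by blast
      have "card {y\<in>S2. P y = x} = d"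
        using bij_betw_same_card[OF fib[OF xS]] pdeg[OF h(1)[OF xS]] z(2) x(2) by simp
      then show ?thesis using x(1) by blast
    qed
    show "locally_injective_at S2 P y" if y: "y \<in> S2 - C" for y
    proof -
      have yS: "y \<in> S2" "y \<notin> C" using y by auto
      have "locally_injective_at S2c p (h y)"
        by (rule pinj[OF h(1)[OF yS(1)]]) (rule notC[OF yS])
      then obtain W where W: "openin (top_of_set S2c) W" "h y \<in> W" "inj_on p W"
        unfolding locally_injective_at_def by blast
      have WS: "W \<subseteq> S2c" using W(1) by (rule openin_imp_subset)
      have "y \<in> h' ` W" using W(2) h(2)[OF yS(1)] by (metis imageI)
      moreover have "inj_on P (h' ` W)"
      proof (rule inj_onI)
        fix u v assume uv: "u \<in> h' ` W" "v \<in> h' ` W" "P u = P v"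
        then obtain a b where ab: "a \<in> W" "u = h' a" "b \<in> W" "v = h' b" by blast
        then have S: "a \<in> S2c" "b \<in> S2c" using WS by blast+
        then have "p a = p b" using hP[OF h'(1), of a] hP[OF h'(1), of b] uv(3) ab h'(2) by metis
        then show "u = v" using W(3) ab by (metis inj_onD)
      qed
      ultimately show ?thesis unfolding locally_injective_at_def using oh'[OF W(1)] by blast
    qed
  qed
  have ram: "ramification_number P y = n" if y: "y \<in> S2" and lc: "local_count p (h y) n" for y n
  proof (rule ramification_number_eq_local_count[OF y])
    fix W assume W: "openin (top_of_set S2) W" "y \<in> W"
    obtain W' N where W': "openin (top_of_set S2c) W'" "h y \<in> W'" "W' \<subseteq> h ` W"
      and N: "openin (top_of_set S2c) N" "p (h y) \<in> N" "\<And>x. x \<in> N \<Longrightarrow> snd x \<noteq> 0 \<Longrightarrow> card {u\<in>W'. p u = x} = n"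
      using lc[unfolded local_count_def, rule_format, OF conjI[OF oh[OF W(1)] imageI[OF W(2)]]] by blast
    have W'S: "W' \<subseteq> S2c" using W'(1) by (rule openin_imp_subset)
    have WS: "W \<subseteq> S2" using W(1) by (rule openin_imp_subset)
    have "y \<in> h' ` W'" using W'(2) h(2)[OF y] by (metis imageI)
    moreover have "h' ` W' \<subseteq> W"
    proof
      fix u assume "u \<in> h' ` W'"
      then obtain v where "v \<in> W" "u = h' (h v)" using W'(3) by blast
      then show "u \<in> W" using h(2) WS by auto
    qed
    moreover have "\<exists>x\<in>N0 - {P y}. card {u\<in>h' ` W'. P u = x} = n"
      if N0: "openin (top_of_set S2) N0" "P y \<in> N0" for N0
    proof -
      let ?M = "N \<inter> h ` N0"
      have M: "openin (top_of_set S2c) ?M" using N(1) oh[OF N0(1)] by (rule openin_Int)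
      have "p (h y) \<in> ?M" using N(2) N0(2) hP[OF y] by (metis IntI imageI)
      then have "infinite ?M" using M by (intro infinite_openin_sphere) auto
      then have "?M - {p (h y)} \<noteq> {}" by (metis Diff_eq_empty_iff finite.emptyI finite_insert finite_subset)
      moreover have "openin (top_of_set S2c) (?M - {p (h y)})"
        using M by (intro openin_sphere_delete_finite) auto
      ultimately obtain z where z: "z \<in> ?M - {p (h y)}" "snd z \<noteq> 0" using nonreal_point by blast
      then obtain x where x: "x \<in> N0" "z = h x" by blast
      have xS: "x \<in> S2" using x(1) N0(1) openin_imp_subset by blast
      have "x \<noteq> P y" using z x(2) hP[OF y] by auto
      moreover have "card {u\<in>h' ` W'. P u = x} = n"
        using bij_betw_same_card[OF bij[OF W'S xS]] N(3)[of z] z x(2) by simp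
      ultimately show ?thesis using x(1) by blast
    qed
    ultimately show "\<exists>W'. openin (top_of_set S2) W' \<and> y \<in> W' \<and> W' \<subseteq> W \<and>
        (\<forall>N. openin (top_of_set S2) N \<longrightarrow> P y \<in> N \<longrightarrow> (\<exists>x\<in>N - {P y}. card {u\<in>W'. P u = x} = n))"
      using oh'[OF W'(1)] by blast
  qed
  have ram_mark: "ramification_number P (h' (mark k)) = Suc (\<delta> k)" for k
  proof (rule ram)
    show "h' (mark k) \<in> S2" by (rule h'(1)) simp
    have "h (h' (mark k)) = mark k" by (rule h'(2)) simp
    then show "local_count p (h (h' (mark k))) (Suc (\<delta> k))" using real_branched_local_count[OF rb] by simp
  qed
  have ram_other: "ramification_number P y = 1" if "y \<in> S2" "y \<notin> C" for y
  proof (rule ram[OF that(1)])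
    show "local_count p (h y) 1"
      by (rule local_count_locally_injective[OF p pinj[OF h(1)[OF that(1)]]]) (rule notC[OF that])
  qed
  show ?thesis
  proof (rule that[OF branched, of h'])
    show "inj_on h' (range mark)"
      by (rule inj_on_inverseI[of _ h]) (use h'(2) pt_simps(1) in blast)
    show "critical_points P = h' ` mark ` {k. \<delta> k > 0}"
    proof (intro set_eqI iffI)
      fix y assume "y \<in> critical_points P"
      then have "y \<in> S2" "ramification_number P y \<noteq> 1" by (auto simp: critical_points_def)
      then show "y \<in> h' ` mark ` {k. \<delta> k > 0}" using ram_other unfolding C_def by blast
    next
      fix y assume "y \<in> h' ` mark ` {k. \<delta> k > 0}"
      then obtain k where "\<delta> k > 0" "y = h' (mark k)" by blast
      then show "y \<in> critical_points P" using ram_mark h'(1)[OF pt_simps(1)] by (simp add: critical_points_def)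
    qed
    show "ramification_number P (h' (mark k)) = Suc (\<delta> k)" if "\<delta> k > 0" for k by (rule ram_mark)
  qed
qed

theorem theoremC:
  fixes d :: nat and l :: "nat list"
  assumes "d \<ge> 2"
    and "\<forall>a \<in> set l. 2 \<le> a \<and> a \<le> d"
  shows "(\<exists>p. branched_covering d p \<and> is_critical_ramification_list p l)
    \<longleftrightarrow> (\<Sum>a\<leftarrow>l. a - 1) = 2 * d - 2"
proof
  assume "\<exists>p. branched_covering d p \<and> is_critical_ramification_list p l"
  then obtain p ys where p: "branched_covering d p" "distinct ys" "set ys = critical_points p"
      "l = map (ramification_number p) ys"
    unfolding is_critical_ramification_list_def by blast
  have "(\<Sum>a\<leftarrow>l. a - 1) = (\<Sum>y\<in>critical_points p. ramification_number p y - 1)"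
    using p(2) by (simp add: p(4) p(3)[symmetric] sum_list_distinct_conv_sum_set comp_def)
  then show "(\<Sum>a\<leftarrow>l. a - 1) = 2 * d - 2" using riemann_hurwitz(2)[OF p(1) assms(1)] by simp
next
  assume sum: "(\<Sum>a\<leftarrow>l. a - 1) = 2 * d - 2"
  define \<delta> where "\<delta> = (\<lambda>k. if k < length l then l ! k - 1 else 0)"
  have l: "2 \<le> l ! k" "l ! k \<le> d" if "k < length l" for k using assms(2) that by auto
  have "\<delta> k > 0 \<longleftrightarrow> k < length l" for k
    using l(1)[of k] by (cases "k < length l") (simp_all add: \<delta>_def)
  then have supp: "{k. \<delta> k > 0} = {..<length l}" by blast
  have "(\<Sum>k<length l. \<delta> k) = 2 * (d - 1)"
    using sum by (simp add: sum_list_sum_nth \<delta>_def atLeast0LessThan right_diff_distrib')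
  moreover have "\<delta> k \<le> d - 1" for k using l(2) by (simp add: \<delta>_def diff_le_mono)
  ultimately obtain p where "real_branched (Suc (d - 1)) p \<delta>"
    using real_branched_exists[of "length l" \<delta> "d - 1"] by (auto simp: \<delta>_def)
  then have rb: "real_branched d p \<delta>" using assms(1) by simp
  obtain P h' where P: "branched_covering d P" "inj_on h' (range mark)"
    "critical_points P = h' ` mark ` {k. \<delta> k > 0}"
    "\<And>k. \<delta> k > 0 \<Longrightarrow> ramification_number P (h' (mark k)) = Suc (\<delta> k)"
    by (rule branched_covering_of_real_branched[OF rb]) (use assms(1) supp that in auto)
  let ?ys = "map (\<lambda>k. h' (mark k)) [0..<length l]"
  have "distinct ?ys"
    using P(2) by (auto simp: distinct_map inj_on_def)
  moreover have "set ?ys = critical_points P" by (auto simp: P(3) supp)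
  moreover have "l = map (ramification_number P) ?ys"
  proof (rule nth_equalityI)
    fix k assume k: "k < length l"
    then have "\<delta> k > 0" using supp by blast
    then show "l ! k = map (ramification_number P) ?ys ! k"
      using P(4)[of k] k l(1)[OF k] by (simp add: \<delta>_def)
  qed simp
  ultimately have "is_critical_ramification_list P l" unfolding is_critical_ramification_list_def by blast
  then show "\<exists>p. branched_covering d p \<and> is_critical_ramification_list p l" using P(1) by blast
qed

end
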